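(* Let $k\ge 2$ be an integer with $k\gamma_k^*>2$, and suppose that the mean LCS-function $\gamma_k:(-1,1)\to\mathbb{R}$ is differentiable at $p_M$. Let $1/2<\alpha<\beta<1$ and let $\gamma_k^a$ be any constant, independent of $d$, with $\gamma_k^a<\gamma_k^*$. Then there exist constants $C_E>0$ and $C_K>0$, independent of $d$, such that $$\mathbb{P}(E^d)\ \ge\ 1-e^{-C_E d^{2\alpha-1}}\qquad\text{and}\qquad \mathbb{P}(K^d)\ \ge\ 1-e^{-C_K d^{2\alpha-1}}$$ for all $d\ge 1$, where $$E^d=\left\{|LCS(X_1\ldots X_{d-(\ell/2)}X_{d+(\ell/2)+1}\ldots X_{2d};Y)|+d^{\alpha}>|LCS(X;Y)|\right\},$$ $$K^d=\left\{|LCS(X^*;Y)|-|LCS(X;Y)|\ \ge\ \frac{\gamma_k^a}{2}d^{\beta}-d^{\alpha}\right\}.$$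
   Context: For finite strings $x,y$, $|LCS(x;y)|$ denotes the length of a longest common subsequence (subsequences need not be contiguous). Mean LCS-function. Let $(U_i)_{i\ge1}$ and $(V_i)_{i\ge1}$ be two independent sequences of iid random variables uniformly distributed on an alphabet of size $k$. For $p\in(-1,1)$ put $$\gamma_k(n,p)=\frac{\mathbb{E}|LCS(U_1\ldots U_{n-np};V_1\ldots V_{n+np})|}{n},\qquad \gamma_k(p)=\lim_{n\to\infty}\gamma_k(n,p),$$ and $\gamma_k^*=\lim_{n\to\infty}\mathbb{E}|LCS(U_1\ldots U_n;V_1\ldots V_n)|/n=\gamma_k(0)$ (these limits exist). The function $\gamma_k$ is concave and symmetric about $0$, hence maximal at $0$. Let $p_M\in[0,1)$ be the largest real at which $\gamma_k$ attains its maximal value $\gamma_k(0)$, so that $[-p_M,p_M]=\gamma_k^{-1}(\{\gamma_k(0)\})$. Model. $X=X_1\ldots X_{2d}$ and $Y=Y_1\ldots Y_{2d}$ are two independent random strings of length $2d$ over an alphabet of size $k$. The string $Y$ is iid uniform. A long constant block of length $\ell=d^{\beta}$ ($\ell$ even) is inserted in the middle of $X$: almost surely $X_{d-(\ell/2)+1}=X_{d-(\ell/2)+2}=\cdots=X_{d+(\ell/2)}$. The strings $Y$, $X_1\ldots X_{d-(\ell/2)}$ and $X_{d+(\ell/2)+1}\ldots X_{2d}$ are three independent strings of iid uniform letters. The string $X^*=X_1^*\ldots X_{2d}^*$ is obtained from $X$ by replacing the constant block by iid uniform letters: $X_i^*=X_i$ for $i\in[1,d-(\ell/2)]\cup[d+(\ell/2)+1,2d]$,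 and the whole string $X^*$ is iid uniform and independent of $Y$. Convention: real numbers used as lengths or indices (such as $d^\alpha$, $d^\beta$, $n\pm np$) are understood to be rounded to the nearest positive integers, with $\ell$ taken even. *)

theory Defs
  imports "HOL-Probability.Probability" "HOL-Library.Sublist"
begin

text \<open>Letters are the natural numbers below \<open>k\<close>; strings are lists.  The library's
  \<open>subseq\<close> is the (not necessarily contiguous) subsequence relation.\<close>

definition lcs_length :: "'b list \<Rightarrow> 'b list \<Rightarrow> nat" where
  "lcs_length x y = Max {length z |z. subseq z x \<and> subseq z y}"

definition word :: "(nat \<Rightarrow> 'a \<Rightarrow> nat) \<Rightarrow> nat \<Rightarrow> nat \<Rightarrow> 'a \<Rightarrow> nat list" where
  "word Z i j \<omega> = map (\<lambda>m. Z m \<omega>) [i..<Suc j]"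

definition round_pos :: "real \<Rightarrow> nat" where
  "round_pos x = max 1 (nat (round x))"

text \<open>The even positive integer nearest to \<open>d\<^sup>\<beta>\<close>.\<close>

definition block_length :: "real \<Rightarrow> nat \<Rightarrow> nat" where
  "block_length \<beta> d = 2 * round_pos (real d powr \<beta> / 2)"

definition uniform_letters :: "nat \<Rightarrow> (nat \<Rightarrow> nat) measure" where
  "uniform_letters k = Pi\<^sub>M UNIV (\<lambda>_. uniform_count_measure {..<k})"

text \<open>On the product space below, \<open>U\<close> and \<open>V\<close> are the two independent sequences of
  iid uniform letters.\<close>

definition expected_lcs :: "nat \<Rightarrow> nat \<Rightarrow> nat \<Rightarrow> real" where
  "expected_lcs k a b =
     (\<integral>(U, V). real (lcs_length (map U [1..<Suc a]) (map V [1..<Suc b]))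
        \<partial>(uniform_letters k \<Otimes>\<^sub>M uniform_letters k))"

definition mean_lcs_n :: "nat \<Rightarrow> nat \<Rightarrow> real \<Rightarrow> real" where
  "mean_lcs_n k n p =
     expected_lcs k (round_pos (real n - real n * p)) (round_pos (real n + real n * p)) / real n"

text \<open>Only the values for \<open>p \<in> {-1<..<1}\<close> are meaningful.\<close>

definition mean_lcs :: "nat \<Rightarrow> real \<Rightarrow> real" where
  "mean_lcs k p = lim (\<lambda>n. mean_lcs_n k n p)"

definition mean_lcs_star :: "nat \<Rightarrow> real" where
  "mean_lcs_star k = lim (\<lambda>n. expected_lcs k n n / real n)"

definition p_M :: "nat \<Rightarrow> real" where
  "p_M k = (GREATEST p. p \<in> {-1<..<1} \<and> mean_lcs k p = mean_lcs k 0)"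

definition (in prob_space) iid_uniform :: "nat \<Rightarrow> nat set \<Rightarrow> (nat \<Rightarrow> 'a \<Rightarrow> nat) \<Rightarrow> bool" where
  "iid_uniform k I Z \<longleftrightarrow>
     indep_vars (\<lambda>_. count_space {..<k}) Z I \<and>
     (\<forall>i\<in>I. distr M (count_space {..<k}) (Z i) = uniform_count_measure {..<k})"

text \<open>Strings are indexed from 1; \<open>Xs\<close> is the string \<open>X\<^sup>*\<close>.  The letter filling the constant block is random with
  arbitrary law, and may depend on the rest of \<open>X\<close>.\<close>

locale long_block_model = prob_space M for M :: "'a measure" +
  fixes k d l :: nat and X Xs Y :: "nat \<Rightarrow> 'a \<Rightarrow> nat"
  assumes X_letters: "\<And>i. i \<in> {1..2 * d} \<Longrightarrow> X i \<in> measurable M (count_space {..<k})"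
    and X_Y_indep:
      "indep_var (count_space UNIV) (word X 1 (2 * d)) (count_space UNIV) (word Y 1 (2 * d))"
    and X_block: "AE \<omega> in M. \<forall>i\<in>{d - l div 2 + 1..d + l div 2}. X i \<omega> = X (d - l div 2 + 1) \<omega>"
    and Y_iid: "iid_uniform k {1..2 * d} Y"
    and X_left_iid: "iid_uniform k {1..d - l div 2} X"
    and X_right_iid: "iid_uniform k {d + l div 2 + 1..2 * d} X"
    and three_indep:
      "indep_vars (\<lambda>_. count_space UNIV)
         (\<lambda>j \<omega>. [word Y 1 (2 * d) \<omega>, word X 1 (d - l div 2) \<omega>,
                  word X (d + l div 2 + 1) (2 * d) \<omega>] ! j) {..<3}"
    and Xs_outside:
      "AE \<omega> in M. \<forall>i\<in>{1..d - l div 2} \<union> {d + l div 2 + 1..2 * d}. Xs i \<omega> = X i \<omega>"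
    and Xs_iid: "iid_uniform k {1..2 * d} Xs"
    and Xs_Y_indep:
      "indep_var (count_space UNIV) (word Xs 1 (2 * d)) (count_space UNIV) (word Y 1 (2 * d))"

text \<open>Only string lengths and indices are rounded; the thresholds \<open>d\<^sup>\<alpha>\<close> and \<open>d\<^sup>\<beta>\<close> in the
  events are exact reals.\<close>

definition event_E ::
  "real \<Rightarrow> nat \<Rightarrow> nat \<Rightarrow> 'a measure \<Rightarrow> (nat \<Rightarrow> 'a \<Rightarrow> nat) \<Rightarrow> (nat \<Rightarrow> 'a \<Rightarrow> nat) \<Rightarrow> 'a set" where
  "event_E \<alpha> d l M X Y =
     {\<omega> \<in> space M.
        real (lcs_length (word X 1 (d - l div 2) \<omega> @ word X (d + l div 2 + 1) (2 * d) \<omega>)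
                         (word Y 1 (2 * d) \<omega>)) + real d powr \<alpha>
        > real (lcs_length (word X 1 (2 * d) \<omega>) (word Y 1 (2 * d) \<omega>))}"

definition event_K ::
  "real \<Rightarrow> real \<Rightarrow> real \<Rightarrow> nat \<Rightarrow> 'a measure \<Rightarrow> (nat \<Rightarrow> 'a \<Rightarrow> nat) \<Rightarrow> (nat \<Rightarrow> 'a \<Rightarrow> nat) \<Rightarrow>
   (nat \<Rightarrow> 'a \<Rightarrow> nat) \<Rightarrow> 'a set" where
  "event_K \<alpha> \<beta> \<gamma>a d M X Xs Y =
     {\<omega> \<in> space M.
        real (lcs_length (word Xs 1 (2 * d) \<omega>) (word Y 1 (2 * d) \<omega>))
          - real (lcs_length (word X 1 (2 * d) \<omega>) (word Y 1 (2 * d) \<omega>))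
        \<ge> \<gamma>a / 2 * real d powr \<beta> - real d powr \<alpha>}"

end

theory Submission
  imports Defs "HOL-Real_Asymp.Real_Asymp"
begin

text \<open>
  Write \<open>e a b\<close> for the expected LCS of two independent uniform words of lengths \<open>a\<close>, \<open>b\<close>.  It is
  superadditive in \<open>(a, b)\<close>, so \<open>e (t a) (t b) / t\<close> converges to a concave, symmetric function
  \<open>F a b\<close>, homogeneous of degree one, and \<open>\<gamma>\<^sub>k(p) = F (1 - p) (1 + p)\<close>.

  A block of equal letters that faces \<open>h\<close> letters of \<open>Y\<close> matches about \<open>h / k\<close> of them, while the
  outer parts of \<open>X\<close> have an LCS of mean at most \<open>e (2d - \<ell>) (2d - h)\<close> with the rest of \<open>Y\<close>.
  Differentiability of \<open>\<gamma>\<^sub>k\<close> at \<open>p\<^sub>M\<close> gives, by symmetry, the right derivative \<open>0\<close> at \<open>0\<close>, so the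
  slope of \<open>F 1\<close> at \<open>1\<close> is \<open>\<gamma>\<^sub>k\<^sup>* / 2 > 1 / k\<close>; by concavity
  \<open>F (2d - \<ell>) (2d - h) + h / k \<le> F (2d - \<ell>) (2d)\<close> for all \<open>h\<close> once \<open>\<ell> / d\<close> is small.  With a
  union bound over the two cuts of \<open>Y\<close> and bounded differences, \<open>|LCS(X;Y)|\<close> is therefore at most
  \<open>F (2d - \<ell>) (2d) + o(d\<^sup>\<alpha>)\<close>.  Comparing with \<open>e (2d - \<ell>) (2d)\<close> gives \<open>E\<^sup>d\<close>, and with
  \<open>F (2d) (2d) \<ge> F (2d - \<ell>) (2d) + \<ell> \<gamma>\<^sub>k\<^sup>* / 2\<close> gives \<open>K\<^sup>d\<close>.

  Both comparisons need \<open>F a b - e a b = O(\<surd>a log a)\<close> along non-diagonal directions.  Cutting one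
  word into pieces of length \<open>a\<close> and bounding exponential moments shows that \<open>F a\<close> exceeds the
  concave hull of \<open>e a\<close> by at most \<open>O(\<surd>a log a)\<close>; a word of length \<open>2a\<close> can be cut so that one of the
  two halves sits at a point where \<open>e a\<close> touches its hull, hence the error at scale \<open>2a\<close> is that at
  scale \<open>a\<close> plus \<open>O(\<surd>a log a)\<close>, and these errors sum to a geometric series.

  For the finitely many remaining \<open>d\<close> it suffices that both events have positive probability,
  however \<open>X\<close> and \<open>X\<^sup>*\<close> are coupled: for \<open>E\<^sup>d\<close> let \<open>Y\<close> be constant and different from the block
  letter, for \<open>K\<^sup>d\<close> let \<open>X\<^sup>* = Y = 0\<^sup>d1\<^sup>d\<close>.
\<close>

section \<open>Longest common subsequences\<close>

lemma finite_common_subseq_lengths: "finite {length z |z. subseq z x \<and> subseq z y}"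
proof (rule finite_subset)
  show "{length z |z. subseq z x \<and> subseq z y} \<subseteq> {..length x}"
    by (auto intro: list_emb_length)
qed auto

lemma lcs_length_ge: "subseq z x \<Longrightarrow> subseq z y \<Longrightarrow> length z \<le> lcs_length x y"
  unfolding lcs_length_def by (rule Max_ge[OF finite_common_subseq_lengths]) auto

lemma lcs_length_attained:
  obtains z where "subseq z x" "subseq z y" "length z = lcs_length x y"
proof -
  have "lcs_length x y \<in> {length z |z. subseq z x \<and> subseq z y}"
    unfolding lcs_length_def
    by (rule Max_in[OF finite_common_subseq_lengths]) (auto intro!: exI[of _ "[]"])
  then show ?thesis using that by auto
qed

lemma lcs_length_commute: "lcs_length x y = lcs_length y x"
  unfolding lcs_length_def by (metis (no_types, lifting) conj_commute)

lemma lcs_length_mono: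
  assumes "subseq x x'" "subseq y y'"
  shows "lcs_length x y \<le> lcs_length x' y'"
  by (metis assms lcs_length_attained lcs_length_ge subseq_order.trans)

lemma lcs_length_append:
  "lcs_length x y + lcs_length x' y' \<le> lcs_length (x @ x') (y @ y')"
proof -
  obtain z where z: "subseq z x" "subseq z y" "length z = lcs_length x y"
    by (rule lcs_length_attained)
  obtain z' where z': "subseq z' x'" "subseq z' y'" "length z' = lcs_length x' y'"
    by (rule lcs_length_attained)
  have "length (z @ z') \<le> lcs_length (x @ x') (y @ y')"
    by (intro lcs_length_ge list_emb_append_mono z z')
  then show ?thesis using z z' by simp
qed

lemma lcs_length_le1: "lcs_length x y \<le> length x"
  by (metis lcs_length_attained list_emb_length)

lemma lcs_length_same: "lcs_length x x = length x"
  by (meson lcs_length_ge lcs_length_le1 le_antisym subseq_order.refl)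

text \<open>An optimal common subsequence is cut where it passes from \<open>x\<close> to
  \<open>x'\<close>; an embedding of its two parts into \<open>y\<close> determines the cut of
  \<open>y\<close>.\<close>

lemma lcs_length_split:
  obtains i where "i \<le> length y"
    "lcs_length (x @ x') y \<le> lcs_length x (take i y) + lcs_length x' (drop i y)"
proof -
  obtain z where z: "subseq z (x @ x')" "subseq z y" "length z = lcs_length (x @ x') y"
    by (rule lcs_length_attained)
  from z(1) obtain z1 z2 where zz: "z = z1 @ z2" "subseq z1 x" "subseq z2 x'"
    by (auto simp: subseq_append_iff)
  from z(2) obtain y1 y2 where yy: "y = y1 @ y2" "subseq z1 y1" "subseq z2 y2"
    unfolding zz(1) by (metis list_emb_appendD)
  have "length z1 + length z2 \<le> lcs_length x y1 + lcs_length x' y2"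
    by (intro add_mono lcs_length_ge zz yy)
  then show ?thesis
    using that[of "length y1"] z(3) yy(1) zz(1) by simp
qed

lemma lcs_length_append_le: "lcs_length x (y @ y') \<le> lcs_length x y + length y'"
proof -
  obtain i where "lcs_length (y @ y') x \<le> lcs_length y (take i x) + lcs_length y' (drop i x)"
    by (rule lcs_length_split)
  also have "\<dots> \<le> lcs_length y x + length y'"
    by (intro add_mono lcs_length_le1 lcs_length_mono) (auto intro: take_is_prefix)
  finally show ?thesis by (simp add: lcs_length_commute)
qed

text \<open>A subsequence of a constant word uses only the letter \<open>c\<close>, so it survives
  filtering \<open>y\<close> for \<open>c\<close>.\<close>

lemma lcs_length_replicate_le: "lcs_length (replicate l c) y \<le> count_list y c"
proof -
  obtain z where z: "subseq z (replicate l c)" "subseq z y"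
    "length z = lcs_length (replicate l c) y"
    by (rule lcs_length_attained)
  have "set z \<subseteq> {c}"
    using z(1) by (auto elim!: list_emb_set)
  then have "filter ((=) c) z = z" by (intro filter_True) auto
  then have "subseq z (filter ((=) c) y)" using subseq_filter[OF z(2), of "(=) c"] by simp
  then have "length z \<le> length (filter ((=) c) y)" by (rule list_emb_length)
  then show ?thesis by (simp add: z(3) count_list_eq_length_filter)
qed

text \<open>The score of the alignments of \<open>x @ replicate l c @ x'\<close> with \<open>y\<close> in which the block
  faces the letters \<open>i + 1, \<dots>, j\<close> of \<open>y\<close>.\<close>

definition block_score :: "nat \<Rightarrow> nat \<Rightarrow> 'b \<Rightarrow> 'b list \<Rightarrow> 'b list \<Rightarrow> 'b list \<Rightarrow> nat" where
  "block_score i j c x x' y =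
     lcs_length x (take i y) + count_list (drop i (take j y)) c + lcs_length x' (drop j y)"

text \<open>Two successive cuts of \<open>y\<close>. There are only quadratically many pairs
  \<open>(i, j)\<close>, few enough for a union bound against exponential tails.\<close>

lemma lcs_length_block_split:
  obtains i j where "i \<le> j" "j \<le> length y"
    "lcs_length (x @ replicate l c @ x') y \<le> block_score i j c x x' y"
proof -
  obtain i where i: "i \<le> length y"
    "lcs_length (x @ replicate l c @ x') y \<le> lcs_length x (take i y) + lcs_length (replicate l c @ x') (drop i y)"
    by (rule lcs_length_split)
  obtain j where j: "j \<le> length (drop i y)" "lcs_length (replicate l c @ x') (drop i y)
      \<le> lcs_length (replicate l c) (take j (drop i y)) + lcs_length x' (drop j (drop i y))"
    by (rule lcs_length_split)
  have "lcs_length (replicate l c) (take j (drop i y)) \<le> count_list (drop i (take (i + j) y)) c"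
    by (metis drop_take add_diff_cancel_left' lcs_length_replicate_le)
  then show ?thesis
    using that[of i "i + j"] i j by (simp add: add.commute block_score_def)
qed

section \<open>Hamming distance and bounded differences\<close>

text \<open>\<open>zip\<close> truncates the longer list, so this is the Hamming distance only
  between lists of equal length.\<close>

definition hamming :: "'b list \<Rightarrow> 'b list \<Rightarrow> nat" where
  "hamming x y = length (filter (\<lambda>(a, b). a \<noteq> b) (zip x y))"

lemma hamming_simps [simp]:
  "hamming [] y = 0"
  "hamming (a # x) (b # y) = of_bool (a \<noteq> b) + hamming x y"
  by (auto simp: hamming_def)

lemma hamming_same [simp]: "hamming x x = 0"
  by (induction x) auto

lemma hamming_commute: "length x = length y \<Longrightarrow> hamming x y = hamming y x"
  by (induction x y rule: list_induct2) auto

lemma hamming_take_drop: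
  assumes "length x = length y"
  shows "hamming x y = hamming (take n x) (take n y) + hamming (drop n x) (drop n y)"
proof -
  have "zip x y = zip (take n x) (take n y) @ zip (drop n x) (drop n y)"
    using assms by (metis append_take_drop_id take_zip drop_zip)
  then show ?thesis by (simp add: hamming_def)
qed

text \<open>The bounded-differences condition with constant 1 for each letter. Symmetry of the
  distance turns the one-sided inequality into a bound in both directions.\<close>

definition hamming_lipschitz :: "('b list \<Rightarrow> real) \<Rightarrow> bool" where
  "hamming_lipschitz f \<longleftrightarrow>
     (\<forall>x y. length x = length y \<longrightarrow> f x \<le> f y + real (hamming x y))"

lemma hamming_lipschitzD:
  assumes "hamming_lipschitz f" "length x = length y"
  shows "f x \<le> f y + real (hamming x y)"
  using assms by (auto simp: hamming_lipschitz_def)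

lemma hamming_lipschitz_uminus:
  assumes "hamming_lipschitz f" shows "hamming_lipschitz (\<lambda>w. - f w)"
  unfolding hamming_lipschitz_def
proof (intro allI impI)
  fix x y :: "'a list" assume l: "length x = length y"
  have "f y \<le> f x + real (hamming y x)"
    using assms l by (simp add: hamming_lipschitz_def)
  then show "- f x \<le> - f y + real (hamming x y)" using hamming_commute[OF l] by simp
qed

lemma hamming_lipschitz_Cons:
  assumes "hamming_lipschitz f" shows "hamming_lipschitz (\<lambda>w. f (c # w))"
  unfolding hamming_lipschitz_def
proof (intro allI impI)
  fix x y :: "'a list" assume "length x = length y"
  then show "f (c # x) \<le> f (c # y) + real (hamming x y)"
    using hamming_lipschitzD[OF assms, of "c # x" "c # y"] by simp
qed

text \<open>Deleting from \<open>z\<close> the letters embedded at positions where \<open>x\<close>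
  and \<open>y\<close> differ leaves a subsequence of \<open>y\<close>.\<close>

lemma subseq_hamming:
  assumes "length x = length y" "subseq z x"
  shows "\<exists>z'. subseq z' z \<and> subseq z' y \<and> length z \<le> length z' + hamming x y"
  using assms
proof (induction x y arbitrary: z rule: list_induct2)
  case Nil
  then show ?case by auto
next
  case (Cons a x b y)
  from \<open>subseq z (a # x)\<close> consider "subseq z x" | z2 where "z = a # z2" "subseq z2 x"
    by cases auto
  then show ?case
  proof cases
    case 1
    then obtain z' where "subseq z' z" "subseq z' y" "length z \<le> length z' + hamming x y"
      using Cons.IH by blast
    then show ?thesis by (intro exI[of _ z']) auto
  next
    case 2
    then obtain z' where z': "subseq z' z2" "subseq z' y" "length z2 \<le> length z' + hamming x y"
      using Cons.IH by blast
    show ?thesis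
    proof (cases "a = b")
      case True
      then show ?thesis using z' 2 by (intro exI[of _ "a # z'"]) auto
    next
      case False
      then show ?thesis using z' 2 by (intro exI[of _ z']) auto
    qed
  qed
qed

lemma lcs_length_hamming1:
  assumes "length x = length x'"
  shows "lcs_length x y \<le> lcs_length x' y + hamming x x'"
proof -
  obtain z where z: "subseq z x" "subseq z y" "length z = lcs_length x y"
    by (rule lcs_length_attained)
  obtain z' where z': "subseq z' z" "subseq z' x'" "length z \<le> length z' + hamming x x'"
    using subseq_hamming[OF assms z(1)] by blast
  have "length z' \<le> lcs_length x' y"
    using z' z by (intro lcs_length_ge) (auto intro: subseq_order.trans)
  then show ?thesis using z z' by simp
qed

lemma lcs_length_hamming:
  assumes "length x = length x'" "length y = length y'"
  shows "lcs_length x y \<le> lcs_length x' y' + hamming x x' + hamming y y'"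
  using lcs_length_hamming1[OF assms(1), of y] lcs_length_hamming1[OF assms(2), of x']
  by (simp add: lcs_length_commute)

lemma count_list_hamming:
  assumes "length x = length y"
  shows "count_list x c \<le> count_list y c + hamming x y"
  using assms by (induction x y rule: list_induct2) auto

text \<open>A pair of words is coded as a single word cut at \<open>a\<close>, so that one
  concentration inequality covers functions of both words.\<close>

lemma hamming_lipschitz_lcs:
  "hamming_lipschitz (\<lambda>w. real (lcs_length (take a w) (drop a w)))"
  unfolding hamming_lipschitz_def
proof (intro allI impI)
  fix x y :: "'a list" assume l: "length x = length y"
  have "lcs_length (take a x) (drop a x) \<le> lcs_length (take a y) (drop a y) + hamming x y"
    using lcs_length_hamming[of "take a x" "take a y" "drop a x" "drop a y"]
      hamming_take_drop[OF l, of a] l by simp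
  then show "real (lcs_length (take a x) (drop a x))
      \<le> real (lcs_length (take a y) (drop a y)) + real (hamming x y)" by linarith
qed

text \<open>The five pieces occupy disjoint sets of positions of \<open>w\<close>, so the changes of
  the three summands add up to at most one Hamming distance.\<close>

lemma hamming_lipschitz_block_score:
  assumes "i \<le> j" "m \<le> a"
  shows "hamming_lipschitz
    (\<lambda>w. real (block_score i j c (take m w) (drop m (take a w)) (drop a w)))"
  unfolding hamming_lipschitz_def
proof (intro allI impI)
  fix w v :: "'a list" assume l: "length w = length v"
  let ?x = "take m w" and ?x' = "drop m (take a w)" and ?y = "drop a w"
  let ?u = "take m v" and ?u' = "drop m (take a v)" and ?z = "drop a v"
  have "hamming ?x ?u + hamming ?x' ?u' + hamming ?y ?z \<le> hamming w v"
  proof -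
    have "hamming (take a w) (take a v) = hamming ?x ?u + hamming ?x' ?u'"
      using hamming_take_drop[of "take a w" "take a v" m] l assms by (simp add: min_absorb1)
    then show ?thesis using hamming_take_drop[OF l, of a] by simp
  qed
  moreover have "hamming ?y ?z = hamming (take i ?y) (take i ?z)
      + hamming (drop i (take j ?y)) (drop i (take j ?z)) + hamming (drop j ?y) (drop j ?z)"
    using hamming_take_drop[of ?y ?z j] hamming_take_drop[of "take j ?y" "take j ?z" i] l assms
    by (simp add: min_absorb1)
  ultimately have "block_score i j c ?x ?x' ?y \<le> block_score i j c ?u ?u' ?z + hamming w v"
    using lcs_length_hamming[of ?x ?u "take i ?y" "take i ?z"] l
      count_list_hamming[of "drop i (take j ?y)" "drop i (take j ?z)" c]
      lcs_length_hamming[of ?x' ?u' "drop j ?y" "drop j ?z"]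
    by (simp add: block_score_def)
  then show "real (block_score i j c ?x ?x' ?y)
      \<le> real (block_score i j c ?u ?u' ?z) + real (hamming w v)" by linarith
qed

section \<open>Averages over words\<close>

definition words :: "nat \<Rightarrow> nat \<Rightarrow> nat list set" where
  "words k n = {w. length w = n \<and> set w \<subseteq> {..<k}}"

lemma finite_words [simp]: "finite (words k n)"
  using finite_lists_length_eq[of "{..<k}" n] by (simp add: words_def conj_commute)

lemma card_words: "card (words k n) = k ^ n"
  using card_lists_length_eq[of "{..<k}" n] by (simp add: words_def conj_commute)

lemma length_words: "w \<in> words k n \<Longrightarrow> length w = n"
  by (simp add: words_def)

text \<open>Expectations over uniform words are kept as finite sums;
  \<open>uniform_word_expectation\<close> and \<open>uniform_word_prob\<close> later connect them to
  random words.\<close>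

definition avg :: "nat \<Rightarrow> nat \<Rightarrow> (nat list \<Rightarrow> real) \<Rightarrow> real" where
  "avg k n f = (\<Sum>w\<in>words k n. f w) / real k ^ n"

lemma avg_cong: "(\<And>w. w \<in> words k n \<Longrightarrow> f w = g w) \<Longrightarrow> avg k n f = avg k n g"
  unfolding avg_def by (simp cong: sum.cong)

lemma avg_mono: "(\<And>w. w \<in> words k n \<Longrightarrow> f w \<le> g w) \<Longrightarrow> avg k n f \<le> avg k n g"
  unfolding avg_def by (intro divide_right_mono sum_mono) auto

lemma avg_const [simp]: "k > 0 \<Longrightarrow> avg k n (\<lambda>_. c) = c"
  by (simp add: avg_def card_words)

lemma avg_add: "avg k n (\<lambda>w. f w + g w) = avg k n f + avg k n g"
  by (simp add: avg_def sum.distrib add_divide_distrib)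

lemma avg_diff: "avg k n (\<lambda>w. f w - g w) = avg k n f - avg k n g"
  by (simp add: avg_def sum_subtractf diff_divide_distrib)

lemma avg_cmult: "avg k n (\<lambda>w. c * f w) = c * avg k n f"
  by (simp add: avg_def sum_distrib_left)

lemma avg_cmult_right: "avg k n (\<lambda>w. f w * c) = avg k n f * c"
  by (simp add: avg_def sum_distrib_right)

lemma avg_uminus: "avg k n (\<lambda>w. - f w) = - avg k n f"
  by (simp add: avg_def sum_negf)

lemma avg_sum: "avg k n (\<lambda>w. \<Sum>i\<in>I. f i w) = (\<Sum>i\<in>I. avg k n (f i))"
  unfolding avg_def by (simp add: sum.swap[of _ I] sum_divide_distrib)

lemma avg_nonneg: "(\<And>w. w \<in> words k n \<Longrightarrow> 0 \<le> f w) \<Longrightarrow> 0 \<le> avg k n f"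
  unfolding avg_def by (intro divide_nonneg_nonneg sum_nonneg) auto

lemma avg_swap: "avg k n (\<lambda>u. avg k m (\<lambda>v. f u v)) = avg k m (\<lambda>v. avg k n (\<lambda>u. f u v))"
  unfolding avg_def by (simp add: sum_divide_distrib[symmetric] sum.swap[of _ "words k n"] mult.commute)

lemma bij_betw_words_append:
  "bij_betw (\<lambda>(u, v). u @ v) (words k a \<times> words k b) (words k (a + b))"
proof (rule bij_betwI[where g = "\<lambda>w. (take a w, drop a w)"])
  show "(\<lambda>w. (take a w, drop a w)) \<in> words k (a + b) \<rightarrow> words k a \<times> words k b"
    by (auto simp: words_def dest: in_set_takeD in_set_dropD)
qed (auto simp: words_def)

lemma avg_append: "avg k (a + b) f = avg k a (\<lambda>u. avg k b (\<lambda>v. f (u @ v)))"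
proof -
  have "(\<Sum>w\<in>words k (a + b). f w) = (\<Sum>(u, v)\<in>words k a \<times> words k b. f (u @ v))"
    using sum.reindex_bij_betw[OF bij_betw_words_append, of f k a b]
    by (simp add: case_prod_unfold)
  also have "\<dots> = (\<Sum>u\<in>words k a. \<Sum>v\<in>words k b. f (u @ v))"
    by (simp add: sum.cartesian_product)
  finally show ?thesis
    by (simp add: avg_def sum_divide_distrib power_add field_simps)
qed

lemma words_1: "words k 1 = (\<lambda>c. [c]) ` {..<k}"
  by (auto simp: words_def length_Suc_conv)

lemma avg_1: "avg k 1 f = (\<Sum>c<k. f [c]) / k"
  unfolding avg_def words_1 by (subst sum.reindex) (auto simp: inj_on_def)

lemma avg_0 [simp]: "avg k 0 f = f []"
proof -
  have "words k 0 = {[]}" by (auto simp: words_def)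
  then show ?thesis by (simp add: avg_def)
qed

lemma avg_Suc: "avg k (Suc n) f = (\<Sum>c<k. avg k n (\<lambda>w. f (c # w))) / k"
  using avg_append[of k 1 n f] avg_1[of k "\<lambda>u. avg k n (\<lambda>v. f (u @ v))"] by simp

lemma avg_take:
  assumes "k > 0" shows "avg k (n + m) (\<lambda>w. f (take n w)) = avg k n f"
proof -
  have "avg k (n + m) (\<lambda>w. f (take n w)) = avg k n (\<lambda>u. avg k m (\<lambda>v. f u))"
    unfolding avg_append by (intro avg_cong) (simp add: length_words)
  then show ?thesis using assms by simp
qed

lemma avg_drop:
  assumes "k > 0" shows "avg k (n + m) (\<lambda>w. f (drop n w)) = avg k m f"
proof -
  have "avg k (n + m) (\<lambda>w. f (drop n w)) = avg k n (\<lambda>u. avg k m (\<lambda>v. f v))"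
    unfolding avg_append by (intro avg_cong) (simp add: length_words)
  then show ?thesis using assms by simp
qed

section \<open>Concentration for Lipschitz functions of a uniform word\<close>

lemma exp_le_quadratic:
  fixes z :: real assumes "\<bar>z\<bar> \<le> 1" shows "exp z \<le> 1 + z + z\<^sup>2"
proof (cases "z \<ge> 0")
  case True
  then show ?thesis using exp_bound[of z] assms by simp
next
  case False
  define y where "y = - z"
  have y: "0 \<le> y" using False by (simp add: y_def)
  \<comment> \<open>With \<open>z = - y\<close> the claim becomes
    \<open>1 \<le> (1 - y + y^2) * exp y\<close>; replacing \<open>exp y\<close> by its quadratic
    Taylor polynomial, a lower bound, already suffices.\<close>
  have "1 \<le> (1 - y + y\<^sup>2) * (1 + y + y\<^sup>2 / 2)"
  proof -
    have "(1 - y + y\<^sup>2) * (1 + y + y\<^sup>2 / 2) = 1 + (y\<^sup>2 + y ^ 3 + y ^ 4) / 2"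
      by (simp add: power2_eq_square power3_eq_cube power4_eq_xxxx field_simps)
    then show ?thesis using y by simp
  qed
  also have "\<dots> \<le> (1 - y + y\<^sup>2) * exp y"
  proof (intro mult_left_mono exp_lower_Taylor_quadratic y)
    have "1 - y + y\<^sup>2 = (1 / 2 - y)\<^sup>2 + 3 / 4" by (simp add: power2_eq_square field_simps)
    then show "0 \<le> 1 - y + y\<^sup>2" by simp
  qed
  finally show ?thesis by (simp add: y_def exp_minus field_simps)
qed

text \<open>Induction on the length, revealing the first letter: the conditional means
  \<open>g c\<close> differ by at most 1, and the term of \<open>exp_le_quadratic\<close> that is
  linear in \<open>g c - m\<close> averages to 0. Each letter contributes one factor
  \<open>exp (\<theta>\<^sup>2)\<close>.\<close>

lemma hoeffding_avg:
  assumes k: "k > 0" and f: "hamming_lipschitz f" and th: "\<bar>\<theta>\<bar> \<le> 1"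
  shows "avg k n (\<lambda>w. exp (\<theta> * f w)) \<le> exp (\<theta> * avg k n f + \<theta>\<^sup>2 * n)"
  using f
proof (induction n arbitrary: f)
  case 0
  then show ?case by simp
next
  case (Suc n)
  define g where "g c = avg k n (\<lambda>w. f (c # w))" for c
  define m where "m = (\<Sum>c<k. g c) / k"
  have m: "avg k (Suc n) f = m" by (simp add: avg_Suc g_def m_def)
  have gg: "g c \<le> g c' + 1" for c c'
  proof -
    have "g c \<le> avg k n (\<lambda>w. f (c' # w) + 1)"
      unfolding g_def
    proof (rule avg_mono)
      fix w
      show "f (c # w) \<le> f (c' # w) + 1"
        using hamming_lipschitzD[OF Suc.prems, of "c # w" "c' # w"] by (cases "c = c'") auto
    qed
    then show ?thesis using k by (simp add: avg_add g_def)
  qed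
  have dev: "\<bar>g c - m\<bar> \<le> 1" for c
  proof -
    have "(\<Sum>c'<k. g c) \<le> (\<Sum>c'<k. g c' + 1)"
      by (intro sum_mono gg)
    moreover have "(\<Sum>c'<k. g c') \<le> (\<Sum>c'<k. g c + 1)"
      by (intro sum_mono gg)
    ultimately show ?thesis
      using k by (simp add: m_def sum.distrib sum_subtractf abs_le_iff field_simps)
  qed
  have msum: "(\<Sum>c<k. g c - m) = 0"
    using k by (simp add: m_def sum_subtractf)
  have "avg k (Suc n) (\<lambda>w. exp (\<theta> * f w))
      \<le> (\<Sum>c<k. exp (\<theta> * g c + \<theta>\<^sup>2 * n)) / k"
    unfolding avg_Suc g_def
    by (intro divide_right_mono sum_mono Suc.IH hamming_lipschitz_Cons Suc.prems) auto
  also have "\<dots> \<le> (\<Sum>c<k. exp (\<theta> * m + \<theta>\<^sup>2 * n) * (1 + \<theta> * (g c - m) + \<theta>\<^sup>2)) / k"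
  proof (intro divide_right_mono sum_mono)
    fix c
    have "\<bar>\<theta> * (g c - m)\<bar> \<le> 1"
      using mult_mono[OF th dev[of c]] by (simp add: abs_mult)
    then have "exp (\<theta> * (g c - m)) \<le> 1 + \<theta> * (g c - m) + (\<theta> * (g c - m))\<^sup>2"
      by (rule exp_le_quadratic)
    also have "(\<theta> * (g c - m))\<^sup>2 \<le> \<theta>\<^sup>2"
      using dev[of c] by (simp add: power_mult_distrib abs_square_le_1 mult_left_le)
    finally have "exp (\<theta> * m + \<theta>\<^sup>2 * n) * exp (\<theta> * (g c - m))
        \<le> exp (\<theta> * m + \<theta>\<^sup>2 * n) * (1 + \<theta> * (g c - m) + \<theta>\<^sup>2)" by simp
    then show "exp (\<theta> * g c + \<theta>\<^sup>2 * n)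
        \<le> exp (\<theta> * m + \<theta>\<^sup>2 * n) * (1 + \<theta> * (g c - m) + \<theta>\<^sup>2)"
      by (simp add: exp_add[symmetric] algebra_simps)
  qed simp
  also have "\<dots> = exp (\<theta> * m + \<theta>\<^sup>2 * n) * (1 + \<theta>\<^sup>2)"
  proof -
    have "(\<Sum>c<k. exp (\<theta> * m + \<theta>\<^sup>2 * n) * (1 + \<theta> * (g c - m) + \<theta>\<^sup>2))
        = exp (\<theta> * m + \<theta>\<^sup>2 * n) * (k + \<theta> * (\<Sum>c<k. g c - m) + k * \<theta>\<^sup>2)"
      by (simp only: sum_distrib_left[symmetric] sum.distrib) simp
    then show ?thesis using k by (simp add: msum field_simps)
  qed
  also have "\<dots> \<le> exp (\<theta> * m + \<theta>\<^sup>2 * n) * exp (\<theta>\<^sup>2)"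
    using exp_ge_add_one_self[of "\<theta>\<^sup>2"] by simp
  also have "\<dots> = exp (\<theta> * m + \<theta>\<^sup>2 * Suc n)"
    by (simp add: exp_add[symmetric] algebra_simps)
  finally show ?case unfolding m .
qed

definition freq :: "nat \<Rightarrow> nat \<Rightarrow> (nat list \<Rightarrow> bool) \<Rightarrow> real" where
  "freq k n P = avg k n (\<lambda>w. of_bool (P w))"

lemma freq_mono: "(\<And>w. w \<in> words k n \<Longrightarrow> P w \<Longrightarrow> Q w) \<Longrightarrow> freq k n P \<le> freq k n Q"
  unfolding freq_def by (intro avg_mono) auto

lemma freq_disj_le: "freq k n (\<lambda>w. P w \<or> Q w) \<le> freq k n P + freq k n Q"
  unfolding freq_def avg_add[symmetric] by (intro avg_mono) auto

lemma freq_Bex_le: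
  assumes "finite I"
  shows "freq k n (\<lambda>w. \<exists>i\<in>I. P i w) \<le> (\<Sum>i\<in>I. freq k n (P i))"
  unfolding freq_def avg_sum[symmetric]
proof (rule avg_mono)
  fix w
  show "of_bool (\<exists>i\<in>I. P i w) \<le> (\<Sum>i\<in>I. of_bool (P i w) :: real)"
  proof (cases "\<exists>i\<in>I. P i w")
    case True
    then obtain i where i: "i \<in> I" "P i w" by blast
    then have "(\<Sum>i\<in>{i}. of_bool (P i w)) \<le> (\<Sum>i\<in>I. of_bool (P i w) :: real)"
      using assms by (intro sum_mono2) auto
    then show ?thesis using i True by simp
  qed (simp add: sum_nonneg)
qed

lemma freq_upper_tail:
  assumes k: "k > 0" and f: "hamming_lipschitz f" and t: "0 \<le> t" "t \<le> 2 * real n" and n: "n > 0"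
  shows "freq k n (\<lambda>w. f w \<ge> avg k n f + t) \<le> exp (- (t\<^sup>2 / (4 * real n)))"
proof -
  \<comment> \<open>This value minimises \<open>- \<theta> * t + \<theta>\<^sup>2 * n\<close>, and
    \<open>t \<le> 2 * n\<close> keeps it at most 1.\<close>
  define \<theta> where "\<theta> = t / (2 * real n)"
  have th: "0 \<le> \<theta>" "\<bar>\<theta>\<bar> \<le> 1" using t n by (auto simp: \<theta>_def)
  have "freq k n (\<lambda>w. f w \<ge> avg k n f + t)
      \<le> avg k n (\<lambda>w. exp (- \<theta> * (avg k n f + t)) * exp (\<theta> * f w))"
    unfolding freq_def
  proof (rule avg_mono)
    fix w
    show "of_bool (f w \<ge> avg k n f + t) \<le> exp (- \<theta> * (avg k n f + t)) * exp (\<theta> * f w)"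
    proof (cases "f w \<ge> avg k n f + t")
      case True
      then have "\<theta> * (avg k n f + t) \<le> \<theta> * f w" using th by (intro mult_left_mono)
      then show ?thesis using True by (simp add: exp_add[symmetric])
    qed simp
  qed
  also have "\<dots> \<le> exp (- \<theta> * (avg k n f + t)) * exp (\<theta> * avg k n f + \<theta>\<^sup>2 * n)"
    unfolding avg_cmult by (intro mult_left_mono hoeffding_avg k f th) auto
  also have "\<dots> = exp (- \<theta> * t + \<theta>\<^sup>2 * n)"
    by (simp add: exp_add[symmetric] algebra_simps)
  also have "- \<theta> * t + \<theta>\<^sup>2 * n = - (t\<^sup>2 / (4 * real n))"
    using n by (simp add: \<theta>_def field_simps power2_eq_square)
  finally show ?thesis .
qed

lemma freq_lower_tail:
  assumes "k > 0" and "hamming_lipschitz f" and "0 \<le> t" "t \<le> 2 * real n" and "n > 0"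
  shows "freq k n (\<lambda>w. f w \<le> avg k n f - t) \<le> exp (- (t\<^sup>2 / (4 * real n)))"
proof -
  have "freq k n (\<lambda>w. f w \<le> avg k n f - t) \<le> freq k n (\<lambda>w. - f w \<ge> avg k n (\<lambda>w. - f w) + t)"
    by (intro freq_mono) (simp add: avg_uminus)
  also have "\<dots> \<le> exp (- (t\<^sup>2 / (4 * real n)))"
    by (intro freq_upper_tail hamming_lipschitz_uminus assms)
  finally show ?thesis .
qed

section \<open>The homogeneous limit function\<close>

locale alphabet =
  fixes k :: nat
  assumes k_pos: "k > 0"
begin

definition elcs :: "nat \<Rightarrow> nat \<Rightarrow> real" where
  "elcs a b = avg k a (\<lambda>u. avg k b (\<lambda>v. real (lcs_length u v)))"

text \<open>Gives the mean the form of an average over one word, as the concentration bounds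
  require.\<close>

lemma elcs_eq_avg: "elcs a b = avg k (a + b) (\<lambda>w. real (lcs_length (take a w) (drop a w)))"
  unfolding elcs_def avg_append by (intro avg_cong) (simp add: length_words)

lemma elcs_commute: "elcs a b = elcs b a"
  unfolding elcs_def by (subst avg_swap) (simp add: lcs_length_commute)

lemma elcs_nonneg: "0 \<le> elcs a b"
  unfolding elcs_def by (intro avg_nonneg) simp

lemma elcs_le1: "elcs a b \<le> a"
proof -
  have "elcs a b \<le> avg k a (\<lambda>u. avg k b (\<lambda>v. real a))"
    unfolding elcs_def
  proof (intro avg_mono)
    fix u v assume "u \<in> words k a"
    then show "real (lcs_length u v) \<le> real a"
      using lcs_length_le1[of u v] by (simp add: length_words)
  qed
  then show ?thesis using k_pos by simp
qed

lemma elcs_superadd: "elcs a b + elcs a' b' \<le> elcs (a + a') (b + b')"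
proof -
  have "elcs a b + elcs a' b' = avg k a (\<lambda>u. avg k a' (\<lambda>u'. avg k b (\<lambda>v. avg k b' (\<lambda>v'.
      real (lcs_length u v) + real (lcs_length u' v')))))"
    using k_pos by (simp add: avg_add elcs_def)
  also have "\<dots> \<le> avg k a (\<lambda>u. avg k a' (\<lambda>u'. avg k b (\<lambda>v. avg k b' (\<lambda>v'.
      real (lcs_length (u @ u') (v @ v'))))))"
    by (intro avg_mono) (use lcs_length_append in \<open>metis of_nat_add of_nat_le_iff\<close>)
  also have "\<dots> = elcs (a + a') (b + b')"
    by (simp add: elcs_def avg_append)
  finally show ?thesis .
qed

lemma elcs_mono: "a \<le> a' \<Longrightarrow> b \<le> b' \<Longrightarrow> elcs a b \<le> elcs a' b'"
  using elcs_superadd[of a b "a' - a" "b' - b"] elcs_nonneg[of "a' - a" "b' - b"] by simp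

lemma elcs_mult: "real q * elcs a b \<le> elcs (q * a) (q * b)"
proof (induction q)
  case 0
  then show ?case by (simp add: elcs_nonneg)
next
  case (Suc q)
  then show ?case using elcs_superadd[of a b "q * a" "q * b"] by (simp add: algebra_simps)
qed

lemma elcs_add_right_le: "elcs a (b + c) \<le> elcs a b + c"
proof -
  have "elcs a (b + c) \<le> avg k a (\<lambda>u. avg k b (\<lambda>v. avg k c (\<lambda>v'.
      real (lcs_length u v) + real c)))"
    unfolding elcs_def avg_append
  proof (intro avg_mono)
    fix u v v' assume "v' \<in> words k c"
    then show "real (lcs_length u (v @ v')) \<le> real (lcs_length u v) + real c"
      using lcs_length_append_le[of u v v'] by (simp add: length_words)
  qed
  also have "\<dots> = elcs a b + c"
    using k_pos by (simp add: elcs_def avg_add)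
  finally show ?thesis .
qed

lemma elcs_le_right: "elcs a b' \<le> elcs a b + (b' - b)"
proof (cases "b \<le> b'")
  case True
  then show ?thesis using elcs_add_right_le[of a b "b' - b"] by simp
next
  case False
  then show ?thesis using elcs_mono[of a a b' b] by simp
qed

lemma elcs_lipschitz: "elcs a' b' \<le> elcs a b + (a' - a) + (b' - b)"
  using elcs_le_right[of a' b' b] elcs_le_right[of b a' a] by (simp add: elcs_commute)

text \<open>\<open>F x y\<close> is also the limit of the quotient as \<open>t \<rightarrow> \<infinity>\<close>; the supremum makes homogeneity in
  \<open>(x, y)\<close> evident.\<close>

definition scaled :: "real \<Rightarrow> real \<Rightarrow> real \<Rightarrow> real" where
  "scaled x y t = elcs (nat \<lfloor>t * x\<rfloor>) (nat \<lfloor>t * y\<rfloor>)"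

definition F :: "real \<Rightarrow> real \<Rightarrow> real" where
  "F x y = (SUP t\<in>{0<..}. scaled x y t / t)"

lemma scaled_nonneg: "0 \<le> scaled x y t"
  by (simp add: scaled_def elcs_nonneg)

lemma scaled_commute: "scaled x y t = scaled y x t"
  unfolding scaled_def by (rule elcs_commute)

lemma scaled_le:
  assumes "0 \<le> x" "0 < t" shows "scaled x y t \<le> t * x"
proof -
  have "scaled x y t \<le> real (nat \<lfloor>t * x\<rfloor>)" unfolding scaled_def by (rule elcs_le1)
  also have "\<dots> \<le> t * x" using assms by simp
  finally show ?thesis .
qed

lemma bdd_above_scaled:
  assumes "0 \<le> x" shows "bdd_above ((\<lambda>t. scaled x y t / t) ` {0<..})"
  by (rule bdd_aboveI2[where M = x]) (use scaled_le[OF assms] in \<open>simp add: field_simps\<close>)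

lemma scaled_le_F:
  assumes "0 \<le> x" "0 < t" shows "scaled x y t / t \<le> F x y"
  unfolding F_def by (rule cSUP_upper[OF _ bdd_above_scaled]) (use assms in auto)

lemma F_commute: "F x y = F y x"
  unfolding F_def by (simp add: scaled_commute)

lemma F_nonneg: assumes "0 \<le> x" shows "0 \<le> F x y"
  using scaled_le_F[OF assms, of 1 y] scaled_nonneg[of x y 1] by simp

lemma F_le1: assumes "0 \<le> x" shows "F x y \<le> x"
  unfolding F_def by (rule cSUP_least) (use scaled_le[OF assms] in \<open>auto simp: field_simps\<close>)

lemma elcs_le_F: "elcs a b \<le> F a b"
  using scaled_le_F[of a 1 b] by (simp add: scaled_def)

text \<open>Fekete's argument: words at scale \<open>t\<close> contain \<open>q\<close> disjoint
  blocks of scale \<open>s\<close>. The subtracted term pays for the incomplete last block.\<close>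

lemma scaled_fekete:
  assumes xy: "0 \<le> x" "0 \<le> y" and st: "0 < s" "0 < t"
  shows "scaled x y s / s - scaled x y s / t \<le> scaled x y t / t"
proof -
  define q where "q = nat \<lfloor>t / s\<rfloor>"
  have q: "t / s - 1 \<le> real q" "real q \<le> t / s"
    using st by (simp_all add: q_def)
  have fl: "q * nat \<lfloor>s * z\<rfloor> \<le> nat \<lfloor>t * z\<rfloor>" if "0 \<le> z" for z
  proof -
    have "real q * real (nat \<lfloor>s * z\<rfloor>) \<le> t / s * (s * z)"
      using q that st by (intro mult_mono) auto
    then have "real (q * nat \<lfloor>s * z\<rfloor>) \<le> t * z" using st by simp
    then show ?thesis by (simp add: le_nat_floor)
  qed
  have "(t / s - 1) * scaled x y s \<le> real q * scaled x y s"
    using q scaled_nonneg by (intro mult_right_mono)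
  also have "\<dots> \<le> elcs (q * nat \<lfloor>s * x\<rfloor>) (q * nat \<lfloor>s * y\<rfloor>)"
    unfolding scaled_def by (rule elcs_mult)
  also have "\<dots> \<le> scaled x y t"
    unfolding scaled_def by (intro elcs_mono fl xy)
  finally have "(t / s - 1) * scaled x y s / t \<le> scaled x y t / t"
    using st by (intro divide_right_mono) auto
  then show ?thesis using st by (simp add: left_diff_distrib diff_divide_distrib)
qed

text \<open>For the lower bound, \<open>scaled_fekete\<close> propagates the quotient at one nearly
  optimal scale \<open>s\<close> to all large \<open>t\<close>; the upper bound is the supremum
  itself.\<close>

lemma scaled_tendsto_F:
  assumes "0 \<le> x" "0 \<le> y"
  shows "((\<lambda>t. scaled x y t / t) \<longlongrightarrow> F x y) at_top"
proof (rule order_tendstoI)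
  fix c assume "c < F x y"
  then obtain s where s: "0 < s" "c < scaled x y s / s"
    unfolding F_def using less_cSUP_iff[OF _ bdd_above_scaled[OF assms(1), of y]] by auto
  have "((\<lambda>t. scaled x y s / s - scaled x y s / t) \<longlongrightarrow> scaled x y s / s - 0) at_top"
    by (intro tendsto_diff real_tendsto_divide_at_top[OF tendsto_const filterlim_ident] tendsto_const)
  then have "eventually (\<lambda>t. c < scaled x y s / s - scaled x y s / t) at_top"
    using s by (intro order_tendstoD(1)) auto
  then show "eventually (\<lambda>t. c < scaled x y t / t) at_top"
    using eventually_gt_at_top[of 0]
  proof eventually_elim
    case (elim t)
    then show ?case using scaled_fekete[OF assms s(1), of t] by linarith
  qed
next
  fix c assume "F x y < c"
  show "eventually (\<lambda>t. scaled x y t / t < c) at_top"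
    using eventually_gt_at_top[of 0]
  proof eventually_elim
    case (elim t)
    then show ?case using scaled_le_F[OF assms(1), of t y] \<open>F x y < c\<close> by linarith
  qed
qed

lemma F_homogeneous:
  assumes "0 < c" "0 \<le> x" "0 \<le> y"
  shows "F (c * x) (c * y) = c * F x y"
proof (rule tendsto_unique[of at_top])
  show "((\<lambda>t. scaled (c * x) (c * y) t / t) \<longlongrightarrow> F (c * x) (c * y)) at_top"
    using assms by (intro scaled_tendsto_F) auto
  have "filterlim (\<lambda>t. c * t) at_top at_top"
    using assms by (intro filterlim_tendsto_pos_mult_at_top[OF tendsto_const]) (auto intro: filterlim_ident)
  then have "((\<lambda>t. c * (scaled x y (c * t) / (c * t))) \<longlongrightarrow> c * F x y) at_top"
    by (intro tendsto_mult tendsto_const filterlim_compose[OF scaled_tendsto_F] assms)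
  moreover have "c * (scaled x y (c * t) / (c * t)) = scaled (c * x) (c * y) t / t" for t
    using assms by (simp add: scaled_def mult_ac)
  ultimately show "((\<lambda>t. scaled (c * x) (c * y) t / t) \<longlongrightarrow> c * F x y) at_top" by simp
qed simp

lemma F_superadd:
  assumes "0 \<le> x" "0 \<le> y" "0 \<le> x'" "0 \<le> y'"
  shows "F x y + F x' y' \<le> F (x + x') (y + y')"
proof (rule tendsto_le[of at_top])
  show "((\<lambda>t. scaled (x + x') (y + y') t / t) \<longlongrightarrow> F (x + x') (y + y')) at_top"
    using assms by (intro scaled_tendsto_F) auto
  show "((\<lambda>t. scaled x y t / t + scaled x' y' t / t) \<longlongrightarrow> F x y + F x' y') at_top"
    using assms by (intro tendsto_add scaled_tendsto_F) auto
  show "eventually (\<lambda>t. scaled x y t / t + scaled x' y' t / t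
      \<le> scaled (x + x') (y + y') t / t) at_top"
    using eventually_gt_at_top[of 0]
  proof eventually_elim
    case (elim t)
    have fl: "nat \<lfloor>t * z\<rfloor> + nat \<lfloor>t * z'\<rfloor> \<le> nat \<lfloor>t * (z + z')\<rfloor>" if "0 \<le> z" "0 \<le> z'" for z z'
      using that elim by (simp add: algebra_simps nat_add_distrib[symmetric] nat_mono le_floor_add
          del: nat_add_distrib)
    have "scaled x y t + scaled x' y' t \<le> scaled (x + x') (y + y') t"
      unfolding scaled_def
      by (rule order.trans[OF elcs_superadd]) (intro elcs_mono fl assms)
    then show ?case using elim by (simp add: add_divide_distrib[symmetric] divide_right_mono)
  qed
qed simp

lemma F_mono_right:
  assumes "0 \<le> x" "0 \<le> y" "y \<le> y'" shows "F x y \<le> F x y'"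
  using F_superadd[of x y 0 "y' - y"] F_nonneg[of 0 "y' - y"] assms by simp

lemma F_add_right_le:
  assumes "0 \<le> x" "0 \<le> y" "0 \<le> z"
  shows "F x (y + z) \<le> F x y + z"
proof (rule tendsto_le[of at_top])
  show "((\<lambda>t. scaled x y t / t + (z + 1 / t)) \<longlongrightarrow> F x y + z) at_top"
  proof -
    have "((\<lambda>t::real. 1 / t) \<longlongrightarrow> 0) at_top"
      by (intro real_tendsto_divide_at_top[OF tendsto_const filterlim_ident])
    then show ?thesis
      using tendsto_add[OF scaled_tendsto_F[OF assms(1,2)] tendsto_add[OF tendsto_const[of z]],
          of "\<lambda>t. 1 / t" 0] by simp
  qed
  show "((\<lambda>t. scaled x (y + z) t / t) \<longlongrightarrow> F x (y + z)) at_top"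
    using assms by (intro scaled_tendsto_F) auto
  show "eventually (\<lambda>t. scaled x (y + z) t / t \<le> scaled x y t / t + (z + 1 / t)) at_top"
    using eventually_gt_at_top[of 0]
  proof eventually_elim
    case (elim t)
    \<comment> \<open>Rounding costs at most 1, which becomes the vanishing term
      \<open>1 / t\<close> after division.\<close>
    have "real (nat \<lfloor>t * (y + z)\<rfloor> - nat \<lfloor>t * y\<rfloor>) \<le> t * z + 1"
    proof -
      have "0 \<le> t * y" "0 \<le> t * z" using assms elim by auto
      then have "nat \<lfloor>t * y\<rfloor> \<le> nat \<lfloor>t * (y + z)\<rfloor>"
        by (intro nat_mono floor_mono) (simp add: distrib_left)
      then have "real (nat \<lfloor>t * (y + z)\<rfloor> - nat \<lfloor>t * y\<rfloor>) = of_int \<lfloor>t * (y + z)\<rfloor> - of_int \<lfloor>t * y\<rfloor>"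
        using \<open>0 \<le> t * y\<close> \<open>0 \<le> t * z\<close> by (simp add: of_nat_diff distrib_left)
      then show ?thesis
        using of_int_floor_le[of "t * (y + z)"] real_of_int_floor_add_one_gt[of "t * y"]
        distrib_left[of t y z] by linarith
    qed
    then have "scaled x (y + z) t \<le> scaled x y t + (t * z + 1)"
      unfolding scaled_def
      using elcs_le_right[of "nat \<lfloor>t * x\<rfloor>" "nat \<lfloor>t * (y + z)\<rfloor>" "nat \<lfloor>t * y\<rfloor>"] by linarith
    then have "scaled x (y + z) t / t \<le> (scaled x y t + (t * z + 1)) / t"
      using elim by (intro divide_right_mono) auto
    then show ?case using elim by (simp add: add_divide_distrib)
  qed
qed simp

text \<open>Homogeneity moves the weights into the arguments, where superadditivity applies.\<close>

lemma F_concave_right: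
  assumes "0 < x" "0 \<le> y1" "0 \<le> y2" "0 \<le> s" "s \<le> 1"
  shows "s * F x y1 + (1 - s) * F x y2 \<le> F x (s * y1 + (1 - s) * y2)"
proof -
  consider "s = 0" | "s = 1" | "0 < s" "s < 1" using assms by linarith
  then show ?thesis
  proof cases
    case 3
    have "s * F x y1 + (1 - s) * F x y2 = F (s * x) (s * y1) + F ((1 - s) * x) ((1 - s) * y2)"
      using 3 assms by (simp add: F_homogeneous)
    also have "\<dots> \<le> F (s * x + (1 - s) * x) (s * y1 + (1 - s) * y2)"
      using 3 assms by (intro F_superadd) auto
    also have "s * x + (1 - s) * x = x" by (simp add: algebra_simps)
    finally show ?thesis .
  qed auto
qed

end

section \<open>Exponential moments of the LCS\<close>

context alphabet begin

definition mgf :: "real \<Rightarrow> nat \<Rightarrow> nat \<Rightarrow> real" where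
  "mgf \<theta> a b = avg k a (\<lambda>u. avg k b (\<lambda>v. exp (\<theta> * real (lcs_length u v))))"

lemma mgf_nonneg: "0 \<le> mgf \<theta> a b"
  unfolding mgf_def by (intro avg_nonneg) simp

lemma mgf_le:
  assumes "\<bar>\<theta>\<bar> \<le> 1"
  shows "mgf \<theta> a b \<le> exp (\<theta> * elcs a b + \<theta>\<^sup>2 * (a + b))"
proof -
  have "mgf \<theta> a b = avg k (a + b) (\<lambda>w. exp (\<theta> * real (lcs_length (take a w) (drop a w))))"
    unfolding mgf_def avg_append by (intro avg_cong) (simp add: length_words)
  also have "\<dots> \<le> exp (\<theta> * elcs a b + \<theta>\<^sup>2 * real (a + b))"
    unfolding elcs_eq_avg by (intro hoeffding_avg k_pos hamming_lipschitz_lcs assms)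
  finally show ?thesis .
qed

text \<open>Jensen's inequality, obtained from the tangent to \<open>exp\<close> at the mean
  \<open>m\<close>.\<close>

lemma mgf_ge:
  assumes "0 \<le> \<theta>" shows "exp (\<theta> * elcs a b) \<le> mgf \<theta> a b"
proof -
  define m where "m = \<theta> * elcs a b"
  have "avg k a (\<lambda>u. avg k b (\<lambda>v. exp m * (1 + (\<theta> * real (lcs_length u v) - m)))) \<le> mgf \<theta> a b"
    unfolding mgf_def
  proof (intro avg_mono)
    fix u v :: "nat list"
    have "exp m * (1 + (\<theta> * real (lcs_length u v) - m))
        \<le> exp m * exp (\<theta> * real (lcs_length u v) - m)"
      by (intro mult_left_mono exp_ge_add_one_self) simp
    then show "exp m * (1 + (\<theta> * real (lcs_length u v) - m)) \<le> exp (\<theta> * real (lcs_length u v))"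
      by (simp add: exp_add[symmetric])
  qed
  also have "avg k a (\<lambda>u. avg k b (\<lambda>v. exp m * (1 + (\<theta> * real (lcs_length u v) - m)))) = exp m"
    using k_pos by (simp add: avg_cmult avg_add avg_diff elcs_def[symmetric] m_def)
  finally show ?thesis by (simp add: m_def)
qed

text \<open>The exponential of the score of the best cut of \<open>v\<close> is at most the sum over
  all cuts; for a fixed cut the two parts of \<open>v\<close> are independent and the average
  factorises.\<close>

lemma mgf_add_left_le:
  assumes "0 \<le> \<theta>"
  shows "mgf \<theta> (a + a') b \<le> (\<Sum>i\<le>b. mgf \<theta> a i * mgf \<theta> a' (b - i))"
proof -
  have "mgf \<theta> (a + a') b \<le> avg k a (\<lambda>u. avg k a' (\<lambda>u'. avg k b (\<lambda>v. \<Sum>i\<le>b.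
      exp (\<theta> * real (lcs_length u (take i v))) * exp (\<theta> * real (lcs_length u' (drop i v))))))"
    unfolding mgf_def avg_append
  proof (intro avg_mono)
    fix u u' v assume v: "v \<in> words k b"
    obtain i where i: "i \<le> length v"
      "lcs_length (u @ u') v \<le> lcs_length u (take i v) + lcs_length u' (drop i v)"
      by (rule lcs_length_split)
    then have "real (lcs_length (u @ u') v)
        \<le> real (lcs_length u (take i v)) + real (lcs_length u' (drop i v))" by linarith
    then have "\<theta> * real (lcs_length (u @ u') v)
        \<le> \<theta> * (real (lcs_length u (take i v)) + real (lcs_length u' (drop i v)))"
      using assms by (rule mult_left_mono)
    then have "exp (\<theta> * real (lcs_length (u @ u') v)) \<le>
        exp (\<theta> * real (lcs_length u (take i v))) * exp (\<theta> * real (lcs_length u' (drop i v)))"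
      by (simp add: exp_add[symmetric] distrib_left)
    also have "\<dots> \<le> (\<Sum>i\<le>b.
        exp (\<theta> * real (lcs_length u (take i v))) * exp (\<theta> * real (lcs_length u' (drop i v))))"
      using i v by (intro member_le_sum) (auto simp: length_words)
    finally show "exp (\<theta> * real (lcs_length (u @ u') v)) \<le> (\<Sum>i\<le>b.
        exp (\<theta> * real (lcs_length u (take i v))) * exp (\<theta> * real (lcs_length u' (drop i v))))" .
  qed
  also have "\<dots> = (\<Sum>i\<le>b. mgf \<theta> a i * mgf \<theta> a' (b - i))"
    unfolding avg_sum
  proof (intro sum.cong refl)
    fix i assume "i \<in> {..b}"
    then have b: "b = i + (b - i)" by simp
    have "avg k b (\<lambda>v. exp (\<theta> * real (lcs_length u (take i v)))
          * exp (\<theta> * real (lcs_length u' (drop i v))))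
        = avg k i (\<lambda>v. exp (\<theta> * real (lcs_length u v)))
          * avg k (b - i) (\<lambda>v. exp (\<theta> * real (lcs_length u' v)))" for u u'
    proof -
      have "avg k b (\<lambda>v. exp (\<theta> * real (lcs_length u (take i v)))
            * exp (\<theta> * real (lcs_length u' (drop i v))))
          = avg k i (\<lambda>v. avg k (b - i) (\<lambda>v'. exp (\<theta> * real (lcs_length u v))
            * exp (\<theta> * real (lcs_length u' v'))))"
        by (subst b, subst avg_append) (intro avg_cong, simp add: length_words)
      then show ?thesis by (simp only: avg_cmult avg_cmult_right)
    qed
    then show "avg k a (\<lambda>u. avg k a' (\<lambda>u'. avg k b (\<lambda>v. exp (\<theta> * real (lcs_length u (take i v)))
          * exp (\<theta> * real (lcs_length u' (drop i v)))))) = mgf \<theta> a i * mgf \<theta> a' (b - i)"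
      by (simp only: avg_cmult avg_cmult_right mgf_def)
  qed
  finally show ?thesis .
qed

text \<open>Splitting off one block of length \<open>a\<close> at a time gives an
  \<open>N\<close>-fold convolution in the second length. The weight
  \<open>exp (- \<mu> * i)\<close> turns it into a product, with one factor \<open>K\<close> per
  block.\<close>

lemma mgf_mult_le:
  assumes th: "0 \<le> \<theta>" and K: "\<And>b. (\<Sum>i\<le>b. mgf \<theta> a i * exp (- \<mu> * i)) \<le> K" and N: "N > 0"
  shows "mgf \<theta> (N * a) b \<le> K ^ N * exp (\<mu> * b)"
  using N
proof (induction N arbitrary: b rule: nat_induct_non_zero)
  case 1
  have "mgf \<theta> a b * exp (- \<mu> * b) \<le> (\<Sum>i\<le>b. mgf \<theta> a i * exp (- \<mu> * i))"
    by (rule member_le_sum) (auto intro!: mult_nonneg_nonneg mgf_nonneg)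
  also have "\<dots> \<le> K" by (rule K)
  finally show ?case by (simp add: exp_minus field_simps)
next
  case (Suc N)
  have K0: "0 \<le> K" by (rule order.trans[OF _ K[of 0]]) (auto intro!: mult_nonneg_nonneg mgf_nonneg)
  have "mgf \<theta> (Suc N * a) b \<le> (\<Sum>i\<le>b. mgf \<theta> a i * mgf \<theta> (N * a) (b - i))"
    using mgf_add_left_le[OF th, of a "N * a" b] by simp
  also have "\<dots> \<le> (\<Sum>i\<le>b. mgf \<theta> a i * (K ^ N * exp (\<mu> * (b - i))))"
  proof (intro sum_mono mult_left_mono mgf_nonneg)
    fix i assume "i \<in> {..b}"
    then show "mgf \<theta> (N * a) (b - i) \<le> K ^ N * exp (\<mu> * (b - i))"
      using Suc.IH[of "b - i"] by (simp add: of_nat_diff)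
  qed
  also have "\<dots> = (\<Sum>i\<le>b. mgf \<theta> a i * exp (- \<mu> * i)) * (K ^ N * exp (\<mu> * b))"
    unfolding sum_distrib_right
    by (intro sum.cong refl) (simp add: of_nat_diff right_diff_distrib exp_diff exp_minus field_simps)
  also have "\<dots> \<le> K * (K ^ N * exp (\<mu> * b))"
    using K0 by (intro mult_right_mono K) auto
  finally show ?case by simp
qed

lemma sum_exp_le:
  fixes \<eta> :: real assumes "0 < \<eta>"
  shows "(\<Sum>i\<le>(b::nat). exp (- \<eta> * i)) \<le> 1 + 1 / \<eta>"
proof -
  define r where "r = exp (- \<eta>)"
  have r: "0 < r" "r < 1" using assms by (auto simp: r_def)
  have "(\<Sum>i\<le>b. exp (- \<eta> * i)) = (\<Sum>i\<le>b. r ^ i)"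
    by (simp add: r_def exp_of_nat_mult[symmetric] mult.commute)
  also have "\<dots> \<le> 1 / (1 - r)"
    using r by (simp add: sum_gp0 divide_right_mono)
  also have "\<dots> \<le> 1 + 1 / \<eta>"
  proof -
    have "r * (1 + \<eta>) \<le> r * exp \<eta>" using r by (intro mult_left_mono exp_ge_add_one_self) auto
    then have "r * (1 + \<eta>) \<le> 1" by (simp add: r_def exp_minus)
    then show ?thesis using r assms by (simp add: field_simps)
  qed
  finally show ?thesis .
qed

text \<open>A word of length \<open>N * a\<close> is cut into \<open>N\<close> pieces; exponential
  moments control the best of all matching cuts of the other word, and \<open>N\<close> tending to
  infinity transfers the line above \<open>elcs a\<close> to \<open>F a\<close>. The parameters
  \<open>\<theta>\<close> and \<open>\<eta>\<close> remain free for optimisation.\<close>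

lemma F_le_legendre:
  assumes lin: "\<And>b. elcs a b \<le> T + \<kappa> * b"
    and th: "0 < \<theta>" "\<theta> \<le> 1" and eta: "0 < \<eta>" and lam: "0 \<le> \<kappa>" and x: "0 \<le> x"
  shows "F a x \<le> T + \<kappa> * x + \<theta> * (a + x) + (ln (1 + 1 / \<eta>) + \<eta> * x) / \<theta>"
proof -
  \<comment> \<open>Here \<open>\<theta> * \<kappa>\<close> cancels the slope of the line,
    \<open>\<theta>\<^sup>2\<close> cancels the moment cost of the \<open>i\<close> letters, and
    \<open>\<eta>\<close> leaves a summable geometric factor.\<close>
  define \<mu> where "\<mu> = \<theta> * \<kappa> + \<theta>\<^sup>2 + \<eta>"
  define K where "K = exp (\<theta> * T + \<theta>\<^sup>2 * a) * (1 + 1 / \<eta>)"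
  have mu0: "0 \<le> \<mu>" using assms by (auto simp: \<mu>_def)
  have K: "(\<Sum>i\<le>b. mgf \<theta> a i * exp (- \<mu> * i)) \<le> K" for b
  proof -
    have "(\<Sum>i\<le>b. mgf \<theta> a i * exp (- \<mu> * i))
        \<le> (\<Sum>i\<le>b. exp (\<theta> * T + \<theta>\<^sup>2 * a) * exp (- \<eta> * i))"
    proof (intro sum_mono)
      fix i
      have "mgf \<theta> a i \<le> exp (\<theta> * elcs a i + \<theta>\<^sup>2 * (a + i))"
        using th by (intro mgf_le) auto
      also have "\<dots> \<le> exp (\<theta> * (T + \<kappa> * i) + \<theta>\<^sup>2 * (a + i))"
        using lin th by simp
      finally have "mgf \<theta> a i * exp (- \<mu> * i)
          \<le> exp (\<theta> * (T + \<kappa> * i) + \<theta>\<^sup>2 * (a + i)) * exp (- \<mu> * i)" by simp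
      also have "\<dots> = exp (\<theta> * T + \<theta>\<^sup>2 * a) * exp (- \<eta> * i)"
        by (simp add: exp_add[symmetric] \<mu>_def algebra_simps)
      finally show "mgf \<theta> a i * exp (- \<mu> * i) \<le> exp (\<theta> * T + \<theta>\<^sup>2 * a) * exp (- \<eta> * i)" .
    qed
    also have "\<dots> \<le> K"
      unfolding sum_distrib_left[symmetric] K_def by (intro mult_left_mono sum_exp_le eta) simp
    finally show ?thesis .
  qed
  define c where "c = \<theta> * T + \<theta>\<^sup>2 * a + ln (1 + 1 / \<eta>)"
  have Kc: "K = exp c" using eta by (simp add: K_def c_def exp_add add_pos_pos)
  have bound: "scaled a x (real N) / N \<le> (c + \<mu> * x) / \<theta>" if N: "N > 0" for N :: nat
  proof -
    define M where "M = nat \<lfloor>N * x\<rfloor>"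
    have "exp (\<theta> * elcs (N * a) M) \<le> mgf \<theta> (N * a) M"
      using th by (intro mgf_ge) auto
    also have "\<dots> \<le> K ^ N * exp (\<mu> * M)"
      using th by (intro mgf_mult_le K N) auto
    also have "\<dots> = exp (N * c + \<mu> * M)"
      by (simp add: Kc exp_of_nat_mult[symmetric] exp_add)
    finally have "\<theta> * elcs (N * a) M \<le> N * c + \<mu> * M" by simp
    also have "\<mu> * M \<le> \<mu> * (N * x)"
      using x mu0 by (intro mult_left_mono) (auto simp: M_def)
    finally have "\<theta> * elcs (N * a) M \<le> N * (c + \<mu> * x)" by (simp add: algebra_simps)
    moreover have "scaled a x (real N) = elcs (N * a) M"
      by (simp add: scaled_def M_def of_nat_mult[symmetric] del: of_nat_mult)
    ultimately show ?thesis using N th by (simp add: field_simps)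
  qed
  have "F a x \<le> (c + \<mu> * x) / \<theta>"
  proof (rule tendsto_upperbound)
    show "(\<lambda>N. scaled a x (real N) / real N) \<longlonglongrightarrow> F a x"
      using x by (intro filterlim_compose[OF scaled_tendsto_F filterlim_real_sequentially]) auto
    show "eventually (\<lambda>N. scaled a x (real N) / real N \<le> (c + \<mu> * x) / \<theta>) sequentially"
      using eventually_gt_at_top[of 0] by eventually_elim (rule bound)
  qed simp
  also have "\<dots> = T + \<kappa> * x + \<theta> * (a + x) + (ln (1 + 1 / \<eta>) + \<eta> * x) / \<theta>"
    using th by (simp add: c_def \<mu>_def field_simps power2_eq_square)
  finally show ?thesis .
qed

end

section \<open>Rate of convergence\<close>

text \<open>The line carries the edge of the upper concave hull of \<open>\<Phi>\<close> over
  \<open>m + 1 / 2\<close>: among pairs on the two sides of that point, the one whose chord is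
  highest there is taken. A point above the line would give a higher chord.\<close>

lemma upper_hull_line:
  fixes \<Phi> :: "nat \<Rightarrow> real"
  assumes "m < B"
  obtains b1 b2 :: nat and T \<kappa> :: real where "b1 \<le> m" "m < b2" "b2 \<le> B"
    "\<Phi> b1 = T + \<kappa> * b1" "\<Phi> b2 = T + \<kappa> * b2" "\<And>b. b \<le> B \<Longrightarrow> \<Phi> b \<le> T + \<kappa> * b"
proof -
  \<comment> \<open>A half-integer is never an endpoint, so both weights of the chord are strictly
    positive.\<close>
  define t where "t = real m + 1 / 2"
  \<comment> \<open>The height at \<open>t\<close> of the chord through \<open>(i, \<Phi> i)\<close>
    and \<open>(j, \<Phi> j)\<close>.\<close>
  define I where "I = (\<lambda>(i, j). ((real j - t) * \<Phi> i + (t - real i) * \<Phi> j) / (real j - real i))"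
  define S where "S = {..m} \<times> {m<..B}"
  have "finite S" "S \<noteq> {}" using assms by (auto simp: S_def)
  then have "\<exists>p\<in>S. \<forall>q\<in>S. I q \<le> I p"
    using Max_in[of "I ` S"] Max_ge[of "I ` S"] by (metis (no_types, lifting) empty_is_image finite_imageI imageE imageI)
  then obtain b1 b2 where b: "b1 \<le> m" "m < b2" "b2 \<le> B"
    and max: "\<And>i j. i \<le> m \<Longrightarrow> m < j \<Longrightarrow> j \<le> B \<Longrightarrow> I (i, j) \<le> I (b1, b2)"
    by (auto simp: S_def)
  define \<kappa> where "\<kappa> = (\<Phi> b2 - \<Phi> b1) / (real b2 - real b1)"
  define T where "T = \<Phi> b1 - \<kappa> * b1"
  have l1: "\<Phi> b1 = T + \<kappa> * b1" by (simp add: T_def)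
  have l2: "\<Phi> b2 = T + \<kappa> * b2"
  proof -
    have "\<kappa> * (real b2 - real b1) = \<Phi> b2 - \<Phi> b1" using b by (simp add: \<kappa>_def)
    then show ?thesis by (simp add: T_def algebra_simps)
  qed
  \<comment> \<open>Relative to the line, the chord height is a weighted mean of the deviations at
    the two endpoints. With one endpoint on the line, maximality decides the sign of the other
    deviation.\<close>
  have I: "I (i, j) = T + \<kappa> * t + ((real j - t) * (\<Phi> i - (T + \<kappa> * i))
      + (t - real i) * (\<Phi> j - (T + \<kappa> * j))) / (real j - real i)" if "i \<le> m" "m < j" for i j
  proof -
    have "real j - real i \<noteq> 0" using that by auto
    then show ?thesis by (simp add: I_def field_simps)
  qed
  have "\<Phi> x \<le> T + \<kappa> * x" if "x \<le> B" for x
  proof (cases "x \<le> m")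
    case True
    have "((real b2 - t) * (\<Phi> x - (T + \<kappa> * x))) / (real b2 - real x) \<le> 0"
      using max[of x b2] True b by (simp add: I l1 l2)
    moreover have "real b2 - t > 0" "real b2 - real x > 0" using True b by (auto simp: t_def)
    ultimately show ?thesis by (simp add: divide_le_0_iff mult_le_0_iff)
  next
    case False
    have "((t - real b1) * (\<Phi> x - (T + \<kappa> * x))) / (real x - real b1) \<le> 0"
      using max[of b1 x] False that b by (simp add: I l1 l2)
    moreover have "t - real b1 > 0" "real x - real b1 > 0" using False b by (auto simp: t_def)
    ultimately show ?thesis by (simp add: divide_le_0_iff mult_le_0_iff)
  qed
  then show ?thesis using that b l1 l2 by blast
qed

context alphabet begin

text \<open>The greedy embedding of the shorter word: a first letter of \<open>v\<close> that equals the first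
  letter of \<open>u\<close> is matched with it, any other one is skipped.\<close>

lemma elcs_Suc_Suc:
  "1 / k * (1 + elcs a b) + (1 - 1 / k) * elcs (Suc a) b \<le> elcs (Suc a) (Suc b)"
proof -
  define A where "A u = avg k b (\<lambda>v. real (lcs_length u v))" for u
  have A: "avg k (Suc a) (\<lambda>w. A (tl w)) = elcs a b"
    using k_pos by (simp add: avg_Suc elcs_def A_def)
  have "1 / k * (1 + elcs a b) + (1 - 1 / k) * elcs (Suc a) b
      = avg k (Suc a) (\<lambda>w. 1 / k * (1 + A (tl w)) + (1 - 1 / k) * A w)"
    using k_pos by (simp only: avg_add avg_cmult A avg_const) (simp add: elcs_def A_def)
  also have "\<dots> \<le> avg k (Suc a) (\<lambda>w. avg k (Suc b) (\<lambda>z. real (lcs_length w z)))"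
  proof (intro avg_mono)
    fix w assume "w \<in> words k (Suc a)"
    then obtain c u where w: "w = c # u" "c < k" by (auto simp: words_def length_Suc_conv)
    have same: "1 + A u \<le> avg k b (\<lambda>v. real (lcs_length w (c # v)))"
    proof -
      have "1 + A u = avg k b (\<lambda>v. 1 + real (lcs_length u v))"
        using k_pos by (simp add: avg_add A_def)
      also have "\<dots> \<le> avg k b (\<lambda>v. real (lcs_length w (c # v)))"
      proof (intro avg_mono)
        fix v show "1 + real (lcs_length u v) \<le> real (lcs_length w (c # v))"
          using lcs_length_append[of "[c]" "[c]" u v] by (simp add: w lcs_length_same)
      qed
      finally show ?thesis .
    qed
    have other: "A w \<le> avg k b (\<lambda>v. real (lcs_length w (c' # v)))" for c'
      unfolding A_def by (intro avg_mono of_nat_mono lcs_length_mono) auto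
    have "1 + A u + (real k - 1) * A w = 1 + A u + (\<Sum>c'\<in>{..<k} - {c}. A w)"
      using w k_pos by (simp add: of_nat_diff)
    also have "\<dots> \<le> avg k b (\<lambda>v. real (lcs_length w (c # v)))
        + (\<Sum>c'\<in>{..<k} - {c}. avg k b (\<lambda>v. real (lcs_length w (c' # v))))"
      by (intro add_mono same sum_mono other)
    also have "\<dots> = (\<Sum>c'<k. avg k b (\<lambda>v. real (lcs_length w (c' # v))))"
      using w by (simp add: sum.remove)
    finally have "(1 + A u + (real k - 1) * A w) / k
        \<le> (\<Sum>c'<k. avg k b (\<lambda>v. real (lcs_length w (c' # v)))) / k"
      by (rule divide_right_mono) simp
    also have "(1 + A u + (real k - 1) * A w) / k = 1 / k * (1 + A (tl w)) + (1 - 1 / k) * A w"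
      using k_pos by (simp add: w field_simps)
    finally show "1 / k * (1 + A (tl w)) + (1 - 1 / k) * A w
        \<le> avg k (Suc b) (\<lambda>z. real (lcs_length w z))"
      by (simp add: avg_Suc)
  qed
  finally show ?thesis by (simp add: elcs_def)
qed

text \<open>The deficit \<open>a - elcs a b\<close> obeys the recursive inequality from
  \<open>elcs_Suc_Suc\<close>, and the right-hand side satisfies it with equality because
  \<open>1 / (2 k) + 1 - 1 / k = 1 - 1 / (2 k)\<close>.\<close>

lemma elcs_ge_greedy: "a - elcs a b \<le> 2 ^ a * (1 - 1 / (2 * real k)) ^ b"
proof (induction a arbitrary: b)
  case 0
  have "0 \<le> (1 - 1 / (2 * real k)) ^ b" using k_pos by (intro zero_le_power) (simp add: field_simps)
  then show ?case using elcs_nonneg[of 0 b] by simp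
next
  case (Suc a)
  note IH = Suc.IH
  show ?case
  proof (induction b)
    case 0
    have "real (Suc a) \<le> 2 ^ Suc a"
      using less_exp[of "Suc a"] by (metis less_imp_le of_nat_le_iff of_nat_numeral of_nat_power)
    then show ?case using elcs_nonneg[of "Suc a" 0] by simp
  next
    case (Suc b)
    let ?\<sigma> = "1 - 1 / (2 * real k)"
    have "Suc a - elcs (Suc a) (Suc b)
        \<le> 1 / k * (a - elcs a b) + (1 - 1 / k) * (Suc a - elcs (Suc a) b)"
      using elcs_Suc_Suc[of a b] k_pos by (simp add: field_simps)
    also have "\<dots> \<le> 1 / k * (2 ^ a * ?\<sigma> ^ b) + (1 - 1 / k) * (2 ^ Suc a * ?\<sigma> ^ b)"
      using k_pos by (intro add_mono mult_left_mono IH Suc.IH) auto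
    also have "\<dots> = 2 ^ Suc a * ?\<sigma> ^ Suc b"
      using k_pos by (simp add: field_simps)
    finally show ?case .
  qed
qed

text \<open>Every \<open>2 * k\<close> letters of the longer word bring a factor of at most
  \<open>exp (- 1) \<le> 1 / 2\<close>, which cancels the growth \<open>2 ^ a\<close>. Beyond
  \<open>2 * k * a\<close> the function \<open>elcs a\<close> is thus constant up to 1, and the hull
  is needed only up to there.\<close>

lemma elcs_saturated:
  assumes "2 * k * a \<le> b" shows "a \<le> elcs a b + 1"
proof -
  have "(1 - 1 / (2 * real k)) ^ (2 * k) \<le> exp (- 1 / (2 * real k)) ^ (2 * k)"
    using exp_ge_add_one_self[of "- 1 / (2 * real k)"] k_pos by (intro power_mono) auto
  also have "\<dots> = exp (- 1)"
    using k_pos by (simp add: exp_of_nat_mult[symmetric])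
  also have "\<dots> \<le> 1 / 2"
    using exp_ge_add_one_self[of 1] by (simp add: exp_minus field_simps)
  finally have "2 * (1 - 1 / (2 * real k)) ^ (2 * k) \<le> 1" by simp
  then have "(2 * (1 - 1 / (2 * real k)) ^ (2 * k)) ^ a \<le> 1"
    using k_pos by (intro power_le_one mult_nonneg_nonneg zero_le_power) auto
  then have "2 ^ a * (1 - 1 / (2 * real k)) ^ (2 * k * a) \<le> (1::real)"
    by (simp add: power_mult_distrib power_mult)
  then have "a \<le> elcs a (2 * k * a) + 1"
    using elcs_ge_greedy[of a "2 * k * a"] by simp
  also have "elcs a (2 * k * a) \<le> elcs a b" by (rule elcs_mono) (use assms in auto)
  finally show ?thesis by simp
qed

text \<open>A bound for the error in \<open>F_le_legendre\<close> at
  \<open>\<theta> = 1 / sqrt a\<close>, \<open>\<eta> = 1 / a\<close> and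
  \<open>x \<le> 2 * k * a\<close>, plus 1 for saturation.\<close>

definition rate_err :: "nat \<Rightarrow> real" where
  "rate_err a = sqrt a * (ln (1 + a) + 4 * k + 1) + 1"

lemma F_le_hull_line:
  fixes T \<kappa> x :: real
  assumes a: "a > 0" and lin: "\<And>b. b \<le> 2 * k * a \<Longrightarrow> elcs a b \<le> T + \<kappa> * b"
    and kappa: "0 \<le> \<kappa>" and x: "0 \<le> x" "x \<le> 2 * real k * real a"
  shows "F a x \<le> T + \<kappa> * x + rate_err a"
proof -
  \<comment> \<open>Raised by 1, the line bounds \<open>elcs a\<close> everywhere: beyond
    \<open>2 * k * a\<close> by saturation and \<open>0 \<le> \<kappa>\<close>.\<close>
  have lin': "elcs a b \<le> (T + 1) + \<kappa> * b" for b
  proof (cases "b \<le> 2 * k * a")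
    case False
    have "elcs a b \<le> a" by (rule elcs_le1)
    also have "a \<le> elcs a (2 * k * a) + 1" by (rule elcs_saturated) simp
    also have "\<dots> \<le> T + \<kappa> * real (2 * k * a) + 1"
      using lin[of "2 * k * a"] by simp
    also have "\<kappa> * real (2 * k * a) \<le> \<kappa> * b"
      using False kappa by (intro mult_left_mono of_nat_mono) auto
    finally show ?thesis by simp
  qed (use lin[of b] in simp)
  define r where "r = sqrt (real a)"
  have r: "1 \<le> r" "real a = r\<^sup>2" using a by (auto simp: r_def)
  have "F a x \<le> T + 1 + \<kappa> * x + (1 / r) * (a + x) + (ln (1 + 1 / (1 / a)) + 1 / a * x) / (1 / r)"
    using a r by (intro F_le_legendre lin' kappa x) auto
  also have "(1 / r) * (a + x) \<le> (1 / r) * (r\<^sup>2 + 2 * k * r\<^sup>2)"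
    using x r by (intro mult_left_mono) auto
  also have "\<dots> = r * (1 + 2 * k)"
    using r by (simp add: power2_eq_square field_simps)
  also have "(ln (1 + 1 / (1 / a)) + 1 / a * x) / (1 / r) \<le> r * (ln (1 + a) + 2 * k)"
  proof -
    have "1 / a * x \<le> 2 * k" using x a by (simp add: field_simps)
    then show ?thesis using r by (simp add: mult.commute)
  qed
  finally show ?thesis by (simp add: rate_err_def r_def algebra_simps)
qed

lemma F_ge_chord:
  fixes T \<kappa> x :: real
  assumes a: "a > 0" and b: "b1 < b2" "real b1 \<le> x" "x \<le> real b2"
    and line: "elcs a b1 = T + \<kappa> * b1" "elcs a b2 = T + \<kappa> * b2"
  shows "T + \<kappa> * x \<le> F a x"
proof -
  define s where "s = (b2 - x) / (real b2 - real b1)"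
  have s: "0 \<le> s" "s \<le> 1" using b by (auto simp: s_def field_simps)
  have x: "s * real b1 + (1 - s) * real b2 = x"
  proof -
    have "s * (real b2 - real b1) = b2 - x" using b by (simp add: s_def)
    then show ?thesis by (simp add: algebra_simps)
  qed
  have "T + \<kappa> * x = s * elcs a b1 + (1 - s) * elcs a b2"
    unfolding line by (simp add: x[symmetric] algebra_simps)
  also have "\<dots> \<le> s * F a b1 + (1 - s) * F a b2"
    using s by (intro add_mono mult_left_mono elcs_le_F) auto
  also have "\<dots> \<le> F a (s * real b1 + (1 - s) * real b2)"
    using a s by (intro F_concave_right) auto
  finally show ?thesis by (simp add: x)
qed

text \<open>One of the two touching points of the hull, \<open>b\<close> say, has its mirror image \<open>2 m + 1 - b\<close>
  between them; cutting \<open>2 m + 1\<close> into these two parts costs the error of the smaller scale only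
  once, because the hull is attained at the touching point.\<close>

lemma F_double_odd:
  assumes a: "a > 0" and D: "\<And>b. F a (real b) \<le> elcs a b + D" and m: "m < 2 * k * a"
  shows "F (2 * real a) (2 * real m + 1) \<le> elcs (2 * a) (2 * m + 1) + D + 2 * rate_err a"
proof -
  obtain b1 b2 :: nat and T \<kappa> :: real where b: "b1 \<le> m" "m < b2" "b2 \<le> 2 * k * a"
    and line: "elcs a b1 = T + \<kappa> * b1" "elcs a b2 = T + \<kappa> * b2"
    and le: "\<And>b. b \<le> 2 * k * a \<Longrightarrow> elcs a b \<le> T + \<kappa> * b"
    by (rule upper_hull_line[OF m, of "elcs a"]) blast
  have kappa: "0 \<le> \<kappa>"
  proof -
    have "\<kappa> * b1 \<le> \<kappa> * b2" using elcs_mono[of a a b1 b2] b line by simp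
    then have "0 \<le> \<kappa> * (real b2 - real b1)" by (simp add: right_diff_distrib)
    then show ?thesis using b by (simp add: zero_le_mult_iff)
  qed
  have "F (2 * real a) (2 * real m + 1) = 2 * F a (real m + 1 / 2)"
    using F_homogeneous[of 2 "real a" "real m + 1 / 2"] by (simp add: algebra_simps)
  also have "\<dots> \<le> 2 * (T + \<kappa> * (real m + 1 / 2) + rate_err a)"
  proof -
    have "real m + 1 / 2 \<le> 2 * real k * real a"
    proof -
      have "real m + 1 \<le> real (2 * k * a)" using m by linarith
      then show ?thesis by simp
    qed
    then show ?thesis
      by (intro mult_left_mono F_le_hull_line a le kappa) auto
  qed
  also have "\<dots> = 2 * T + \<kappa> * (2 * m + 1) + 2 * rate_err a"
    by (simp add: algebra_simps)
  also have "2 * T + \<kappa> * (2 * m + 1) \<le> elcs (2 * a) (2 * m + 1) + D"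
  proof -
    have step: "2 * T + \<kappa> * (2 * m + 1) \<le> elcs (2 * a) (2 * m + 1) + D"
      if bi: "elcs a bi = T + \<kappa> * bi" and range: "bi \<le> 2 * m + 1" "b1 \<le> 2 * m + 1 - bi" "2 * m + 1 - bi \<le> b2"
      for bi
    proof -
      have "T + \<kappa> * real (2 * m + 1 - bi) \<le> F a (real (2 * m + 1 - bi))"
        by (rule F_ge_chord[OF a _ _ _ line]) (use range b in auto)
      also have "\<dots> \<le> elcs a (2 * m + 1 - bi) + D" by (rule D)
      finally have "2 * T + \<kappa> * (2 * m + 1) \<le> elcs a bi + elcs a (2 * m + 1 - bi) + D"
        using bi range by (simp add: of_nat_diff algebra_simps)
      also have "elcs a bi + elcs a (2 * m + 1 - bi) \<le> elcs (2 * a) (2 * m + 1)"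
        using elcs_superadd[of a bi a "2 * m + 1 - bi"] range by (simp add: mult_2)
      finally show ?thesis by simp
    qed
    \<comment> \<open>The point \<open>b1\<close> is mirrored if its image
      \<open>2 * m + 1 - b1\<close> does not exceed \<open>b2\<close>; otherwise the image of
      \<open>b2\<close> lies above \<open>b1\<close>.\<close>
    show ?thesis
    proof (cases "2 * m + 1 \<le> b1 + b2")
      case True
      then show ?thesis using b by (intro step[OF line(1)]) auto
    next
      case False
      then show ?thesis using b by (intro step[OF line(2)]) auto
    qed
  qed
  finally show ?thesis by simp
qed

text \<open>\<open>F_double_odd\<close> handles odd \<open>b\<close> below the saturated range.
  There an even \<open>b > 0\<close> gives up one letter at cost 1, and from
  \<open>2 * k * (2 * a)\<close> on saturation gives the error 1.\<close>

lemma F_double: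
  assumes a: "a > 0" and D: "\<And>b. F a (real b) \<le> elcs a b + D" and D0: "0 \<le> D"
  shows "F (2 * real a) (real b) \<le> elcs (2 * a) b + (D + 2 * rate_err a + 1)"
proof -
  have err: "0 \<le> rate_err a" by (simp add: rate_err_def)
  consider "2 * k * (2 * a) \<le> b" | "b = 0" | m where "b = 2 * m + 1" "m < 2 * k * a"
    | m where "b = 2 * m + 2" "m < 2 * k * a"
  proof -
    consider "b = 0" | m where "b = 2 * m + 1" | m where "b = 2 * m + 2"
    proof (cases b)
      case (Suc c)
      consider "c = 2 * (c div 2)" | "c = 2 * (c div 2) + 1" by linarith
      then show ?thesis using that(2)[of "c div 2"] that(3)[of "c div 2"] Suc by cases auto
    qed (use that in auto)
    then show ?thesis
    proof cases
      case 1 then show ?thesis using that by auto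
    next
      case (2 m) then show ?thesis using that by (cases "m < 2 * k * a") auto
    next
      case (3 m) then show ?thesis using that by (cases "m < 2 * k * a") auto
    qed
  qed
  then show ?thesis
  proof cases
    case 1
    have "F (2 * real a) b \<le> real (2 * a)" using F_le1[of "2 * real a" b] by simp
    also have "\<dots> \<le> elcs (2 * a) b + 1" by (rule elcs_saturated) (rule 1)
    finally show ?thesis using err D0 by simp
  next
    case 2
    then show ?thesis
      using F_le1[of 0 "2 * real a"] elcs_nonneg[of "2 * a" 0] err D0 by (simp add: F_commute)
  next
    case (3 m)
    then show ?thesis using F_double_odd[OF a D, of m] by (simp add: add.commute)
  next
    case (4 m)
    have "F (2 * real a) b \<le> F (2 * real a) (2 * real m + 1) + 1"
      using F_add_right_le[of "2 * real a" "2 * real m + 1" 1] 4 by simp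
    also have "F (2 * real a) (2 * real m + 1) \<le> elcs (2 * a) (2 * m + 1) + D + 2 * rate_err a"
      by (rule F_double_odd[OF a D]) (use 4 in auto)
    also have "elcs (2 * a) (2 * m + 1) \<le> elcs (2 * a) b" by (rule elcs_mono) (use 4 in auto)
    finally show ?thesis by simp
  qed
qed

text \<open>Strong induction by halving \<open>a\<close>. The square root shrinks by a fixed factor,
  and the room gained absorbs the new error \<open>2 * rate_err\<close>.\<close>

lemma F_le_elcs:
  assumes "a > 0"
  shows "F a (real b) \<le> elcs a b + (24 * k + 18) * (sqrt a * (1 + ln (1 + a)))"
  using assms
proof (induction a arbitrary: b rule: less_induct)
  case (less a)
  define C :: real where "C = 24 * k + 18"
  have C: "C \<ge> 18" by (simp add: C_def)
  show ?case
  proof (cases "a = 1")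
    case True
    have "0 \<le> ln (2::real)" by simp
    then have "1 \<le> C * (1 + ln 2)" using mult_mono[of 1 C 1 "1 + ln 2"] C by simp
    then show ?thesis
      using F_le1[of 1 b] elcs_nonneg[of 1 b] True by (simp add: C_def)
  next
    case False
    define a' where "a' = a div 2"
    have a': "a' > 0" "a' < a" "2 * a' \<le> a" using False less.prems by (auto simp: a'_def)
    define L where "L = 1 + ln (1 + real a)"
    define D where "D = C * (sqrt a' * (1 + ln (1 + a')))"
    have L: "1 \<le> L" "1 + ln (1 + real a') \<le> L" using a' by (auto simp: L_def)
    have D0: "0 \<le> D" using C by (simp add: D_def)
    have double: "F (2 * real a') b \<le> elcs (2 * a') b + (D + 2 * rate_err a' + 1)"
      using less.IH[OF a'(2,1)] by (intro F_double a' D0) (simp add: D_def C_def)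
    have upper: "F a b \<le> elcs a b + (D + 2 * rate_err a' + 2)"
    proof -
      \<comment> \<open>An odd \<open>a\<close> exceeds \<open>2 * a'\<close> by one letter, which
        costs 1.\<close>
      have "real a \<le> 2 * real a' + 1" by (simp add: a'_def)
      then have "F a b \<le> F (2 * real a' + 1) b"
        using F_mono_right[of b "real a" "2 * real a' + 1"] by (simp add: F_commute)
      also have "\<dots> \<le> F (2 * real a') b + 1"
        using F_add_right_le[of b "2 * real a'" 1] by (simp add: F_commute)
      also note double
      also have "elcs (2 * a') b \<le> elcs a b" by (rule elcs_mono) (use a' in auto)
      finally show ?thesis by simp
    qed
    have s': "1 \<le> sqrt a'" using a' by simp
    have "D \<le> C * (sqrt a' * L)"
      unfolding D_def using C L by (intro mult_left_mono) auto
    moreover have "rate_err a' \<le> sqrt a' * (L + 4 * k * L) + 1"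
    proof -
      have "real k * 1 \<le> k * L" using L by (intro mult_left_mono) auto
      then have "ln (1 + a') + 4 * k + 1 \<le> L + 4 * k * L" using L by simp
      then have "sqrt a' * (ln (1 + a') + 4 * k + 1) \<le> sqrt a' * (L + 4 * k * L)"
        by (rule mult_left_mono) simp
      then show ?thesis by (simp add: rate_err_def)
    qed
    moreover have "1 \<le> sqrt a' * L" using mult_mono[of 1 "sqrt a'" 1 L] s' L by simp
    ultimately have "D + 2 * rate_err a' + 2 \<le> (C + (2 + 8 * k) + 4) * (sqrt a' * L)"
      by (simp add: algebra_simps)
    \<comment> \<open>The constant \<open>24 * k + 18\<close> is the solution of this equation for
      \<open>C\<close>; the factor \<open>4 / 3\<close> is below \<open>sqrt 2\<close>, the gain
      from halving.\<close>
    also have "C + (2 + 8 * k) + 4 = C * (4 / 3)" by (simp add: C_def)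
    also have "C * (4 / 3) * (sqrt a' * L) = C * (4 / 3 * sqrt a' * L)" by simp
    also have "\<dots> \<le> C * (sqrt a * L)"
    proof -
      have "4 / 3 * sqrt a' = sqrt (16 / 9 * a')" by (simp add: real_sqrt_mult real_sqrt_divide)
      also have "\<dots> \<le> sqrt a" using a' by (intro real_sqrt_le_mono) linarith
      finally show ?thesis using C L by (intro mult_left_mono mult_right_mono) auto
    qed
    finally show ?thesis using upper by (simp add: C_def L_def)
  qed
qed

end

section \<open>Uniform random words\<close>

lemma measurable_map_word:
  fixes Z :: "nat \<Rightarrow> 'a \<Rightarrow> nat"
  assumes "\<And>m. m \<in> set xs \<Longrightarrow> Z m \<in> measurable M (count_space A)"
  shows "(\<lambda>\<omega>. map (\<lambda>m. Z m \<omega>) xs) \<in> measurable M (count_space UNIV)"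
proof -
  have sets: "{\<omega> \<in> space M. map (\<lambda>m. Z m \<omega>) xs = w} \<in> sets M" for w
    using assms
  proof (induction xs arbitrary: w)
    case Nil
    then show ?case by (cases "w = []") auto
  next
    case (Cons x xs)
    show ?case
    proof (cases w)
      case (Cons c w')
      have "Z x \<in> measurable M (count_space A)" using Cons.prems by simp
      then have "Z x -` ({c} \<inter> A) \<inter> space M \<in> sets M" by (rule measurable_sets) auto
      moreover have "Z x -` ({c} \<inter> A) \<inter> space M = {\<omega> \<in> space M. Z x \<omega> = c}"
        using measurable_space[OF \<open>Z x \<in> measurable M (count_space A)\<close>] by auto
      moreover have "{\<omega> \<in> space M. map (\<lambda>m. Z m \<omega>) xs = w'} \<in> sets M"
        using Cons.prems by (intro Cons.IH) auto
      ultimately have "{\<omega> \<in> space M. Z x \<omega> = c} \<inter> {\<omega> \<in> space M. map (\<lambda>m. Z m \<omega>) xs = w'} \<in> sets M"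
        by auto
      also have "{\<omega> \<in> space M. Z x \<omega> = c} \<inter> {\<omega> \<in> space M. map (\<lambda>m. Z m \<omega>) xs = w'}
          = {\<omega> \<in> space M. map (\<lambda>m. Z m \<omega>) (x # xs) = w}"
        using Cons by auto
      finally show ?thesis .
    qed simp
  qed
  show ?thesis
    unfolding measurable_count_space_eq_countable[OF countableI_type]
    using sets by (auto simp: vimage_def Int_def conj_commute)
qed

text \<open>For \<open>k > 0\<close> the prescribed point masses add up to 1, so values outside
  \<open>words k n\<close> have probability 0 without a separate clause.\<close>

definition uniform_word :: "'a measure \<Rightarrow> nat \<Rightarrow> nat \<Rightarrow> ('a \<Rightarrow> nat list) \<Rightarrow> bool" where
  "uniform_word M k n W \<longleftrightarrow> W \<in> measurable M (count_space UNIV) \<and>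
     (\<forall>w\<in>words k n. measure M {\<omega> \<in> space M. W \<omega> = w} = 1 / real k ^ n)"

lemma (in prob_space) uniform_word_AE:
  assumes "uniform_word M k n W" "k > 0"
  shows "AE \<omega> in M. W \<omega> \<in> words k n"
proof -
  have W: "W \<in> measurable M (count_space UNIV)" using assms by (simp add: uniform_word_def)
  have sets: "{\<omega> \<in> space M. W \<omega> \<in> A} \<in> sets M" for A
    using measurable_sets[OF W, of A] by (simp add: vimage_def Int_def conj_commute)
  have "prob {\<omega> \<in> space M. W \<omega> \<in> words k n} = prob (\<Union>w\<in>words k n. {\<omega> \<in> space M. W \<omega> = w})"
    by (intro arg_cong[where f = prob]) auto
  also have "\<dots> = (\<Sum>w\<in>words k n. prob {\<omega> \<in> space M. W \<omega> = w})"
    using sets[of "{_}"] by (intro finite_measure_finite_Union) (auto simp: disjoint_family_on_def)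
  also have "\<dots> = 1"
    using assms by (simp add: uniform_word_def card_words)
  finally show ?thesis using prob_Collect_eq_1[OF sets] by simp
qed

lemma (in prob_space) uniform_word_expectation:
  assumes W: "uniform_word M k n W" and k: "k > 0"
  shows "expectation (\<lambda>\<omega>. f (W \<omega>)) = avg k n f"
proof -
  have meas: "W \<in> measurable M (count_space UNIV)" using W by (simp add: uniform_word_def)
  have sets: "{\<omega> \<in> space M. W \<omega> = w} \<in> sets M" for w
    using measurable_sets[OF meas, of "{w}"] by (simp add: vimage_def Int_def conj_commute)
  have "expectation (\<lambda>\<omega>. f (W \<omega>))
      = expectation (\<lambda>\<omega>. \<Sum>w\<in>words k n. f w * indicator {\<omega> \<in> space M. W \<omega> = w} \<omega>)"
  proof (rule integral_cong_AE)
    show "(\<lambda>\<omega>. f (W \<omega>)) \<in> borel_measurable M"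
      by (rule measurable_compose[OF meas]) simp
    show "(\<lambda>\<omega>. \<Sum>w\<in>words k n. f w * indicator {\<omega> \<in> space M. W \<omega> = w} \<omega>) \<in> borel_measurable M"
      using sets by (intro borel_measurable_sum borel_measurable_times borel_measurable_indicator) auto
    show "AE \<omega> in M. f (W \<omega>) = (\<Sum>w\<in>words k n. f w * indicator {\<omega> \<in> space M. W \<omega> = w} \<omega>)"
      using uniform_word_AE[OF W k] AE_space
    proof eventually_elim
      case (elim \<omega>)
      have "(\<Sum>w\<in>words k n. f w * indicator {\<omega> \<in> space M. W \<omega> = w} \<omega>)
          = (\<Sum>w\<in>words k n. if w = W \<omega> then f w else 0)"
        using elim by (intro sum.cong) (auto simp: indicator_def)
      then show ?case using elim by simp
    qed
  qed
  also have "\<dots> = (\<Sum>w\<in>words k n. f w * prob {\<omega> \<in> space M. W \<omega> = w})"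
    using sets by (subst Bochner_Integration.integral_sum)
      (auto intro!: integrable_mult_right integrable_real_indicator simp: emeasure_eq_measure)
  also have "\<dots> = avg k n f"
    using W by (simp add: uniform_word_def avg_def sum_divide_distrib)
  finally show ?thesis .
qed

lemma (in prob_space) uniform_word_prob:
  assumes W: "uniform_word M k n W" and k: "k > 0"
  shows "prob {\<omega> \<in> space M. P (W \<omega>)} = freq k n P"
proof -
  have "prob {\<omega> \<in> space M. P (W \<omega>)} = expectation (indicator {\<omega> \<in> space M. P (W \<omega>)})"
    by (simp add: Int_absorb2)
  also have "\<dots> = expectation (\<lambda>\<omega>. of_bool (P (W \<omega>)))"
    by (intro Bochner_Integration.integral_cong) (auto simp: indicator_def)
  also have "\<dots> = freq k n P"
    unfolding freq_def by (rule uniform_word_expectation[OF W k])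
  finally show ?thesis .
qed

text \<open>Almost surely \<open>A\<close> has length \<open>a\<close>, so the concatenation
  determines both words and its point masses factorise.\<close>

lemma (in prob_space) uniform_word_append:
  assumes A: "uniform_word M k a A" and B: "uniform_word M k b B"
    and indep: "\<And>u v. prob {\<omega> \<in> space M. A \<omega> = u \<and> B \<omega> = v}
      = prob {\<omega> \<in> space M. A \<omega> = u} * prob {\<omega> \<in> space M. B \<omega> = v}"
    and k: "k > 0"
  shows "uniform_word M k (a + b) (\<lambda>\<omega>. A \<omega> @ B \<omega>)"
  unfolding uniform_word_def
proof (intro conjI ballI)
  have meas: "A \<in> measurable M (count_space UNIV)" "B \<in> measurable M (count_space UNIV)"
    using A B by (auto simp: uniform_word_def)
  show "(\<lambda>\<omega>. A \<omega> @ B \<omega>) \<in> measurable M (count_space UNIV)"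
    by (rule measurable_compose_countable[OF _ meas(1)]) (rule measurable_compose[OF meas(2)], simp)
  have sets: "{\<omega> \<in> space M. A \<omega> @ B \<omega> = w} \<in> sets M" for w
    using measurable_sets[OF \<open>(\<lambda>\<omega>. A \<omega> @ B \<omega>) \<in> measurable M (count_space UNIV)\<close>, of "{w}"]
    by (simp add: vimage_def Int_def conj_commute)
  have sets1: "{\<omega> \<in> space M. A \<omega> = w} \<in> sets M" for w
    using measurable_sets[OF meas(1), of "{w}"] by (simp add: vimage_def Int_def conj_commute)
  have sets2: "{\<omega> \<in> space M. B \<omega> = w} \<in> sets M" for w
    using measurable_sets[OF meas(2), of "{w}"] by (simp add: vimage_def Int_def conj_commute)
  fix w assume w: "w \<in> words k (a + b)"
  then have tw: "take a w \<in> words k a" "drop a w \<in> words k b"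
    by (auto simp: words_def dest: in_set_takeD in_set_dropD)
  have "prob {\<omega> \<in> space M. A \<omega> @ B \<omega> = w}
      = prob {\<omega> \<in> space M. A \<omega> = take a w \<and> B \<omega> = drop a w}"
  proof (rule finite_measure_eq_AE)
    show "AE x in M. (x \<in> {\<omega> \<in> space M. A \<omega> @ B \<omega> = w})
        = (x \<in> {\<omega> \<in> space M. A \<omega> = take a w \<and> B \<omega> = drop a w})"
      using uniform_word_AE[OF A k]
    proof eventually_elim
      case (elim \<omega>)
      then have "length (A \<omega>) = a" by (rule length_words)
      moreover have "w = take a w @ drop a w" by simp
      ultimately have "A \<omega> @ B \<omega> = w \<longleftrightarrow> A \<omega> = take a w \<and> B \<omega> = drop a w"
        by (metis append_eq_append_conv_if append_eq_conv_conj)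
      then show ?case by simp
    qed
    have "{\<omega> \<in> space M. A \<omega> = take a w \<and> B \<omega> = drop a w}
        = {\<omega> \<in> space M. A \<omega> = take a w} \<inter> {\<omega> \<in> space M. B \<omega> = drop a w}" by auto
    then show "{\<omega> \<in> space M. A \<omega> = take a w \<and> B \<omega> = drop a w} \<in> sets M"
      using sets1 sets2 by auto
  qed (rule sets)
  also have "\<dots> = 1 / real k ^ (a + b)"
    unfolding indep using A B tw by (simp add: uniform_word_def power_add)
  finally show "prob {\<omega> \<in> space M. A \<omega> @ B \<omega> = w} = 1 / real k ^ (a + b)" .
qed

text \<open>The link from iid letters to averages over words; the point mass of a word is the
  product over its letters.\<close>

lemma (in prob_space) iid_uniform_word:
  assumes iid: "iid_uniform k I Z" and sub: "{i..j} \<subseteq> I" and k: "k > 0"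
  shows "uniform_word M k (Suc j - i) (word Z i j)"
proof -
  have iv: "indep_vars (\<lambda>_. count_space {..<k}) Z I"
    and distr: "\<And>m. m \<in> I \<Longrightarrow> distr M (count_space {..<k}) (Z m) = uniform_count_measure {..<k}"
    using iid by (auto simp: iid_uniform_def)
  have Z: "Z m \<in> measurable M (count_space {..<k})" if "m \<in> I" for m
    using iv that by (auto simp: indep_vars_def)
  have meas: "word Z i j \<in> measurable M (count_space UNIV)"
    unfolding word_def by (rule measurable_map_word[where A = "{..<k}"], rule Z) (use sub in auto)
  have "prob {\<omega> \<in> space M. word Z i j \<omega> = w} = 1 / real k ^ (Suc j - i)"
    if w: "w \<in> words k (Suc j - i)" for w
  proof (cases "i \<le> j")
    case False
    then have "w = []" using length_words[OF w] by simp
    then have "{\<omega> \<in> space M. word Z i j \<omega> = w} = space M" using False by (auto simp: word_def)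
    then show ?thesis using False by (simp add: prob_space)
  next
    case True
    have letter: "w ! (m - i) < k" if "m \<in> {i..j}" for m
    proof -
      have "w ! (m - i) \<in> set w" using w that by (intro nth_mem) (auto simp: words_def)
      then show ?thesis using w by (auto simp: words_def)
    qed
    have "{\<omega> \<in> space M. word Z i j \<omega> = w}
        = (\<Inter>m\<in>{i..j}. Z m -` {w ! (m - i)} \<inter> space M)" (is "?L = ?R")
    proof (intro set_eqI)
      fix \<omega>
      have "word Z i j \<omega> = w \<longleftrightarrow> (\<forall>n<Suc j - i. Z (i + n) \<omega> = w ! n)"
        using length_words[OF w] by (auto simp: word_def list_eq_iff_nth_eq simp del: upt_Suc)
      also have "\<dots> \<longleftrightarrow> (\<forall>m\<in>{i..j}. Z m \<omega> = w ! (m - i))"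
      proof safe
        fix m assume "\<forall>n<Suc j - i. Z (i + n) \<omega> = w ! n" "m \<in> {i..j}"
        then show "Z m \<omega> = w ! (m - i)" by (auto dest!: spec[of _ "m - i"])
      next
        fix n assume "\<forall>m\<in>{i..j}. Z m \<omega> = w ! (m - i)" "n < Suc j - i"
        then show "Z (i + n) \<omega> = w ! n" by (auto dest!: bspec[of _ _ "i + n"])
      qed
      finally show "\<omega> \<in> ?L \<longleftrightarrow> \<omega> \<in> ?R" using True by auto
    qed
    also have "prob \<dots> = (\<Prod>m\<in>{i..j}. prob (Z m -` {w ! (m - i)} \<inter> space M))"
      using True letter by (intro indep_varsD[OF iv]) (use sub in auto)
    also have "\<dots> = (\<Prod>m\<in>{i..j}. 1 / real k)"
    proof (rule prod.cong[OF refl])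
      fix m assume m: "m \<in> {i..j}"
      then have "m \<in> I" using sub by auto
      have "prob (Z m -` {w ! (m - i)} \<inter> space M)
          = measure (distr M (count_space {..<k}) (Z m)) {w ! (m - i)}"
        using letter[OF m] by (subst measure_distr[OF Z[OF \<open>m \<in> I\<close>]]) auto
      also have "\<dots> = 1 / real k"
        using letter[OF m] by (simp add: distr[OF \<open>m \<in> I\<close>] measure_uniform_count_measure)
      finally show "prob (Z m -` {w ! (m - i)} \<inter> space M) = 1 / real k" .
    qed
    finally show ?thesis using True by (simp add: power_one_over)
  qed
  then show ?thesis using meas by (simp add: uniform_word_def)
qed

context alphabet begin

lemma prob_space_uniform_letters: "prob_space (uniform_letters k)"
  unfolding uniform_letters_def using k_pos
  by (intro prob_space_PiM prob_space_uniform_count_measure) auto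

lemma uniform_letters_iid:
  "prob_space.iid_uniform (uniform_letters k) k UNIV (\<lambda>i U. U i)"
proof -
  let ?u = "uniform_count_measure {..<k}"
  interpret letters: product_prob_space "\<lambda>_::nat. ?u" UNIV
    using k_pos by (intro product_prob_spaceI prob_space_uniform_count_measure) auto
  interpret prob_space "uniform_letters k" by (rule prob_space_uniform_letters)
  have rv: "random_variable (count_space {..<k}) (\<lambda>U. U i)" for i
  proof -
    have "(\<lambda>U. U i) \<in> measurable (uniform_letters k) ?u"
      unfolding uniform_letters_def by (rule measurable_component_singleton) simp
    moreover have "measurable (uniform_letters k) ?u = measurable (uniform_letters k) (count_space {..<k})"
      by (rule measurable_cong_sets) (simp_all add: sets_uniform_count_measure)
    ultimately show ?thesis by simp
  qed
  have distr: "distr (uniform_letters k) (count_space {..<k}) (\<lambda>U. U i) = ?u" for i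
  proof -
    have "distr (uniform_letters k) (count_space {..<k}) (\<lambda>U. U i)
        = distr (uniform_letters k) ?u (\<lambda>U. U i)"
      by (intro distr_cong refl) (simp add: sets_uniform_count_measure)
    then show ?thesis
      using letters.PiM_component[of i] by (simp add: uniform_letters_def)
  qed
  have sets: "sets (Pi\<^sub>M UNIV (\<lambda>_::nat. count_space {..<k})) = sets (uniform_letters k)"
    unfolding uniform_letters_def by (intro sets_PiM_cong refl) (simp add: sets_uniform_count_measure)
  \<comment> \<open>The family of all coordinates is the identity map, so its joint law is the
    product measure itself.\<close>
  have "indep_vars (\<lambda>_. count_space {..<k}) (\<lambda>i U. U i) UNIV"
    by (subst indep_vars_iff_distr_eq_PiM'[OF _ rv])
      (use sets in \<open>simp_all add: distr distr_id2 restrict_UNIV uniform_letters_def[symmetric]\<close>)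
  then show ?thesis
    unfolding iid_uniform_def using distr by simp
qed

text \<open>The two prefixes, glued together, form one uniform word of length \<open>a + b\<close>
  on the product space, so the integral is a finite average.\<close>

lemma expected_lcs_eq: "expected_lcs k a b = elcs a b"
proof -
  let ?L = "uniform_letters k" and ?P = "uniform_letters k \<Otimes>\<^sub>M uniform_letters k"
  interpret L: prob_space ?L by (rule prob_space_uniform_letters)
  interpret P: pair_prob_space ?L ?L ..
  define A where "A n U = map U [1..<Suc n]" for n and U :: "nat \<Rightarrow> nat"
  have A: "uniform_word ?L k n (A n)" for n
    using L.iid_uniform_word[OF uniform_letters_iid, of 1 n] k_pos
    by (simp add: word_def[abs_def] A_def[abs_def] del: upt_Suc)
  have meas: "A n \<in> measurable ?L (count_space UNIV)" for n
    using A by (auto simp: uniform_word_def)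
  have sets: "{U \<in> space ?L. A n U = u} \<in> sets ?L" for n u
    using measurable_sets[OF meas, of "{u}"] by (simp add: vimage_def Int_def conj_commute)
  have rect: "P.prob ({U \<in> space ?L. Q U} \<times> {V \<in> space ?L. R V})
      = L.prob {U \<in> space ?L. Q U} * L.prob {V \<in> space ?L. R V}"
    if "{U \<in> space ?L. Q U} \<in> sets ?L" "{V \<in> space ?L. R V} \<in> sets ?L" for Q R
    using L.emeasure_pair_measure_Times[OF that]
    by (simp add: P.emeasure_eq_measure L.emeasure_eq_measure ennreal_mult[symmetric])
  have fst: "P.prob {\<omega> \<in> space ?P. A n (fst \<omega>) = u} = L.prob {U \<in> space ?L. A n U = u}" for n u
  proof -
    have "{\<omega> \<in> space ?P. A n (fst \<omega>) = u} = {U \<in> space ?L. A n U = u} \<times> {V \<in> space ?L. True}"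
      by (auto simp: space_pair_measure)
    then show ?thesis using rect[OF sets, of "\<lambda>_. True" n u] by (simp add: L.prob_space)
  qed
  have snd: "P.prob {\<omega> \<in> space ?P. A n (snd \<omega>) = u} = L.prob {U \<in> space ?L. A n U = u}" for n u
  proof -
    have "{\<omega> \<in> space ?P. A n (snd \<omega>) = u} = {U \<in> space ?L. True} \<times> {V \<in> space ?L. A n V = u}"
      by (auto simp: space_pair_measure)
    then show ?thesis using rect[OF _ sets, of "\<lambda>_. True" n u] by (simp add: L.prob_space)
  qed
  have "uniform_word ?P k (a + b) (\<lambda>\<omega>. A a (fst \<omega>) @ A b (snd \<omega>))"
  proof (rule P.uniform_word_append)
    show "uniform_word ?P k a (\<lambda>\<omega>. A a (fst \<omega>))"
      using A[of a] measurable_compose[OF measurable_fst meas] by (simp add: uniform_word_def fst)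
    show "uniform_word ?P k b (\<lambda>\<omega>. A b (snd \<omega>))"
      using A[of b] measurable_compose[OF measurable_snd meas] by (simp add: uniform_word_def snd)
    fix u v
    have "{\<omega> \<in> space ?P. A a (fst \<omega>) = u \<and> A b (snd \<omega>) = v}
        = {U \<in> space ?L. A a U = u} \<times> {V \<in> space ?L. A b V = v}"
      by (auto simp: space_pair_measure)
    then show "P.prob {\<omega> \<in> space ?P. A a (fst \<omega>) = u \<and> A b (snd \<omega>) = v}
      = P.prob {\<omega> \<in> space ?P. A a (fst \<omega>) = u} * P.prob {\<omega> \<in> space ?P. A b (snd \<omega>) = v}"
      using rect[OF sets sets, of a u b v] by (simp add: fst snd)
  qed (rule k_pos)
  from P.uniform_word_expectation[OF this k_pos, of "\<lambda>w. real (lcs_length (take a w) (drop a w))"]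
  show ?thesis
    by (simp add: elcs_eq_avg expected_lcs_def A_def case_prod_unfold del: upt_Suc)
qed

end

section \<open>The slope of the mean LCS-function\<close>

lemma floor_le_round_pos: "nat \<lfloor>x\<rfloor> \<le> round_pos x"
  unfolding round_pos_def using nat_mono[OF floor_mono[of x "x + 1 / 2"]] by (simp add: round_def)

lemma round_pos_le_floor: "round_pos x \<le> nat \<lfloor>x\<rfloor> + 1"
proof -
  have "round x \<le> \<lfloor>x\<rfloor> + 1"
    unfolding round_def using floor_mono[of "x + 1 / 2" "x + 1"] by simp
  then have "nat (round x) \<le> nat \<lfloor>x\<rfloor> + 1" by linarith
  then show ?thesis by (simp add: round_pos_def)
qed

context alphabet begin

text \<open>\<open>round_pos\<close> lies between the floor and the floor plus 1, so rounding
  changes the mean by at most 2, which vanishes after division by \<open>n\<close>.\<close>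

lemma mean_lcs_n_tendsto:
  assumes "\<bar>p\<bar> < 1"
  shows "(\<lambda>n. mean_lcs_n k n p) \<longlonglongrightarrow> F (1 - p) (1 + p)"
proof (rule tendsto_sandwich)
  have lim: "(\<lambda>n. scaled (1 - p) (1 + p) (real n) / real n) \<longlonglongrightarrow> F (1 - p) (1 + p)"
    using assms by (intro filterlim_compose[OF scaled_tendsto_F filterlim_real_sequentially]) auto
  then show "(\<lambda>n. scaled (1 - p) (1 + p) (real n) / real n) \<longlonglongrightarrow> F (1 - p) (1 + p)" .
  have "(\<lambda>n. 2 / real n) \<longlonglongrightarrow> 0" by (rule lim_const_over_n)
  from tendsto_add[OF lim this]
  show "(\<lambda>n. scaled (1 - p) (1 + p) (real n) / real n + 2 / real n) \<longlonglongrightarrow> F (1 - p) (1 + p)" by simp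
  have eq: "mean_lcs_n k n p = elcs (round_pos (n * (1 - p))) (round_pos (n * (1 + p))) / n" for n
    by (simp add: mean_lcs_n_def expected_lcs_eq right_diff_distrib distrib_left)
  show "eventually (\<lambda>n. scaled (1 - p) (1 + p) (real n) / real n \<le> mean_lcs_n k n p) sequentially"
    unfolding eq scaled_def
    by (intro always_eventually allI divide_right_mono elcs_mono floor_le_round_pos) auto
  show "eventually (\<lambda>n. mean_lcs_n k n p \<le> scaled (1 - p) (1 + p) (real n) / real n + 2 / real n) sequentially"
  proof (intro always_eventually allI)
    fix n :: nat
    let ?a = "n * (1 - p)" and ?b = "n * (1 + p)"
    have "elcs (round_pos ?a) (round_pos ?b) \<le> elcs (nat \<lfloor>?a\<rfloor> + 1) (nat \<lfloor>?b\<rfloor> + 1)"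
      by (intro elcs_mono round_pos_le_floor)
    also have "\<dots> \<le> scaled (1 - p) (1 + p) n + 2"
      unfolding scaled_def by (rule order.trans[OF elcs_lipschitz[of _ _ "nat \<lfloor>?a\<rfloor>" "nat \<lfloor>?b\<rfloor>"]]) simp
    finally have "elcs (round_pos ?a) (round_pos ?b) / n \<le> (scaled (1 - p) (1 + p) n + 2) / n"
      by (rule divide_right_mono) simp
    then show "mean_lcs_n k n p \<le> scaled (1 - p) (1 + p) (real n) / real n + 2 / real n"
      by (simp add: eq add_divide_distrib)
  qed
qed

lemma mean_lcs_eq: "\<bar>p\<bar> < 1 \<Longrightarrow> mean_lcs k p = F (1 - p) (1 + p)"
  unfolding mean_lcs_def by (intro limI mean_lcs_n_tendsto)

lemma mean_lcs_star_eq: "mean_lcs_star k = F 1 1"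
  unfolding mean_lcs_star_def
proof (rule limI)
  have "(\<lambda>n. scaled 1 1 (real n) / real n) \<longlonglongrightarrow> F 1 1"
    by (intro filterlim_compose[OF scaled_tendsto_F filterlim_real_sequentially]) auto
  then show "(\<lambda>n. expected_lcs k n n / real n) \<longlonglongrightarrow> F 1 1"
    by (simp add: scaled_def expected_lcs_eq)
qed

lemma mean_lcs_minus: "\<bar>p\<bar> < 1 \<Longrightarrow> mean_lcs k (- p) = mean_lcs k p"
  by (simp add: mean_lcs_eq F_commute)

lemma F_lipschitz:
  assumes "0 \<le> x" "0 \<le> y" "0 \<le> x'" "0 \<le> y'"
  shows "F x' y' \<le> F x y + \<bar>x' - x\<bar> + \<bar>y' - y\<bar>"
proof -
  have right: "F x y' \<le> F x y + \<bar>y' - y\<bar>" if "0 \<le> x" "0 \<le> y" "0 \<le> y'" for x y y'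
  proof -
    have "F x y' \<le> F x (y + \<bar>y' - y\<bar>)" using that by (intro F_mono_right) auto
    also have "\<dots> \<le> F x y + \<bar>y' - y\<bar>" using that by (intro F_add_right_le) auto
    finally show ?thesis .
  qed
  show ?thesis
    using right[of x' y y'] right[of y x x'] assms by (simp add: F_commute[of y])
qed

lemma mean_lcs_lipschitz:
  assumes "\<bar>p\<bar> < 1" "\<bar>q\<bar> < 1"
  shows "mean_lcs k p \<le> mean_lcs k q + 2 * \<bar>p - q\<bar>"
  using F_lipschitz[of "1 - q" "1 + q" "1 - p" "1 + p"] assms abs_minus_commute[of q p]
  by (simp add: mean_lcs_eq abs_less_iff)

text \<open>The level set is bounded by \<open>1 - F 1 1 < 1\<close>, because \<open>F\<close> is at
  most its first argument, and by continuity it contains its supremum. Hence the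
  \<open>GREATEST\<close> in \<open>p_M\<close> denotes a genuine maximum.\<close>

lemma p_M_attains:
  assumes "F 1 1 > 0"
  shows "0 \<le> p_M k" "p_M k < 1" "mean_lcs k (p_M k) = F 1 1"
proof -
  define S where "S = {p \<in> {-1<..<1}. mean_lcs k p = mean_lcs k 0}"
  have g: "mean_lcs k 0 = F 1 1" by (simp add: mean_lcs_eq)
  have S0: "0 \<in> S" by (simp add: S_def)
  then have "S \<noteq> {}" by blast
  have upper: "p \<le> 1 - F 1 1" if "p \<in> S" for p
  proof -
    have "\<bar>p\<bar> < 1" using that by (auto simp: S_def)
    then have "mean_lcs k p \<le> 1 - p"
      using F_le1[of "1 - p" "1 + p"] mean_lcs_eq[of p] by simp
    then show ?thesis using that by (simp add: S_def g)
  qed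
  have bdd: "bdd_above S" using upper by (rule bdd_aboveI)
  define s where "s = Sup S"
  have s: "0 \<le> s" "s < 1"
    using cSup_upper[OF S0 bdd] cSup_least[of S "1 - F 1 1"] S0 upper assms by (force simp: s_def)+
  have ms: "mean_lcs k s = F 1 1"
  proof -
    have "\<bar>mean_lcs k s - F 1 1\<bar> \<le> e" if "e > 0" for e
    proof -
      obtain p where p: "p \<in> S" "s - e / 2 < p"
        using less_cSup_iff[OF \<open>S \<noteq> {}\<close> bdd, of "s - e / 2"] \<open>e > 0\<close> by (auto simp: s_def)
      have "p \<le> s" using p bdd by (auto simp: s_def intro: cSup_upper)
      moreover have "mean_lcs k p = F 1 1" "\<bar>p\<bar> < 1" using p by (auto simp: S_def g)
      ultimately show ?thesis
        using mean_lcs_lipschitz[of p s] mean_lcs_lipschitz[of s p] s p by auto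
    qed
    then have "\<bar>mean_lcs k s - F 1 1\<bar> \<le> 0" by (rule field_le_epsilon[of _ 0, simplified])
    then show ?thesis by simp
  qed
  have "p_M k = s"
    unfolding p_M_def
  proof (rule Greatest_equality)
    show "s \<in> {-1<..<1} \<and> mean_lcs k s = mean_lcs k 0" using s ms g by simp
    fix p assume "p \<in> {-1<..<1} \<and> mean_lcs k p = mean_lcs k 0"
    then show "p \<le> s" unfolding s_def by (intro cSup_upper bdd) (simp add: S_def)
  qed
  then show "0 \<le> p_M k" "p_M k < 1" "mean_lcs k (p_M k) = F 1 1" using s ms by auto
qed

text \<open>If \<open>p_M k > 0\<close>, the maximal value is still attained at
  \<open>p_M k\<close>, which serves as \<open>p\<close>. Otherwise differentiability holds at 0,
  where evenness forces the derivative to vanish.\<close>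

lemma mean_lcs_above_line:
  assumes diff: "mean_lcs k differentiable (at (p_M k))" and pos: "F 1 1 > 0" and e: "e > 0"
  obtains p where "0 < p" "p < 1" "mean_lcs k p > F 1 1 - p * e"
proof (cases "p_M k > 0")
  case True
  then show ?thesis using that[of "p_M k"] p_M_attains[OF pos] e by simp
next
  case False
  then have "p_M k = 0" using p_M_attains[OF pos] by simp
  then obtain D where D: "(mean_lcs k has_real_derivative D) (at 0)"
    using diff by (auto simp: real_differentiable_def)
  have "((\<lambda>x. mean_lcs k (- x)) has_real_derivative - D) (at 0)"
    using D DERIV_mirror[of "mean_lcs k" D 0] by simp
  moreover have "eventually (\<lambda>x::real. \<bar>x\<bar> < 1) (nhds 0)"
    by (rule eventually_nhds_in_open[of "{-1<..<1}", THEN eventually_mono]) auto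
  then have "eventually (\<lambda>x. mean_lcs k (- x) = mean_lcs k x) (nhds 0)"
    by eventually_elim (rule mean_lcs_minus)
  ultimately have "(mean_lcs k has_real_derivative - D) (at 0)"
    using DERIV_cong_ev[of 0 0 "\<lambda>x. mean_lcs k (- x)" "mean_lcs k" "- D" "- D"] by simp
  then have "- D = D" using D by (rule DERIV_unique)
  then have "((\<lambda>y. (mean_lcs k y - mean_lcs k 0) / (y - 0)) \<longlongrightarrow> 0) (at 0)"
    using D by (simp add: has_field_derivative_iff)
  then have "eventually (\<lambda>y. dist ((mean_lcs k y - mean_lcs k 0) / (y - 0)) 0 < e) (at 0)"
    using e by (rule tendstoD)
  then obtain d where d: "d > 0"
    "\<And>y. y \<noteq> 0 \<Longrightarrow> dist y 0 < d \<Longrightarrow> dist ((mean_lcs k y - mean_lcs k 0) / (y - 0)) 0 < e"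
    unfolding eventually_at by auto
  define p where "p = min (d / 2) (1 / 2)"
  have p: "0 < p" "p < 1" using d by (auto simp: p_def)
  have "\<bar>(mean_lcs k p - mean_lcs k 0) / p\<bar> < e"
    using d(2)[of p] p d(1) by (simp add: dist_real_def p_def min_def split: if_splits)
  then have "mean_lcs k p > mean_lcs k 0 - p * e"
    using p by (simp add: abs_less_iff field_simps)
  then show ?thesis using that[OF p] by (simp add: mean_lcs_eq)
qed

lemma F_slope:
  assumes diff: "mean_lcs k differentiable (at (p_M k))" and gap: "k * F 1 1 > 2"
  obtains s where "0 < s" "F 1 1 + s / k < F 1 (1 + s)"
proof -
  have "0 < k * F 1 1" using gap by simp
  then have pos: "F 1 1 > 0" by (simp add: zero_less_mult_iff)
  have e: "F 1 1 - 2 / k > 0" using gap k_pos by (simp add: field_simps)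
  obtain p where p: "0 < p" "p < 1" "mean_lcs k p > F 1 1 - p * (F 1 1 - 2 / k)"
    by (rule mean_lcs_above_line[OF diff pos e])
  \<comment> \<open>With this value \<open>(1 - p, 1 + p)\<close> is \<open>1 - p\<close> times
    \<open>(1, 1 + s)\<close>, and \<open>(1 - p) * (s / k)\<close> is \<open>p * (2 / k)\<close>,
    matching the tolerance \<open>F 1 1 - 2 / k\<close> chosen above.\<close>
  define s where "s = 2 * p / (1 - p)"
  have s: "0 < s" "1 + s = (1 + p) / (1 - p)" using p by (auto simp: s_def field_simps)
  have "(1 - p) * F 1 (1 + s) = F ((1 - p) * 1) ((1 - p) * (1 + s))"
    using p s by (intro F_homogeneous[symmetric]) auto
  also have "\<dots> = mean_lcs k p" using p s by (simp add: mean_lcs_eq)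
  finally have "(1 - p) * F 1 (1 + s) > F 1 1 - p * (F 1 1 - 2 / k)" using p(3) by simp
  moreover have "F 1 1 - p * (F 1 1 - 2 / k) = (1 - p) * (F 1 1 + s / k)"
  proof -
    have "(1 - p) * (s / k) = p * (2 / k)" using p by (simp add: s_def)
    then have "(1 - p) * (F 1 1 + s / k) = (1 - p) * F 1 1 + p * (2 / k)"
      by (simp only: distrib_left)
    then show ?thesis by (auto simp: algebra_simps)
  qed
  ultimately have "F 1 1 + s / k < F 1 (1 + s)" using p by simp
  then show ?thesis using that s by blast
qed

text \<open>By concavity the slope of \<open>F a\<close> on \<open>[b - h, b]\<close> is at least
  its slope on \<open>[b, c]\<close> with \<open>c = a * (1 + s)\<close>. The latter is at least
  \<open>1 / k\<close>, since the surplus \<open>d * a\<close> covers the rise of at most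
  \<open>b - a\<close> from the diagonal to \<open>b\<close>.\<close>

lemma F_increment:
  assumes s: "0 < s" and d: "0 \<le> d" "F 1 1 + s / k + d \<le> F 1 (1 + s)"
    and ab: "0 < a" "a \<le> b" "b - a \<le> d * a" "b < a * (1 + s)" and h: "0 \<le> h" "h \<le> b"
  shows "F a (b - h) + h / k \<le> F a b"
proof -
  define c where "c = a * (1 + s)"
  \<comment> \<open>The weight for which \<open>b\<close> is the convex combination of
    \<open>b - h\<close> and \<open>c\<close>.\<close>
  define w where "w = (c - b) / (c - b + h)"
  have cb: "0 < c - b" using ab by (simp add: c_def)
  have w: "0 \<le> w" "w \<le> 1" "w * (c - b + h) = c - b" using cb h by (auto simp: w_def)
  have Fc: "F a c = a * F 1 (1 + s)"
    using F_homogeneous[of a 1 "1 + s"] ab s by (simp add: c_def)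
  have "F a b \<le> F a a + (b - a)" using F_add_right_le[of a a "b - a"] ab by simp
  also have "F a a = a * F 1 1" using F_homogeneous[of a 1 1] ab by simp
  finally have Fb: "F a b \<le> a * F 1 1 + (b - a)" .
  have "a * (F 1 1 + s / k + d) \<le> F a c" unfolding Fc using ab d by (intro mult_left_mono) auto
  then have "a * s / k \<le> F a c - F a b" using Fb ab by (simp add: algebra_simps)
  moreover have "(c - b) / k \<le> a * s / k" using ab by (intro divide_right_mono) (auto simp: c_def algebra_simps)
  ultimately have incr: "(c - b) / k \<le> F a c - F a b" by simp
  have "w * F a (b - h) + (1 - w) * F a c \<le> F a (w * (b - h) + (1 - w) * c)"
    using ab h w s by (intro F_concave_right) (auto simp: c_def)
  also have "w * (b - h) + (1 - w) * c = b" using w(3) by (simp add: algebra_simps)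
  finally have "(1 - w) * (F a c - F a b) \<le> w * (F a b - F a (b - h))" by (simp add: algebra_simps)
  moreover have "(1 - w) * ((c - b) / k) \<le> (1 - w) * (F a c - F a b)"
    using incr w by (intro mult_left_mono) auto
  ultimately have "(1 - w) * ((c - b) / k) \<le> w * (F a b - F a (b - h))" by simp
  then have "(1 - w) * ((c - b) / k) * (c - b + h) \<le> w * (F a b - F a (b - h)) * (c - b + h)"
    using cb h by (intro mult_right_mono) auto
  moreover have "(1 - w) * ((c - b) / k) * (c - b + h) = (c - b) * (h / k)"
  proof -
    have "(1 - w) * (c - b + h) = h" using w(3) by (simp add: left_diff_distrib)
    moreover have "(1 - w) * ((c - b) / k) * (c - b + h) = ((1 - w) * (c - b + h)) * ((c - b) / k)"
      by (simp only: mult_ac)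
    ultimately show ?thesis by simp
  qed
  moreover have "w * (F a b - F a (b - h)) * (c - b + h) = (c - b) * (F a b - F a (b - h))"
  proof -
    have "w * (F a b - F a (b - h)) * (c - b + h) = (w * (c - b + h)) * (F a b - F a (b - h))"
      by (simp only: mult_ac)
    then show ?thesis by (simp only: w(3))
  qed
  ultimately have "(c - b) * (h / k) \<le> (c - b) * (F a b - F a (b - h))" by linarith
  then have "h / k \<le> F a b - F a (b - h)" using cb by (simp only: mult_le_cancel_left_pos)
  then show ?thesis by simp
qed

text \<open>The point \<open>(b - l, b)\<close> and its mirror image add up to a diagonal point,
  where homogeneity gives the value.\<close>

lemma F_diag_gap:
  assumes "0 \<le> l" "l \<le> b"
  shows "F (b - l) b + l / 2 * F 1 1 \<le> F b b"
proof (cases "b = 0")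
  case True
  then show ?thesis using assms by simp
next
  case False
  then have b: "0 < b" using assms by simp
  have "2 * F (b - l) b = F (b - l) b + F b (b - l)" by (simp add: F_commute)
  also have "\<dots> \<le> F (b - l + b) (b + (b - l))" using assms b by (intro F_superadd) auto
  also have "\<dots> = (2 * b - l) * F 1 1"
    using F_homogeneous[of "2 * b - l" 1 1] assms b by (simp add: algebra_simps)
  finally have "2 * F (b - l) b \<le> (2 * b - l) * F 1 1" .
  moreover have "F b b = b * F 1 1" using F_homogeneous[of b 1 1] b by simp
  ultimately show ?thesis by (simp add: algebra_simps)
qed

end

section \<open>Tails of the block scores\<close>

text \<open>Here \<open>w = x @ x' @ y\<close> with \<open>x\<close> and \<open>x'\<close> of length \<open>m\<close> and \<open>y\<close> of length \<open>b\<close>.\<close>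

definition block_tail :: "nat \<Rightarrow> nat \<Rightarrow> nat \<Rightarrow> nat \<Rightarrow> real \<Rightarrow> real" where
  "block_tail k m b l U = freq k (2 * m + b) (\<lambda>w. \<exists>c<k. U \<le> real (lcs_length
     (take m w @ replicate l c @ drop m (take (2 * m) w)) (drop (2 * m) w)))"

definition lcs_tail :: "nat \<Rightarrow> nat \<Rightarrow> nat \<Rightarrow> real \<Rightarrow> real" where
  "lcs_tail k a b B = freq k (a + b) (\<lambda>w. real (lcs_length (take a w) (drop a w)) \<le> B)"

context alphabet begin

lemma avg_count_list: "c < k \<Longrightarrow> avg k n (\<lambda>w. real (count_list w c)) = n / k"
proof (induction n)
  case (Suc n)
  have "avg k (Suc n) (\<lambda>w. real (count_list w c)) = (\<Sum>c'<k. of_bool (c' = c) + n / k) / k"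
    using Suc k_pos by (auto simp: avg_Suc avg_add intro!: sum.cong arg_cong2[where f = "(/)"])
  also have "\<dots> = Suc n / k"
    using Suc.prems k_pos by (simp add: sum.distrib add_divide_distrib)
  finally show ?case .
qed simp

lemma avg_block_score:
  assumes m: "m \<le> a" and ij: "i \<le> j" "j \<le> b" and c: "c < k"
  shows "avg k (a + b) (\<lambda>w. real (block_score i j c (take m w) (drop m (take a w)) (drop a w)))
    = elcs m i + (real j - real i) / k + elcs (a - m) (b - j)"
proof -
  have take: "avg k b (\<lambda>v. f (take n v)) = avg k n f" if "n \<le> b" for n f
    using avg_take[OF k_pos, of n "b - n" f] that by simp
  have count: "avg k b (\<lambda>v. real (count_list (drop i (take j v)) c)) = (real j - real i) / k"
    using take[OF ij(2), of "\<lambda>v. real (count_list (drop i v) c)"]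
      avg_drop[OF k_pos, of i "j - i" "\<lambda>v. real (count_list v c)"] avg_count_list[OF c, of "j - i"] ij
    by (simp add: of_nat_diff)
  have drop: "avg k b (\<lambda>v. f (drop j v)) = avg k (b - j) f" for f
    using avg_drop[OF k_pos, of j "b - j" f] ij by simp
  have "avg k (a + b) (\<lambda>w. real (block_score i j c (take m w) (drop m (take a w)) (drop a w)))
      = avg k a (\<lambda>u. avg k b (\<lambda>v. real (block_score i j c (take m u) (drop m u) v)))"
    unfolding avg_append using m by (intro avg_cong) (simp add: length_words)
  also have "\<dots> = avg k a (\<lambda>u. avg k i (\<lambda>v. real (lcs_length (take m u) v)) + (real j - real i) / k
      + avg k (b - j) (\<lambda>v. real (lcs_length (drop m u) v)))"
  proof (rule avg_cong)
    fix u
    have "avg k b (\<lambda>v. real (block_score i j c (take m u) (drop m u) v))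
        = avg k b (\<lambda>v. real (lcs_length (take m u) (take i v)))
          + avg k b (\<lambda>v. real (count_list (drop i (take j v)) c))
          + avg k b (\<lambda>v. real (lcs_length (drop m u) (drop j v)))"
      by (simp add: block_score_def avg_add)
    then show "avg k b (\<lambda>v. real (block_score i j c (take m u) (drop m u) v))
        = avg k i (\<lambda>v. real (lcs_length (take m u) v)) + (real j - real i) / k
          + avg k (b - j) (\<lambda>v. real (lcs_length (drop m u) v))"
      using take[of i "\<lambda>v. real (lcs_length (take m u) v)"]
        drop[of "\<lambda>v. real (lcs_length (drop m u) v)"] ij by (simp add: count)
  qed
  also have "\<dots> = avg k a (\<lambda>u. avg k i (\<lambda>v. real (lcs_length (take m u) v))) + (real j - real i) / k
      + avg k a (\<lambda>u. avg k (b - j) (\<lambda>v. real (lcs_length (drop m u) v)))"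
    using k_pos by (simp add: avg_add)
  also have "\<dots> = elcs m i + (real j - real i) / k + elcs (a - m) (b - j)"
    using avg_take[OF k_pos, of m "a - m" "\<lambda>u. avg k i (\<lambda>v. real (lcs_length u v))"]
      avg_drop[OF k_pos, of m "a - m" "\<lambda>u. avg k (b - j) (\<lambda>v. real (lcs_length u v))"] m
    by (simp add: elcs_def)
  finally show ?thesis .
qed

text \<open>A union bound over the block letter and the two cuts, at most
  \<open>k * (b + 1)^2\<close> triples. The letter belongs to the union because it may depend on the
  outer parts of \<open>X\<close>. By \<open>incr\<close> every score has mean at most
  \<open>F (2 * m) b\<close>.\<close>

lemma block_tail_le:
  assumes incr: "\<And>h. 0 \<le> h \<Longrightarrow> h \<le> b \<Longrightarrow> F (real (2 * m)) (real b - h) + h / k \<le> F (real (2 * m)) b"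
    and t: "0 \<le> t" "t \<le> 2 * real (2 * m + b)" and mb: "2 * m + b > 0"
  shows "block_tail k m b l (F (real (2 * m)) b + t)
    \<le> real (k * (b + 1)\<^sup>2) * exp (- (t\<^sup>2 / (4 * real (2 * m + b))))"
proof -
  define a where "a = 2 * m"
  have m: "m \<le> a" by (simp add: a_def)
  note incr = incr[folded a_def] and t = t[folded a_def] and ab = mb[folded a_def]
  define sc where "sc p w = (case p of (c :: nat, i, j) \<Rightarrow>
    real (block_score i j c (take m w) (drop m (take a w)) (drop a w)))" for p w
  define I where "I = {(c, i, j). c < k \<and> i \<le> j \<and> j \<le> b}"
  have sub: "I \<subseteq> {..<k} \<times> {..b} \<times> {..b}" by (auto simp: I_def)
  then have fin: "finite I" by (rule finite_subset) auto
  have "card I \<le> card ({..<k} \<times> {..b} \<times> {..b})" using sub by (intro card_mono) auto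
  then have card: "card I \<le> k * (b + 1)\<^sup>2" by (simp add: power2_eq_square)
  have "freq k (a + b) (\<lambda>w. \<exists>c<k. F a b + t
        \<le> real (lcs_length (take m w @ replicate l c @ drop m (take a w)) (drop a w)))
      \<le> freq k (a + b) (\<lambda>w. \<exists>p\<in>I. F a b + t \<le> sc p w)"
  proof (rule freq_mono)
    fix w assume w: "w \<in> words k (a + b)"
      and "\<exists>c<k. F a b + t
        \<le> real (lcs_length (take m w @ replicate l c @ drop m (take a w)) (drop a w))"
    then obtain c where c: "c < k"
      "F a b + t \<le> real (lcs_length (take m w @ replicate l c @ drop m (take a w)) (drop a w))"
      by blast
    obtain i j where ij: "i \<le> j" "j \<le> length (drop a w)"
      "lcs_length (take m w @ replicate l c @ drop m (take a w)) (drop a w)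
        \<le> block_score i j c (take m w) (drop m (take a w)) (drop a w)"
      by (rule lcs_length_block_split)
    have "(c, i, j) \<in> I" using c ij w by (simp add: I_def length_words)
    moreover have "F a b + t \<le> sc (c, i, j) w" using c(2) ij(3) by (simp add: sc_def)
    ultimately show "\<exists>p\<in>I. F a b + t \<le> sc p w" by blast
  qed
  also have "\<dots> \<le> (\<Sum>p\<in>I. freq k (a + b) (\<lambda>w. F a b + t \<le> sc p w))"
    by (rule freq_Bex_le[OF fin])
  also have "\<dots> \<le> (\<Sum>p\<in>I. exp (- (t\<^sup>2 / (4 * real (a + b)))))"
  proof (rule sum_mono)
    fix p assume "p \<in> I"
    then obtain c i j where p: "p = (c, i, j)" "c < k" "i \<le> j" "j \<le> b" by (auto simp: I_def)
    have "avg k (a + b) (sc p) = elcs m i + (real j - real i) / k + elcs (a - m) (b - j)"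
      using avg_block_score[OF m p(3,4,2)] by (simp add: sc_def[abs_def] p(1))
    \<comment> \<open>Superadditivity merges the two outer alignments, leaving a bound that depends
      on the cuts only through \<open>j - i\<close>.\<close>
    also have "\<dots> \<le> elcs a (b - (j - i)) + (real j - real i) / k"
      using elcs_superadd[of m i "a - m" "b - j"] m p by (simp add: add.commute)
    also have "elcs a (b - (j - i)) \<le> F a (real (b - (j - i)))" by (rule elcs_le_F)
    also have "real (b - (j - i)) = real b - (real j - real i)" using p by (simp add: of_nat_diff)
    also have "F a (real b - (real j - real i)) + (real j - real i) / k \<le> F a b"
      using p by (intro incr) auto
    finally have mean: "avg k (a + b) (sc p) \<le> F a b" by simp
    have "freq k (a + b) (\<lambda>w. F a b + t \<le> sc p w) \<le> freq k (a + b) (\<lambda>w. avg k (a + b) (sc p) + t \<le> sc p w)"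
      using mean by (intro freq_mono) linarith
    also have "\<dots> \<le> exp (- (t\<^sup>2 / (4 * real (a + b))))"
      using hamming_lipschitz_block_score[OF p(3) m, of c] t ab
      by (intro freq_upper_tail k_pos) (auto simp: sc_def[abs_def] p(1))
    finally show "freq k (a + b) (\<lambda>w. F a b + t \<le> sc p w) \<le> exp (- (t\<^sup>2 / (4 * real (a + b))))" .
  qed
  also have "\<dots> \<le> real (k * (b + 1)\<^sup>2) * exp (- (t\<^sup>2 / (4 * real (a + b))))"
    unfolding sum_constant using card by (intro mult_right_mono of_nat_mono) auto
  finally show ?thesis unfolding block_tail_def a_def .
qed

lemma lcs_tail_le:
  assumes "0 \<le> t" "t \<le> 2 * real (a + b)" "a + b > 0"
  shows "lcs_tail k a b (elcs a b - t)
    \<le> exp (- (t\<^sup>2 / (4 * real (a + b))))"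
  using freq_lower_tail[OF k_pos hamming_lipschitz_lcs assms] by (simp add: elcs_eq_avg lcs_tail_def)

end

text \<open>The first term is the convergence error of \<open>F_le_elcs\<close> at length
  \<open>2 * d\<close>; the extra \<open>1 / 2\<close> pays for the rounding of the block
  length.\<close>

lemma rate_eventually_le:
  fixes C \<alpha> :: real assumes "1 / 2 < \<alpha>"
  shows "eventually (\<lambda>d::nat. C * (sqrt (2 * d) * (1 + ln (1 + 2 * d))) + 1 / 2 \<le> d powr \<alpha> / 2) sequentially"
  using assms by real_asymp

text \<open>Halving the constant in the exponent absorbs the polynomial number of terms in the union
  bound.\<close>

lemma tails_eventually_le:
  fixes K \<alpha> :: real assumes "1 / 2 < \<alpha>"
  shows "eventually (\<lambda>d::nat. (K * (2 * d + 1)\<^sup>2 + 1) * exp (- (d powr (2 * \<alpha> - 1) / 256))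
    \<le> exp (- (d powr (2 * \<alpha> - 1) / 512))) sequentially"
  using assms by real_asymp

text \<open>As the block has length at most \<open>d^\<beta> + 1\<close>, this gives
  \<open>l < \<epsilon> * (2 * d - l)\<close>, the shortness required by
  \<open>F_increment\<close>.\<close>

lemma block_eventually_short:
  fixes \<epsilon> \<beta> :: real assumes "\<beta> < 1" "\<epsilon> > 0"
  shows "eventually (\<lambda>d::nat. (d powr \<beta> + 1) * (1 + \<epsilon>) < \<epsilon> * (2 * d)) sequentially"
proof -
  have "(\<lambda>d::nat. real d powr (\<beta> - 1)) \<longlonglongrightarrow> 0"
    using assms by (intro tendsto_neg_powr filterlim_real_sequentially) auto
  then have "eventually (\<lambda>d::nat. d powr (\<beta> - 1) < \<epsilon> / (1 + \<epsilon>)) sequentially"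
    using assms by (intro order_tendstoD(2)) auto
  moreover have "eventually (\<lambda>d::nat. (1 + \<epsilon>) / \<epsilon> < real d) sequentially"
    by real_asymp
  ultimately show ?thesis
    using eventually_gt_at_top[of 0]
  proof eventually_elim
    case (elim d)
    have "d powr \<beta> = d * d powr (\<beta> - 1)" using elim by (simp add: powr_mult_base)
    moreover have "d * (d powr (\<beta> - 1) * (1 + \<epsilon>)) < d * \<epsilon>"
      using elim assms by (intro mult_strict_left_mono) (auto simp: pos_less_divide_eq)
    moreover have "1 + \<epsilon> < real d * \<epsilon>" using elim assms by (simp add: pos_divide_less_eq)
    ultimately show ?case by (simp add: algebra_simps)
  qed
qed

section \<open>The long-block model\<close>

lemma length_word [simp]: "length (word Z i j \<omega>) = Suc j - i"
  by (simp add: word_def del: upt_Suc)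

lemma word_split:
  assumes "i \<le> Suc j" "j \<le> n"
  shows "word Z i n \<omega> = word Z i j \<omega> @ word Z (Suc j) n \<omega>"
proof -
  have "[i..<Suc n] = [i..<Suc j] @ [Suc j..<Suc n]"
    using upt_add_eq_append[of i "Suc j" "n - j"] assms by simp
  then show ?thesis by (simp only: word_def map_append)
qed

lemma (in prob_space) prob_ge_1_minus:
  assumes "E \<in> events" "B \<in> events" "AE \<omega> in M. \<omega> \<in> E \<or> \<omega> \<in> B"
  shows "1 - prob B \<le> prob E"
proof -
  have "prob (E \<union> B) = 1" using assms by (intro prob_eq_1[THEN iffD2]) auto
  then show ?thesis using measure_Un_le[OF assms(1,2)] by simp
qed

lemma sets_Collect_count_space:
  assumes "A \<in> measurable M (count_space UNIV)"
  shows "{\<omega> \<in> space M. P (A \<omega>)} \<in> sets M"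
  using measurable_sets[OF assms, of "Collect P"] by (simp add: vimage_def Int_def conj_commute)

lemma measurable_Pair_count_space:
  fixes A :: "'a \<Rightarrow> 'b::countable"
  assumes A: "A \<in> measurable M (count_space UNIV)" and B: "B \<in> measurable M (count_space UNIV)"
  shows "(\<lambda>\<omega>. (A \<omega>, B \<omega>)) \<in> measurable M (count_space UNIV)"
  by (rule measurable_compose_countable[OF _ A]) (rule measurable_compose[OF B], simp)

section \<open>Deterministic estimates for the finitely many small \<open>d\<close>\<close>

lemma count_list_mono_subseq:
  assumes "subseq z x" shows "count_list z c \<le> count_list x c"
  using list_emb_length[OF subseq_filter[OF assms, of "(=) c"]]
  by (simp add: count_list_eq_length_filter)

text \<open>A common subsequence with a constant word in \<open>c'\<close> uses no letter of a block
  of \<open>c\<close>.\<close>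

lemma lcs_block_absent_letter:
  assumes "c \<noteq> c'"
  shows "lcs_length (x @ replicate l c @ x') (replicate n c') \<le> lcs_length (x @ x') (replicate n c')"
proof -
  obtain z where z: "subseq z (x @ replicate l c @ x')" "subseq z (replicate n c')"
    "length z = lcs_length (x @ replicate l c @ x') (replicate n c')"
    by (rule lcs_length_attained)
  have "set z \<subseteq> {c'}"
    using z(2) by (auto elim!: list_emb_set)
  then have "filter ((=) c') z = z" by (intro filter_True) auto
  then have "subseq z (filter ((=) c') (x @ replicate l c @ x'))"
    using subseq_filter[OF z(1), of "(=) c'"] by simp
  also have "filter ((=) c') (x @ replicate l c @ x') = filter ((=) c') (x @ x')"
    using assms by simp
  finally have "subseq z (x @ x')"
    by (rule subseq_order.trans) (rule subseq_filter_left)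
  then have "length z \<le> lcs_length (x @ x') (replicate n c')" using z by (intro lcs_length_ge)
  then show ?thesis using z by simp
qed

lemma count_list_replicate: "count_list (replicate n c) c' = (if c = c' then n else 0)"
  by (induction n) auto

text \<open>Whatever the block letter \<open>c\<close>, one of the letters 0 and 1 differs from it
  and occurs only \<open>d - h\<close> times in the first word; the other occurs \<open>d\<close>
  times in the second.\<close>

lemma lcs_two_letter_block:
  fixes c :: nat
  assumes "h \<le> d"
  shows "lcs_length (replicate (d - h) 0 @ replicate (2 * h) c @ replicate (d - h) 1)
    (replicate d 0 @ replicate d 1) \<le> 2 * d - h" (is "lcs_length ?x ?y \<le> _")
proof -
  obtain z where z: "subseq z ?x" "subseq z ?y" "length z = lcs_length ?x ?y"
    by (rule lcs_length_attained)
  have "set z \<subseteq> {0, 1}"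
    using z(2) by (auto elim!: list_emb_set)
  then have "length z = count_list z 0 + count_list z 1" by (induction z) auto
  moreover have "count_list z 0 \<le> d" "count_list z 1 \<le> d"
    using count_list_mono_subseq[OF z(2), of 0] count_list_mono_subseq[OF z(2), of 1]
    by (auto simp: count_list_append count_list_replicate)
  moreover have "c \<noteq> 0 \<Longrightarrow> count_list z 0 \<le> d - h" "c \<noteq> 1 \<Longrightarrow> count_list z 1 \<le> d - h"
    using count_list_mono_subseq[OF z(1), of 0] count_list_mono_subseq[OF z(1), of 1]
    by (auto simp: count_list_append count_list_replicate)
  ultimately have "length z \<le> 2 * d - h" using assms by (cases "c = 0") auto
  then show ?thesis using z by simp
qed

lemma (in prob_space) indep_vars_three:
  fixes A B C :: "'a \<Rightarrow> 'b"
  assumes indep: "indep_vars (\<lambda>_. count_space UNIV) (\<lambda>j \<omega>. [A \<omega>, B \<omega>, C \<omega>] ! j) {..<3}"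
  shows "prob {\<omega> \<in> space M. A \<omega> = a \<and> B \<omega> = b \<and> C \<omega> = c}
      = prob {\<omega> \<in> space M. A \<omega> = a} * prob {\<omega> \<in> space M. B \<omega> = b} * prob {\<omega> \<in> space M. C \<omega> = c}"
    and "prob {\<omega> \<in> space M. B \<omega> = b \<and> C \<omega> = c}
      = prob {\<omega> \<in> space M. B \<omega> = b} * prob {\<omega> \<in> space M. C \<omega> = c}"
proof -
  define f where "f j \<omega> = [A \<omega>, B \<omega>, C \<omega>] ! j" for j \<omega>
  define S where "S j = [{a}, {b}, {c}] ! j" for j
  have ind: "indep_vars (\<lambda>_. count_space UNIV) f {..<3}"
    using indep by (simp add: f_def[abs_def])
  have f: "f 0 -` S 0 \<inter> space M = {\<omega> \<in> space M. A \<omega> = a}"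
    "f 1 -` S 1 \<inter> space M = {\<omega> \<in> space M. B \<omega> = b}"
    "f 2 -` S 2 \<inter> space M = {\<omega> \<in> space M. C \<omega> = c}"
    by (auto simp: f_def S_def)
  have *: "prob (\<Inter>j\<in>J. f j -` S j \<inter> space M) = (\<Prod>j\<in>J. prob (f j -` S j \<inter> space M))"
    if "J \<noteq> {}" "J \<subseteq> {..<3}" for J
    using that by (intro indep_varsD[OF ind]) (auto intro: finite_subset)
  have "{\<omega> \<in> space M. A \<omega> = a \<and> B \<omega> = b \<and> C \<omega> = c}
      = (\<Inter>j\<in>{0, 1, 2}. f j -` S j \<inter> space M)"
    unfolding INT_insert f by auto
  then show "prob {\<omega> \<in> space M. A \<omega> = a \<and> B \<omega> = b \<and> C \<omega> = c}
      = prob {\<omega> \<in> space M. A \<omega> = a} * prob {\<omega> \<in> space M. B \<omega> = b} * prob {\<omega> \<in> space M. C \<omega> = c}"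
    using *[of "{0, 1, 2}"] f by simp
  have "{\<omega> \<in> space M. B \<omega> = b \<and> C \<omega> = c} = (\<Inter>j\<in>{1, 2}. f j -` S j \<inter> space M)"
    unfolding INT_insert f by auto
  then show "prob {\<omega> \<in> space M. B \<omega> = b \<and> C \<omega> = c}
      = prob {\<omega> \<in> space M. B \<omega> = b} * prob {\<omega> \<in> space M. C \<omega> = c}"
    using *[of "{1, 2}"] f by simp
qed

context long_block_model
begin

lemma measurable_words:
  shows "word X 1 (2 * d) \<in> measurable M (count_space UNIV)"
    and "word Y 1 (2 * d) \<in> measurable M (count_space UNIV)"
    and "word Xs 1 (2 * d) \<in> measurable M (count_space UNIV)"
  using indep_var_rv1[OF X_Y_indep] indep_var_rv2[OF X_Y_indep] indep_var_rv1[OF Xs_Y_indep]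
  by auto

text \<open>Exhibits the outer parts as functions of the whole word, whose measurability then yields
  that of \<open>event_E\<close>.\<close>

lemma outer_words:
  assumes "l \<le> 2 * d"
  shows "word X 1 (d - l div 2) \<omega> = take (d - l div 2) (word X 1 (2 * d) \<omega>)"
    and "word X (d + l div 2 + 1) (2 * d) \<omega> = drop (d + l div 2) (word X 1 (2 * d) \<omega>)"
proof -
  have "word X 1 (2 * d) \<omega> = word X 1 (d - l div 2) \<omega> @ word X (Suc (d - l div 2)) (2 * d) \<omega>"
    by (rule word_split) auto
  then show "word X 1 (d - l div 2) \<omega> = take (d - l div 2) (word X 1 (2 * d) \<omega>)"
    by simp
  have "word X 1 (2 * d) \<omega> = word X 1 (d + l div 2) \<omega> @ word X (Suc (d + l div 2)) (2 * d) \<omega>"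
    using assms by (intro word_split) auto
  then show "word X (d + l div 2 + 1) (2 * d) \<omega> = drop (d + l div 2) (word X 1 (2 * d) \<omega>)"
    by simp
qed

lemma event_E_sets:
  assumes "l \<le> 2 * d" shows "event_E \<alpha> d l M X Y \<in> events"
  unfolding event_E_def outer_words[OF assms]
  by (rule sets_Collect_count_space[OF measurable_Pair_count_space[OF measurable_words(1,2)],
    where P = "\<lambda>(x, y). real (lcs_length (take (d - l div 2) x @ drop (d + l div 2) x) y)
      + real d powr \<alpha> > real (lcs_length x y)", unfolded case_prod_conv])

lemma event_K_sets: "event_K \<alpha> \<beta> \<gamma>a d M X Xs Y \<in> events"
  unfolding event_K_def
  by (rule sets_Collect_count_space[OF measurable_Pair_count_space[OF measurable_words(1)
    measurable_Pair_count_space[OF measurable_words(2,3)]],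
    where P = "\<lambda>(x, y, x'). \<gamma>a / 2 * real d powr \<beta> - real d powr \<alpha>
      \<le> real (lcs_length x' y) - real (lcs_length x y)", unfolded case_prod_conv])

lemma X_block_word:
  assumes "even l" "0 < l" "l \<le> 2 * d"
  shows "AE \<omega> in M. word X 1 (2 * d) \<omega> = word X 1 (d - l div 2) \<omega>
    @ replicate l (X (d - l div 2 + 1) \<omega>) @ word X (d + l div 2 + 1) (2 * d) \<omega>"
  using X_block
proof eventually_elim
  case (elim \<omega>)
  let ?h = "l div 2"
  have "word X 1 (2 * d) \<omega> = word X 1 (d - ?h) \<omega> @ word X (Suc (d - ?h)) (2 * d) \<omega>"
    by (rule word_split) auto
  also have "word X (Suc (d - ?h)) (2 * d) \<omega>
      = word X (Suc (d - ?h)) (d + ?h) \<omega> @ word X (Suc (d + ?h)) (2 * d) \<omega>"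
    using assms by (intro word_split) auto
  also have "word X (Suc (d - ?h)) (d + ?h) \<omega> = map (\<lambda>_. X (d - ?h + 1) \<omega>) [Suc (d - ?h)..<Suc (d + ?h)]"
    unfolding word_def
  proof (rule map_cong[OF refl])
    fix m assume "m \<in> set [Suc (d - ?h)..<Suc (d + ?h)]"
    then have "m \<in> {d - ?h + 1..d + ?h}" by auto
    then show "X m \<omega> = X (d - ?h + 1) \<omega>" by (rule bspec[OF elim])
  qed
  also have "\<dots> = replicate l (X (d - ?h + 1) \<omega>)"
  proof -
    have "Suc (d + ?h) - Suc (d - ?h) = l" using assms by auto
    then show ?thesis by (simp only: map_replicate_const length_upt)
  qed
  finally show ?case by (simp only: Suc_eq_plus1)
qed

lemma block_letter:
  assumes "0 < l" "l \<le> 2 * d" "\<omega> \<in> space M" "even l"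
  shows "X (d - l div 2 + 1) \<omega> < k"
  using measurable_space[OF X_letters, of "d - l div 2 + 1" \<omega>] assms by auto

lemma uniform_XsY:
  assumes "k > 0"
  shows "uniform_word M k (2 * d + 2 * d) (\<lambda>\<omega>. word Xs 1 (2 * d) \<omega> @ word Y 1 (2 * d) \<omega>)"
proof (rule uniform_word_append)
  show "uniform_word M k (2 * d) (word Xs 1 (2 * d))" "uniform_word M k (2 * d) (word Y 1 (2 * d))"
    using iid_uniform_word[OF Xs_iid order.refl assms] iid_uniform_word[OF Y_iid order.refl assms]
    by simp_all
  fix u v
  show "prob {\<omega> \<in> space M. word Xs 1 (2 * d) \<omega> = u \<and> word Y 1 (2 * d) \<omega> = v}
    = prob {\<omega> \<in> space M. word Xs 1 (2 * d) \<omega> = u} * prob {\<omega> \<in> space M. word Y 1 (2 * d) \<omega> = v}"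
    using indep_varD[OF Xs_Y_indep, of "{u}" "{v}"]
    by (simp add: vimage_def Int_def conj_commute conj_left_commute)
qed (rule assms)

text \<open>With the block removed, the outer parts of \<open>X\<close> followed by \<open>Y\<close>
  form a uniform word, the one described by \<open>block_tail\<close>.\<close>

lemma uniform_LRY:
  assumes k: "k > 0" and l: "l \<le> 2 * d"
  shows "uniform_word M k ((d - l div 2 + (d - l div 2)) + 2 * d)
    (\<lambda>\<omega>. (word X 1 (d - l div 2) \<omega> @ word X (d + l div 2 + 1) (2 * d) \<omega>) @ word Y 1 (2 * d) \<omega>)"
proof -
  let ?h = "l div 2"
  let ?L = "word X 1 (d - ?h)" and ?R = "word X (d + ?h + 1) (2 * d)" and ?Y = "word Y 1 (2 * d)"
  have L: "uniform_word M k (d - ?h) ?L" and R: "uniform_word M k (d - ?h) ?R"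
    and Y: "uniform_word M k (2 * d) ?Y"
    using iid_uniform_word[OF X_left_iid order.refl k] iid_uniform_word[OF X_right_iid order.refl k]
      iid_uniform_word[OF Y_iid order.refl k] l by (simp_all add: mult_2)
  note three = indep_vars_three(1)[OF three_indep] and two = indep_vars_three(2)[OF three_indep]
  show ?thesis
  proof (rule uniform_word_append[OF uniform_word_append[OF L R two k] Y _ k])
    fix u v
    \<comment> \<open>The left part has the fixed length \<open>d - ?h\<close>, so the place where
      \<open>u\<close> is cut is forced.\<close>
    have LR: "?L \<omega> @ ?R \<omega> = u \<longleftrightarrow> ?L \<omega> = take (d - ?h) u \<and> ?R \<omega> = drop (d - ?h) u" for \<omega>
      unfolding append_eq_conv_conj by simp
    have "prob {\<omega> \<in> space M. ?L \<omega> @ ?R \<omega> = u \<and> ?Y \<omega> = v}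
      = prob {\<omega> \<in> space M. ?Y \<omega> = v \<and> ?L \<omega> = take (d - ?h) u \<and> ?R \<omega> = drop (d - ?h) u}"
      unfolding LR by (intro arg_cong[where f = prob]) blast
    then show "prob {\<omega> \<in> space M. ?L \<omega> @ ?R \<omega> = u \<and> ?Y \<omega> = v}
      = prob {\<omega> \<in> space M. ?L \<omega> @ ?R \<omega> = u} * prob {\<omega> \<in> space M. ?Y \<omega> = v}"
      unfolding LR three two by (simp only: mult_ac)
  qed
qed

text \<open>Off the two bad events, \<open>X\<close> scores less than \<open>U\<close> against
  \<open>Y\<close> and its outer parts score more than \<open>B\<close>, so \<open>thr\<close> gives
  \<open>event_E\<close>.\<close>

lemma prob_event_E_ge:
  assumes k: "k > 0" and l: "even l" "0 < l" "l \<le> 2 * d"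
    and thr: "U \<le> B + real d powr \<alpha>"
  shows "prob (event_E \<alpha> d l M X Y) \<ge> 1 -
    (block_tail k (d - l div 2) (2 * d) l U + lcs_tail k (2 * (d - l div 2)) (2 * d) B)"
proof -
  let ?h = "l div 2"
  define a where "a = 2 * (d - ?h)"
  let ?W = "\<lambda>\<omega>. (word X 1 (d - ?h) \<omega> @ word X (d + ?h + 1) (2 * d) \<omega>) @ word Y 1 (2 * d) \<omega>"
  let ?P = "\<lambda>w. \<exists>c<k. U \<le> real (lcs_length
        (take (d - ?h) w @ replicate l c @ drop (d - ?h) (take a w)) (drop a w))"
  let ?Q = "\<lambda>w. real (lcs_length (take a w) (drop a w)) \<le> B"
  have W: "uniform_word M k (a + 2 * d) ?W" using uniform_LRY[OF k l(3)] by (simp add: a_def mult_2)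
  have len: "length (word X (d + ?h + 1) (2 * d) \<omega>) = d - ?h" for \<omega> using l by simp
  have "1 - prob {\<omega> \<in> space M. ?P (?W \<omega>) \<or> ?Q (?W \<omega>)} \<le> prob (event_E \<alpha> d l M X Y)"
  proof (rule prob_ge_1_minus[OF event_E_sets[OF l(3)]])
    show "{\<omega> \<in> space M. ?P (?W \<omega>) \<or> ?Q (?W \<omega>)} \<in> events"
      using W by (intro sets_Collect_count_space[where A = ?W]) (simp add: uniform_word_def)
    show "AE \<omega> in M. \<omega> \<in> event_E \<alpha> d l M X Y \<or> \<omega> \<in> {\<omega> \<in> space M. ?P (?W \<omega>) \<or> ?Q (?W \<omega>)}"
      using X_block_word[OF l] AE_space
    proof eventually_elim
      case (elim \<omega>)
      have c: "X (d - ?h + 1) \<omega> < k" using block_letter l elim by simp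
      have parts: "take (d - ?h) (?W \<omega>) = word X 1 (d - ?h) \<omega>"
        "take a (?W \<omega>) = word X 1 (d - ?h) \<omega> @ word X (d + ?h + 1) (2 * d) \<omega>"
        "drop a (?W \<omega>) = word Y 1 (2 * d) \<omega>"
        "drop (d - ?h) (take a (?W \<omega>)) = word X (d + ?h + 1) (2 * d) \<omega>"
        using len by (simp_all add: a_def mult_2)
      show ?case
      proof (cases "?P (?W \<omega>) \<or> ?Q (?W \<omega>)")
        case False
        then have "real (lcs_length (word X 1 (2 * d) \<omega>) (word Y 1 (2 * d) \<omega>)) < U"
          using c unfolding elim(1) parts by (auto simp: not_le)
        moreover have "B < real (lcs_length (word X 1 (d - ?h) \<omega> @ word X (d + ?h + 1) (2 * d) \<omega>)
            (word Y 1 (2 * d) \<omega>))"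
          using False unfolding parts by simp
        ultimately have "real (lcs_length (word X 1 (2 * d) \<omega>) (word Y 1 (2 * d) \<omega>))
            < real (lcs_length (word X 1 (d - ?h) \<omega> @ word X (d + ?h + 1) (2 * d) \<omega>)
              (word Y 1 (2 * d) \<omega>)) + real d powr \<alpha>"
          using thr by linarith
        then have "\<omega> \<in> event_E \<alpha> d l M X Y"
          unfolding event_E_def using elim(2) by (intro CollectI conjI)
        then show ?thesis ..
      next
        case True
        then show ?thesis using elim(2) by blast
      qed
    qed
  qed
  moreover have "prob {\<omega> \<in> space M. ?P (?W \<omega>) \<or> ?Q (?W \<omega>)} = freq k (a + 2 * d) (\<lambda>w. ?P w \<or> ?Q w)"
    by (rule uniform_word_prob[OF W k])
  moreover have "freq k (a + 2 * d) (\<lambda>w. ?P w \<or> ?Q w) \<le> freq k (a + 2 * d) ?P + freq k (a + 2 * d) ?Q" by (rule freq_disj_le)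
  ultimately show ?thesis unfolding block_tail_def lcs_tail_def a_def by linarith
qed

text \<open>Two uniform words occur: \<open>?W\<close> bounds the score of \<open>X\<close> from
  above, \<open>?V\<close> that of \<open>Xs\<close> from below. A union bound joins the two tails
  under any coupling.\<close>

lemma prob_event_K_ge:
  assumes k: "k > 0" and l: "even l" "0 < l" "l \<le> 2 * d"
    and thr: "\<gamma>a / 2 * real d powr \<beta> - real d powr \<alpha> \<le> B - U"
  shows "prob (event_K \<alpha> \<beta> \<gamma>a d M X Xs Y) \<ge> 1 -
    (block_tail k (d - l div 2) (2 * d) l U + lcs_tail k (2 * d) (2 * d) B)"
proof -
  let ?h = "l div 2"
  define a where "a = 2 * (d - ?h)"
  let ?W = "\<lambda>\<omega>. (word X 1 (d - ?h) \<omega> @ word X (d + ?h + 1) (2 * d) \<omega>) @ word Y 1 (2 * d) \<omega>"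
  let ?V = "\<lambda>\<omega>. word Xs 1 (2 * d) \<omega> @ word Y 1 (2 * d) \<omega>"
  let ?P = "\<lambda>w. \<exists>c<k. U \<le> real (lcs_length
        (take (d - ?h) w @ replicate l c @ drop (d - ?h) (take a w)) (drop a w))"
  let ?Q = "\<lambda>w. real (lcs_length (take (2 * d) w) (drop (2 * d) w)) \<le> B"
  have W: "uniform_word M k (a + 2 * d) ?W" using uniform_LRY[OF k l(3)] by (simp add: a_def mult_2)
  have V: "uniform_word M k (2 * d + 2 * d) ?V" by (rule uniform_XsY[OF k])
  have len: "length (word X (d + ?h + 1) (2 * d) \<omega>) = d - ?h" for \<omega> using l by simp
  have "{\<omega> \<in> space M. ?P (?W \<omega>)} \<in> events"
    using W by (intro sets_Collect_count_space[where A = ?W]) (simp add: uniform_word_def)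
  moreover have "{\<omega> \<in> space M. ?Q (?V \<omega>)} \<in> events"
    using V by (intro sets_Collect_count_space[where A = ?V]) (simp add: uniform_word_def)
  ultimately have sets: "{\<omega> \<in> space M. ?P (?W \<omega>)} \<in> events" "{\<omega> \<in> space M. ?Q (?V \<omega>)} \<in> events" .
  have "1 - prob ({\<omega> \<in> space M. ?P (?W \<omega>)} \<union> {\<omega> \<in> space M. ?Q (?V \<omega>)})
      \<le> prob (event_K \<alpha> \<beta> \<gamma>a d M X Xs Y)"
  proof (rule prob_ge_1_minus[OF event_K_sets])
    show "{\<omega> \<in> space M. ?P (?W \<omega>)} \<union> {\<omega> \<in> space M. ?Q (?V \<omega>)} \<in> events"
      by (rule sets.Un[OF sets])
    show "AE \<omega> in M. \<omega> \<in> event_K \<alpha> \<beta> \<gamma>a d M X Xs Y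
        \<or> \<omega> \<in> {\<omega> \<in> space M. ?P (?W \<omega>)} \<union> {\<omega> \<in> space M. ?Q (?V \<omega>)}"
      using X_block_word[OF l] AE_space
    proof eventually_elim
      case (elim \<omega>)
      have c: "X (d - ?h + 1) \<omega> < k" using block_letter l elim by simp
      have parts: "take (d - ?h) (?W \<omega>) = word X 1 (d - ?h) \<omega>"
        "drop a (?W \<omega>) = word Y 1 (2 * d) \<omega>"
        "drop (d - ?h) (take a (?W \<omega>)) = word X (d + ?h + 1) (2 * d) \<omega>"
        using len by (simp_all add: a_def mult_2)
      show ?case
      proof (cases "?P (?W \<omega>) \<or> ?Q (?V \<omega>)")
        case False
        then have "real (lcs_length (word X 1 (2 * d) \<omega>) (word Y 1 (2 * d) \<omega>)) < U"
          using c unfolding elim(1) parts by (auto simp: not_le)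
        moreover have "B < real (lcs_length (word Xs 1 (2 * d) \<omega>) (word Y 1 (2 * d) \<omega>))"
          using False by simp
        ultimately have "\<gamma>a / 2 * real d powr \<beta> - real d powr \<alpha>
            \<le> real (lcs_length (word Xs 1 (2 * d) \<omega>) (word Y 1 (2 * d) \<omega>))
              - real (lcs_length (word X 1 (2 * d) \<omega>) (word Y 1 (2 * d) \<omega>))"
          using thr by linarith
        then have "\<omega> \<in> event_K \<alpha> \<beta> \<gamma>a d M X Xs Y"
          unfolding event_K_def using elim(2) by (intro CollectI conjI)
        then show ?thesis ..
      next
        case True
        then show ?thesis using elim(2) by blast
      qed
    qed
  qed
  moreover have "prob ({\<omega> \<in> space M. ?P (?W \<omega>)} \<union> {\<omega> \<in> space M. ?Q (?V \<omega>)})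
      \<le> freq k (a + 2 * d) ?P + freq k (2 * d + 2 * d) ?Q"
    using measure_Un_le[OF sets]
    unfolding uniform_word_prob[OF W k, of ?P] uniform_word_prob[OF V k, of ?Q] .
  ultimately show ?thesis unfolding block_tail_def lcs_tail_def a_def by linarith
qed

section \<open>Positive probability for every \<open>d\<close>\<close>

text \<open>The word \<open>X\<close> takes countably many values, so it has an atom
  \<open>x\<close>. By independence \<open>Y\<close> can at the same time be constant in a letter
  other than the block letter of \<open>x\<close>, and then the block contributes nothing.\<close>

lemma prob_event_E_pos:
  assumes k: "k \<ge> 2" and l: "even l" "0 < l" "l \<le> 2 * d"
  shows "0 < prob (event_E \<alpha> d l M X Y)"
proof -
  let ?h = "l div 2" and ?X = "word X 1 (2 * d)" and ?Y = "word Y 1 (2 * d)"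
  have sX: "{\<omega> \<in> space M. ?X \<omega> = x} \<in> events" for x
    by (rule sets_Collect_count_space[OF measurable_words(1)])
  have sY: "{\<omega> \<in> space M. ?Y \<omega> = y} \<in> events" for y
    by (rule sets_Collect_count_space[OF measurable_words(2)])
  have "\<exists>x. prob {\<omega> \<in> space M. ?X \<omega> = x} \<noteq> 0"
  proof (rule ccontr)
    assume "\<not> ?thesis"
    then have "AE \<omega> in M. \<forall>x. ?X \<omega> \<noteq> x"
      unfolding AE_all_countable
      using sX by (auto intro!: AE_iff_measurable[OF sX, THEN iffD2] simp: emeasure_eq_measure)
    then show False using AE_False by simp
  qed
  then obtain x where "prob {\<omega> \<in> space M. ?X \<omega> = x} \<noteq> 0" by blast
  then have x: "0 < prob {\<omega> \<in> space M. ?X \<omega> = x}" by (simp add: zero_less_measure_iff)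
  \<comment> \<open>Lists count from 0, so index \<open>d - ?h\<close> holds
    \<open>X (d - ?h + 1)\<close>, the first letter of the block.\<close>
  define c where "c = x ! (d - ?h)"
  define c' :: nat where "c' = (if c = 0 then 1 else 0)"
  have c': "c \<noteq> c'" "c' < k" using k by (auto simp: c'_def)
  define y where "y = replicate (2 * d) c'"
  have "uniform_word M k (2 * d) ?Y" using iid_uniform_word[OF Y_iid order.refl] k by simp
  moreover have "y \<in> words k (2 * d)" using c' by (auto simp: words_def y_def)
  ultimately have y: "0 < prob {\<omega> \<in> space M. ?Y \<omega> = y}"
    using k by (simp add: uniform_word_def)
  have "0 < prob {\<omega> \<in> space M. ?X \<omega> = x} * prob {\<omega> \<in> space M. ?Y \<omega> = y}" using x y by simp
  also have "\<dots> = prob {\<omega> \<in> space M. ?X \<omega> = x \<and> ?Y \<omega> = y}"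
    using indep_varD[OF X_Y_indep, of "{x}" "{y}"]
    by (simp add: vimage_def Int_def conj_commute conj_left_commute)
  also have "\<dots> \<le> prob (event_E \<alpha> d l M X Y)"
  proof (rule finite_measure_mono_AE[OF _ event_E_sets[OF l(3)]])
    show "AE \<omega> in M. \<omega> \<in> {\<omega> \<in> space M. ?X \<omega> = x \<and> ?Y \<omega> = y} \<longrightarrow> \<omega> \<in> event_E \<alpha> d l M X Y"
      using X_block_word[OF l] AE_space
    proof eventually_elim
      case (elim \<omega>)
      show ?case
      proof
        assume "\<omega> \<in> {\<omega> \<in> space M. ?X \<omega> = x \<and> ?Y \<omega> = y}"
        then have xy: "?X \<omega> = x" "?Y \<omega> = y" by auto
        have "X (d - ?h + 1) \<omega> = c"
        proof -
          have "d - ?h < 2 * d" using l by auto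
          then show ?thesis by (simp add: c_def xy(1)[symmetric] word_def nth_map_upt del: upt_Suc)
        qed
        then have "lcs_length (?X \<omega>) (?Y \<omega>)
            \<le> lcs_length (word X 1 (d - ?h) \<omega> @ word X (d + ?h + 1) (2 * d) \<omega>) (?Y \<omega>)"
          unfolding elim(1) xy(2) y_def using c' by (simp add: lcs_block_absent_letter)
        then have "real (lcs_length (?X \<omega>) (?Y \<omega>))
            \<le> real (lcs_length (word X 1 (d - ?h) \<omega> @ word X (d + ?h + 1) (2 * d) \<omega>) (?Y \<omega>))"
          by (rule of_nat_mono)
        also have "\<dots> < \<dots> + real d powr \<alpha>" using l by simp
        finally show "\<omega> \<in> event_E \<alpha> d l M X Y"
          unfolding event_E_def using elim(2) by (intro CollectI conjI)
      qed
    qed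
  qed
  finally show ?thesis .
qed

text \<open>If \<open>Xs\<close> and \<open>Y\<close> both equal \<open>0^d 1^d\<close>, then
  \<open>Xs\<close> scores \<open>2 * d\<close>. The outer parts of \<open>X\<close> are then almost
  surely fixed, and \<open>lcs_two_letter_block\<close> bounds its score by
  \<open>2 * d - l div 2\<close> for every block letter.\<close>

lemma prob_event_K_pos:
  assumes k: "k \<ge> 2" and l: "even l" "0 < l" "l \<le> 2 * d"
    and thr: "\<gamma>a / 2 * real d powr \<beta> - real d powr \<alpha> \<le> l div 2"
  shows "0 < prob (event_K \<alpha> \<beta> \<gamma>a d M X Xs Y)"
proof -
  let ?h = "l div 2" and ?Xs = "word Xs 1 (2 * d)" and ?Y = "word Y 1 (2 * d)"
  define y :: "nat list" where "y = replicate d 0 @ replicate d 1"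
  have U: "uniform_word M k (2 * d + 2 * d) (\<lambda>\<omega>. ?Xs \<omega> @ ?Y \<omega>)" using k by (intro uniform_XsY) simp
  have "y @ y \<in> words k (2 * d + 2 * d)" using k by (auto simp: words_def y_def)
  then have "0 < prob {\<omega> \<in> space M. ?Xs \<omega> @ ?Y \<omega> = y @ y}"
    using U k by (simp add: uniform_word_def)
  also have "\<dots> \<le> prob (event_K \<alpha> \<beta> \<gamma>a d M X Xs Y)"
  proof (rule finite_measure_mono_AE[OF _ event_K_sets])
    show "AE \<omega> in M. \<omega> \<in> {\<omega> \<in> space M. ?Xs \<omega> @ ?Y \<omega> = y @ y} \<longrightarrow> \<omega> \<in> event_K \<alpha> \<beta> \<gamma>a d M X Xs Y"
      using X_block_word[OF l] Xs_outside AE_space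
    proof eventually_elim
      case (elim \<omega>)
      show ?case
      proof
        assume "\<omega> \<in> {\<omega> \<in> space M. ?Xs \<omega> @ ?Y \<omega> = y @ y}"
        moreover have "length (?Xs \<omega>) = length y" by (simp add: y_def)
        ultimately have xy: "?Xs \<omega> = y" "?Y \<omega> = y" by auto
        have nth: "Xs (Suc i) \<omega> = y ! i" if "i < 2 * d" for i
          using that by (simp add: xy(1)[symmetric] word_def nth_map_upt del: upt_Suc)
        have left: "word X 1 (d - ?h) \<omega> = replicate (d - ?h) 0"
        proof (rule nth_equalityI)
          fix i assume "i < length (word X 1 (d - ?h) \<omega>)"
          then have i: "i < d - ?h" by simp
          then have "word X 1 (d - ?h) \<omega> ! i = X (Suc i) \<omega>"
            by (simp add: word_def nth_map_upt del: upt_Suc)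
          also have "\<dots> = Xs (Suc i) \<omega>" using elim(2) i by simp
          also have "\<dots> = 0" using i nth[of i] by (simp add: y_def nth_append)
          finally show "word X 1 (d - ?h) \<omega> ! i = replicate (d - ?h) 0 ! i" using i by simp
        qed simp
        have right: "word X (d + ?h + 1) (2 * d) \<omega> = replicate (d - ?h) 1"
        proof (rule nth_equalityI)
          fix i assume "i < length (word X (d + ?h + 1) (2 * d) \<omega>)"
          then have i: "i < d - ?h" by simp
          then have "word X (d + ?h + 1) (2 * d) \<omega> ! i = X (Suc (d + ?h + i)) \<omega>"
            by (simp add: word_def nth_map_upt del: upt_Suc)
          also have "\<dots> = Xs (Suc (d + ?h + i)) \<omega>"
          proof -
            have "Suc (d + ?h + i) \<in> {d + ?h + 1..2 * d}" using i l by auto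
            then show ?thesis using elim(2) by (metis UnI2)
          qed
          also have "\<dots> = 1" using i nth[of "d + ?h + i"] by (simp add: y_def nth_append)
          finally show "word X (d + ?h + 1) (2 * d) \<omega> ! i = replicate (d - ?h) 1 ! i" using i by simp
        qed (use l in simp)
        have l2: "l = 2 * ?h" "?h \<le> d" using l by auto
        have "lcs_length (word X 1 (2 * d) \<omega>) (?Y \<omega>) \<le> 2 * d - ?h"
          unfolding elim(1) left right xy(2) y_def
          using lcs_two_letter_block[OF l2(2), of "X (d - ?h + 1) \<omega>"] l2(1) by simp
        moreover have "lcs_length (?Xs \<omega>) (?Y \<omega>) = 2 * d"
          unfolding xy lcs_length_same by (simp add: y_def)
        ultimately have "real ?h \<le> real (lcs_length (?Xs \<omega>) (?Y \<omega>))
            - real (lcs_length (word X 1 (2 * d) \<omega>) (?Y \<omega>))"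
          using l2(2) by linarith
        then show "\<omega> \<in> event_K \<alpha> \<beta> \<gamma>a d M X Xs Y"
          using elim(3) thr by (simp add: event_K_def)
      qed
    qed
  qed
  finally show ?thesis .
qed

end

section \<open>Rounding of the block length, and uniform constants for all \<open>d\<close>\<close>

lemma block_length_bounds:
  assumes d: "d \<ge> 1" and b: "0 \<le> \<beta>" "\<beta> \<le> 1"
  shows "even (block_length \<beta> d)" "0 < block_length \<beta> d" "block_length \<beta> d \<le> 2 * d"
    and "\<bar>real (block_length \<beta> d) - real d powr \<beta>\<bar> \<le> 1"
proof -
  define x where "x = real d powr \<beta> / 2"
  have x: "1 / 2 \<le> x" "x \<le> d / 2"
    using d b powr_mono[of \<beta> 1 "real d"] by (auto simp: x_def ge_one_powr_ge_zero)
  have r: "\<bar>of_int (round x) - x\<bar> \<le> 1 / 2" by (rule of_int_round_abs_le)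
  \<comment> \<open>As \<open>x\<close> is at least \<open>1 / 2\<close>, it rounds to at least 1,
    so \<open>round_pos\<close> agrees with \<open>round\<close> here.\<close>
  have "1 \<le> round x" using x by (simp add: round_def le_floor_iff)
  then have rp: "real (round_pos x) = of_int (round x)" by (simp add: round_pos_def max_def)
  have bl: "block_length \<beta> d = 2 * round_pos x" by (simp add: block_length_def x_def)
  show "even (block_length \<beta> d)" "0 < block_length \<beta> d" by (simp_all add: bl round_pos_def)
  have "real_of_int (round x) \<le> x + 1 / 2" using abs_ge_self[of "of_int (round x) - x"] r by simp
  also have "x + 1 / 2 \<le> real d / 2 + 1 / 2" using x(2) by simp
  finally have "real (round_pos x) \<le> real d / 2 + 1 / 2" unfolding rp .
  then have "real (2 * round_pos x) \<le> real (d + 1)" by simp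
  then have "2 * round_pos x \<le> d + 1" by (simp only: of_nat_le_iff)
  then show "block_length \<beta> d \<le> 2 * d" using d by (simp add: bl)
  show "\<bar>real (block_length \<beta> d) - real d powr \<beta>\<bar> \<le> 1"
  proof -
    have "real d powr \<beta> = 2 * x" by (simp add: x_def)
    moreover have "\<bar>2 * (of_int (round x) - x)\<bar> \<le> 1" using r unfolding abs_mult by simp
    ultimately show ?thesis by (simp add: bl rp right_diff_distrib)
  qed
qed

text \<open>Below \<open>d0\<close>, any \<open>C \<le> P d / f d\<close> suffices because
  \<open>1 - exp (- u) \<le> u\<close>; the minimum of \<open>c\<close> and these finitely many
  positive ratios serves all \<open>d\<close>.\<close>

lemma exponential_bound_from_1:
  fixes P f :: "nat \<Rightarrow> real"
  assumes pos: "\<And>d. d \<ge> 1 \<Longrightarrow> 0 < P d" and f: "\<And>d. d \<ge> 1 \<Longrightarrow> 0 < f d"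
    and c: "0 < c" and ev: "\<And>d. d \<ge> 1 \<Longrightarrow> d \<ge> d0 \<Longrightarrow> 1 - exp (- c * f d) \<le> P d"
  shows "\<exists>C>0. \<forall>d\<ge>1. 1 - exp (- C * f d) \<le> P d"
proof -
  define S where "S = insert c ((\<lambda>d. P d / f d) ` {1..<d0})"
  have fin: "finite S" "S \<noteq> {}" by (auto simp: S_def)
  have "\<And>x. x \<in> S \<Longrightarrow> 0 < x" using c pos f by (auto simp: S_def)
  then have "0 < Min S" using Min_in[OF fin] by blast
  moreover have "1 - exp (- Min S * f d) \<le> P d" if d: "d \<ge> 1" for d
  proof (cases "d \<ge> d0")
    case True
    have "Min S \<le> c" using fin by (intro Min_le) (auto simp: S_def)
    then have "Min S * f d \<le> c * f d" using f[OF d] by (intro mult_right_mono) auto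
    then have "1 - exp (- Min S * f d) \<le> 1 - exp (- c * f d)" by simp
    also have "\<dots> \<le> P d" by (rule ev[OF d True])
    finally show ?thesis .
  next
    case False
    then have "Min S \<le> P d / f d" using fin d by (intro Min_le) (auto simp: S_def)
    then have "Min S * f d \<le> P d" using f[OF d] by (simp add: pos_le_divide_eq)
    then show ?thesis using exp_ge_add_one_self[of "- Min S * f d"] by simp
  qed
  ultimately show ?thesis by blast
qed

text \<open>\<open>U\<close> is the upper threshold for the score of \<open>X\<close>;
  \<open>B\<close> and \<open>B'\<close> are the lower thresholds for its outer parts and for
  \<open>Xs\<close>. The quantified \<open>l\<close> and \<open>m\<close> serve as
  abbreviations.\<close>

lemma (in alphabet) large_d_bounds:
  assumes diff: "mean_lcs k differentiable (at (p_M k))" and gap: "k * F 1 1 > 2"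
    and \<alpha>: "1 / 2 < \<alpha>" "\<alpha> \<le> 1" and \<beta>: "0 \<le> \<beta>" "\<beta> < 1"
  shows "eventually (\<lambda>d. \<forall>l m. l = block_length \<beta> d \<longrightarrow> m = d - l div 2 \<longrightarrow>
      (\<exists>U B B'. U \<le> B + real d powr \<alpha> \<and>
        F 1 1 / 2 * real d powr \<beta> - real d powr \<alpha> \<le> B' - U \<and>
        block_tail k m (2 * d) l U + lcs_tail k (2 * m) (2 * d) B
          \<le> exp (- (1 / 512) * real d powr (2 * \<alpha> - 1)) \<and>
        block_tail k m (2 * d) l U + lcs_tail k (2 * d) (2 * d) B'
          \<le> exp (- (1 / 512) * real d powr (2 * \<alpha> - 1)))) sequentially"
proof -
  obtain s where s: "0 < s" "F 1 1 + s / k < F 1 (1 + s)" by (rule F_slope[OF diff gap])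
  \<comment> \<open>The strict surplus \<open>\<delta>\<close> will cover
    \<open>2 * d - a \<le> \<delta> * a\<close>; bounding \<open>\<epsilon>\<close> by
    \<open>s\<close> too gives \<open>2 * d < a * (1 + s)\<close>.\<close>
  define \<delta> where "\<delta> = F 1 (1 + s) - F 1 1 - s / k"
  define \<epsilon> where "\<epsilon> = min \<delta> s"
  have eps: "0 < \<epsilon>" "\<epsilon> \<le> \<delta>" "\<epsilon> \<le> s" using s by (auto simp: \<epsilon>_def \<delta>_def)
  define C :: real where "C = 24 * k + 18"
  show ?thesis
    using rate_eventually_le[OF \<alpha>(1), of C] tails_eventually_le[OF \<alpha>(1), of "real k"] block_eventually_short[OF \<beta>(2) eps(1)] eventually_ge_at_top[of 1]
  proof eventually_elim
    case (elim d)
    show ?case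
    proof (intro allI impI)
      fix l m :: nat assume l: "l = block_length \<beta> d" and m: "m = d - l div 2"
      define a where "a = 2 * m"
      \<comment> \<open>Two deviations of size \<open>t\<close> make up
        \<open>d^\<alpha> / 2\<close>, which leaves \<open>d^\<alpha> / 2\<close> for the
        convergence error.\<close>
      define t where "t = real d powr \<alpha> / 4"
      define G where "G = C * (sqrt (2 * d) * (1 + ln (1 + 2 * d)))"
      define q where "q = exp (- (real d powr (2 * \<alpha> - 1) / 256))"
      note bl = block_length_bounds[OF elim(4) \<beta>(1) less_imp_le[OF \<beta>(2)], folded l]
      have al: "real a = 2 * real d - real l" using bl by (auto simp: a_def m)
      have "real l * (1 + \<epsilon>) \<le> (real d powr \<beta> + 1) * (1 + \<epsilon>)"
        using bl(4) eps by (intro mult_right_mono) auto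
      then have la: "real l < \<epsilon> * a" using elim(3) by (simp add: al algebra_simps)
      have a0: "0 < real a"
        using la bl(2) eps by (metis less_trans of_nat_0_less_iff zero_less_mult_pos)
      have a2d: "a \<le> 2 * d" by (simp add: a_def m)
      have incr: "F a (real (2 * d) - x) + x / k \<le> F a (real (2 * d))" if "0 \<le> x" "x \<le> real (2 * d)" for x
      proof (rule F_increment[OF s(1), of \<delta>])
        show "0 \<le> \<delta>" "F 1 1 + s / k + \<delta> \<le> F 1 (1 + s)" using eps by (simp_all add: \<delta>_def)
        have "\<epsilon> * a \<le> \<delta> * a" "\<epsilon> * a \<le> s * a" using eps by (intro mult_right_mono; simp)+
        then show "real (2 * d) - a \<le> \<delta> * a" "real (2 * d) < a * (1 + s)"
          using la al distrib_left[of a 1 s] by (simp_all add: mult.commute)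
      qed (use that a0 a2d in auto)
      have t: "0 \<le> t" "t \<le> real d"
        using \<alpha> elim(4) powr_mono[of \<alpha> 1 "real d"] by (auto simp: t_def)
      \<comment> \<open>The total length is at most \<open>4 * d\<close>, and
        \<open>t^2 / (16 * d) = d^(2 \<alpha> - 1) / 256\<close>, whence the constant in
        \<open>q\<close>.\<close>
      have tail: "exp (- (t\<^sup>2 / (4 * real (a' + 2 * d)))) \<le> q" if "a' \<le> 2 * d" for a'
      proof -
        have "t\<^sup>2 = real d powr (2 * \<alpha>) / 16"
          by (simp add: t_def power2_eq_square powr_add[symmetric])
        also have "real d powr (2 * \<alpha>) = d * real d powr (2 * \<alpha> - 1)"
          using elim(4) by (simp add: powr_mult_base)
        finally have "t\<^sup>2 / (16 * d) = (d * real d powr (2 * \<alpha> - 1) / 16) / (16 * d)"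
          by (rule arg_cong)
        then have "t\<^sup>2 / (16 * d) = real d powr (2 * \<alpha> - 1) / 256"
          using elim(4) by (simp add: divide_simps)
        moreover have "t\<^sup>2 / (16 * d) \<le> t\<^sup>2 / (4 * real (a' + 2 * d))"
          using that elim(4) by (intro divide_left_mono) auto
        ultimately have "real d powr (2 * \<alpha> - 1) / 256 \<le> t\<^sup>2 / (4 * real (a' + 2 * d))"
          by (simp only:)
        then show ?thesis unfolding q_def by (simp only: exp_le_cancel_iff neg_le_iff_le)
      qed
      have rate: "F a' b \<le> elcs a' b + G" if "0 < a'" "a' \<le> 2 * d" for a' b
      proof -
        have "sqrt a' * (1 + ln (1 + a')) \<le> sqrt (2 * d) * (1 + ln (1 + 2 * d))"
          using that by (intro mult_mono) auto
        then have "C * (sqrt a' * (1 + ln (1 + a'))) \<le> G"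
          unfolding G_def by (intro mult_left_mono) (auto simp: C_def)
        then show ?thesis using F_le_elcs[OF that(1), of b] by (simp add: C_def)
      qed
      define U where "U = F a (real (2 * d)) + t"
      define B where "B = elcs a (2 * d) - t"
      define B' where "B' = elcs (2 * d) (2 * d) - t"
      have EB: "U \<le> B + real d powr \<alpha>"
        using rate[of a "2 * d"] a0 a2d elim(1) by (simp add: U_def B_def G_def t_def)
      have g: "0 \<le> F 1 1" "F 1 1 \<le> 1" using F_nonneg[of 1 1] F_le1[of 1 1] by auto
      have KB: "F 1 1 / 2 * real d powr \<beta> - real d powr \<alpha> \<le> B' - U"
      proof -
        have "real (2 * d) - real l = a" using al by simp
        then have "F a (real (2 * d)) + real l / 2 * F 1 1 \<le> F (real (2 * d)) (real (2 * d))"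
          using F_diag_gap[of "real l" "real (2 * d)"] bl by simp
        moreover have "(real d powr \<beta> - 1) / 2 * F 1 1 \<le> real l / 2 * F 1 1"
          using bl(4) g by (intro mult_right_mono) auto
        moreover have "F (real (2 * d)) (real (2 * d)) \<le> elcs (2 * d) (2 * d) + G"
          using elim(4) by (intro rate) auto
        ultimately show ?thesis
          using elim(1) g by (simp add: U_def B'_def G_def t_def algebra_simps)
      qed
      have "block_tail k m (2 * d) l U
          \<le> real (k * (2 * d + 1)\<^sup>2) * exp (- (t\<^sup>2 / (4 * real (a + 2 * d))))"
        unfolding U_def a_def
        using t elim(4) incr[unfolded a_def] by (intro block_tail_le) auto
      also have "\<dots> \<le> real (k * (2 * d + 1)\<^sup>2) * q"
        using tail[OF a2d] by (intro mult_left_mono) auto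
      finally have f1: "block_tail k m (2 * d) l U \<le> real (k * (2 * d + 1)\<^sup>2) * q" .
      have f2: "lcs_tail k a' (2 * d) (elcs a' (2 * d) - t) \<le> q" if "a' \<le> 2 * d" for a'
        using t elim(4) by (intro order.trans[OF lcs_tail_le tail[OF that]]) auto
      have total: "real (k * (2 * d + 1)\<^sup>2) * q + q \<le> exp (- (1 / 512) * real d powr (2 * \<alpha> - 1))"
        using elim(2) by (simp add: q_def algebra_simps)
      show "\<exists>U B B'. U \<le> B + real d powr \<alpha> \<and>
        F 1 1 / 2 * real d powr \<beta> - real d powr \<alpha> \<le> B' - U \<and>
        block_tail k m (2 * d) l U + lcs_tail k (2 * m) (2 * d) B
          \<le> exp (- (1 / 512) * real d powr (2 * \<alpha> - 1)) \<and>
        block_tail k m (2 * d) l U + lcs_tail k (2 * d) (2 * d) B'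
          \<le> exp (- (1 / 512) * real d powr (2 * \<alpha> - 1))"
      proof (intro exI conjI)
        show "U \<le> B + real d powr \<alpha>" by (rule EB)
        show "F 1 1 / 2 * real d powr \<beta> - real d powr \<alpha> \<le> B' - U" by (rule KB)
        show "block_tail k m (2 * d) l U + lcs_tail k (2 * m) (2 * d) B
            \<le> exp (- (1 / 512) * real d powr (2 * \<alpha> - 1))"
          using add_mono[OF f1 f2[OF a2d]] total unfolding B_def a_def by (rule order.trans)
        show "block_tail k m (2 * d) l U + lcs_tail k (2 * d) (2 * d) B'
            \<le> exp (- (1 / 512) * real d powr (2 * \<alpha> - 1))"
          using add_mono[OF f1 f2[OF order.refl]] total unfolding B'_def by (rule order.trans)
      qed
    qed
  qed
qed

theorem theorem3p1:
  fixes k :: nat and \<alpha> \<beta> \<gamma>a :: real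
    and M :: "nat \<Rightarrow> 'a measure" and X Xs Y :: "nat \<Rightarrow> nat \<Rightarrow> 'a \<Rightarrow> nat"
  assumes "k \<ge> 2" and "real k * mean_lcs_star k > 2"
    and "mean_lcs k differentiable (at (p_M k))"
    and "1 / 2 < \<alpha>" and "\<alpha> < \<beta>" and "\<beta> < 1"
    and "\<gamma>a < mean_lcs_star k"
    and "\<And>d. d \<ge> 1 \<Longrightarrow> long_block_model (M d) k d (block_length \<beta> d) (X d) (Xs d) (Y d)"
  shows "\<exists>C_E > 0. \<exists>C_K > 0. \<forall>d \<ge> 1.
     measure (M d) (event_E \<alpha> d (block_length \<beta> d) (M d) (X d) (Y d))
       \<ge> 1 - exp (- C_E * real d powr (2 * \<alpha> - 1)) \<and>
     measure (M d) (event_K \<alpha> \<beta> \<gamma>a d (M d) (X d) (Xs d) (Y d))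
       \<ge> 1 - exp (- C_K * real d powr (2 * \<alpha> - 1))"
proof -
  have k: "k > 0" using assms(1) by simp
  interpret alphabet k by unfold_locales (rule k)
  let ?l = "block_length \<beta>"
  let ?E = "\<lambda>d. measure (M d) (event_E \<alpha> d (?l d) (M d) (X d) (Y d))"
  let ?K = "\<lambda>d. measure (M d) (event_K \<alpha> \<beta> \<gamma>a d (M d) (X d) (Xs d) (Y d))"
  have \<alpha>\<beta>: "\<alpha> \<le> 1" "0 \<le> \<beta>" "\<beta> \<le> 1" using assms by auto
  note bl = block_length_bounds[OF _ \<alpha>\<beta>(2,3)]
  have ga: "\<gamma>a \<le> F 1 1" "F 1 1 \<le> 1" using assms(7) F_le1[of 1 1] by (auto simp: mean_lcs_star_eq)
  have gap: "k * F 1 1 > 2" using assms(2) by (simp add: mean_lcs_star_eq)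
  obtain d0 where d0: "\<And>d. d \<ge> d0 \<Longrightarrow> \<forall>l m. l = ?l d \<longrightarrow> m = d - l div 2 \<longrightarrow>
      (\<exists>U B B'. U \<le> B + real d powr \<alpha> \<and>
        F 1 1 / 2 * real d powr \<beta> - real d powr \<alpha> \<le> B' - U \<and>
        block_tail k m (2 * d) l U + lcs_tail k (2 * m) (2 * d) B
          \<le> exp (- (1 / 512) * real d powr (2 * \<alpha> - 1)) \<and>
        block_tail k m (2 * d) l U + lcs_tail k (2 * d) (2 * d) B'
          \<le> exp (- (1 / 512) * real d powr (2 * \<alpha> - 1)))"
    using large_d_bounds[OF assms(3) gap assms(4) \<alpha>\<beta>(1,2) assms(6)]
    unfolding eventually_sequentially by blast
  have large: "1 - exp (- (1 / 512) * real d powr (2 * \<alpha> - 1)) \<le> ?E d"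
    "1 - exp (- (1 / 512) * real d powr (2 * \<alpha> - 1)) \<le> ?K d" if d: "d \<ge> 1" "d \<ge> d0" for d
  proof -
    interpret long_block_model "M d" k d "?l d" "X d" "Xs d" "Y d" by (rule assms(8)[OF d(1)])
    let ?m = "d - ?l d div 2"
    obtain U B B' where *: "U \<le> B + real d powr \<alpha>"
      "F 1 1 / 2 * real d powr \<beta> - real d powr \<alpha> \<le> B' - U"
      "block_tail k ?m (2 * d) (?l d) U + lcs_tail k (2 * ?m) (2 * d) B
        \<le> exp (- (1 / 512) * real d powr (2 * \<alpha> - 1))"
      "block_tail k ?m (2 * d) (?l d) U + lcs_tail k (2 * d) (2 * d) B'
        \<le> exp (- (1 / 512) * real d powr (2 * \<alpha> - 1))"
      using d0[OF d(2), rule_format, OF refl refl] by blast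
    show "1 - exp (- (1 / 512) * real d powr (2 * \<alpha> - 1)) \<le> ?E d"
      using prob_event_E_ge[OF k bl(1-3)[OF d(1)] *(1)] *(3) by linarith
    have "\<gamma>a / 2 * real d powr \<beta> \<le> F 1 1 / 2 * real d powr \<beta>"
      using ga by (intro mult_right_mono) auto
    then have "\<gamma>a / 2 * real d powr \<beta> - real d powr \<alpha> \<le> B' - U" using *(2) by linarith
    from prob_event_K_ge[OF k bl(1-3)[OF d(1)] this] *(4)
    show "1 - exp (- (1 / 512) * real d powr (2 * \<alpha> - 1)) \<le> ?K d" by linarith
  qed
  have pos: "0 < ?E d" "0 < ?K d" if d: "d \<ge> 1" for d
  proof -
    interpret long_block_model "M d" k d "?l d" "X d" "Xs d" "Y d" by (rule assms(8)[OF d])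
    show "0 < ?E d" by (rule prob_event_E_pos[OF assms(1) bl(1-3)[OF d]])
    \<comment> \<open>The rounding of the block can cost \<open>1 / 2\<close> in the comparison with
      half its length; this term covers it.\<close>
    have "1 \<le> real d powr \<alpha>" using d assms(4) by (simp add: ge_one_powr_ge_zero)
    moreover have "\<gamma>a / 2 * real d powr \<beta> \<le> 1 / 2 * real d powr \<beta>"
      using ga by (intro mult_right_mono) auto
    moreover have "real (?l d div 2) = real (?l d) / 2" using bl(1)[OF d] by (auto elim: evenE)
    ultimately have "\<gamma>a / 2 * real d powr \<beta> - real d powr \<alpha> \<le> ?l d div 2"
      using bl(4)[OF d] by (simp add: abs_le_iff)
    then show "0 < ?K d" by (rule prob_event_K_pos[OF assms(1) bl(1-3)[OF d]])
  qed
  have f: "0 < real d powr (2 * \<alpha> - 1)" if "d \<ge> 1" for d using that by simp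
  have "\<exists>C>0. \<forall>d\<ge>1. 1 - exp (- C * real d powr (2 * \<alpha> - 1)) \<le> ?E d"
    by (rule exponential_bound_from_1[of ?E "\<lambda>d. real d powr (2 * \<alpha> - 1)" "1 / 512" d0])
      (use pos f large in auto)
  moreover have "\<exists>C>0. \<forall>d\<ge>1. 1 - exp (- C * real d powr (2 * \<alpha> - 1)) \<le> ?K d"
    by (rule exponential_bound_from_1[of ?K "\<lambda>d. real d powr (2 * \<alpha> - 1)" "1 / 512" d0])
      (use pos f large in auto)
  ultimately show ?thesis by blast
qed

end
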